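(* Let $G$ be a finite group of covariant dimension $2$. Then $G$ is isomorphic to a subgroup of $\mathrm{GL}_2(\mathbb C)$.
   Context: The base field is $\mathbb C$; all $G$-modules are finite-dimensional over $\mathbb C$. A covariant of a finite group $G$ is a $G$-equivariant morphism (polynomial map) $\varphi\colon V\to W$ between $G$-modules; its dimension is $\dim\varphi:=\dim\overline{\varphi(V)}$. It is faithful if $G$ acts faithfully on the image $\varphi(V)$. The covariant dimension $\operatorname{covdim} G$ is the minimum of $\dim\varphi$ over all faithful covariants $\varphi$ of $G$. *)

theory Defs
  imports
    "HOL-Analysis.Abstract_Topology"
    "HOL-Algebra.Coset"
    "HOL-Library.Poly_Mapping"
    "HOL-Library.Extended_Nat"
    "Jordan_Normal_Form.Matrix"
begin

subsection \<open>Polynomials and the Zariski topology on affine space\<close>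

text \<open>A polynomial is a finitely supported map from monomials (finitely supported exponent
  maps) to coefficients.\<close>

type_synonym cpoly = "(nat \<Rightarrow>\<^sub>0 nat) \<Rightarrow>\<^sub>0 complex"

definition polynomials :: "nat \<Rightarrow> cpoly set" where
  "polynomials n = {p. \<forall>m \<in> Poly_Mapping.keys p. Poly_Mapping.keys m \<subseteq> {..<n}}"

definition poly_eval :: "complex vec \<Rightarrow> cpoly \<Rightarrow> complex" where
  "poly_eval v p = (\<Sum>m \<in> Poly_Mapping.keys p. Poly_Mapping.lookup p m * (\<Prod>i \<in> Poly_Mapping.keys m. (v $ i) ^ Poly_Mapping.lookup m i))"

definition zero_locus :: "nat \<Rightarrow> cpoly set \<Rightarrow> complex vec set" where
  "zero_locus n S = {v \<in> carrier_vec n. \<forall>p \<in> S. poly_eval v p = 0}"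

definition zariski :: "nat \<Rightarrow> complex vec topology" where
  "zariski n =
     topology (\<lambda>U. \<exists>S \<subseteq> polynomials n. U = carrier_vec n - zero_locus n S)"

lemma poly_eval_superset:
  assumes "finite A" "Poly_Mapping.keys p \<subseteq> A"
  shows "poly_eval v p = (\<Sum>m \<in> A. Poly_Mapping.lookup p m * (\<Prod>i \<in> Poly_Mapping.keys m. (v $ i) ^ Poly_Mapping.lookup m i))"
  unfolding poly_eval_def
  by (rule sum.mono_neutral_left) (use assms in \<open>auto simp: in_keys_iff\<close>)

lemma poly_eval_zero [simp]: "poly_eval v 0 = 0"
  by (simp add: poly_eval_def)

lemma poly_eval_one [simp]: "poly_eval v 1 = 1"
  by (simp add: poly_eval_def)

lemma poly_eval_add: "poly_eval v (p + q) = poly_eval v p + poly_eval v q"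
proof -
  let ?A = "Poly_Mapping.keys p \<union> Poly_Mapping.keys q"
  have "Poly_Mapping.keys (p + q) \<subseteq> ?A" by (rule keys_add)
  then show ?thesis
    by (simp add: poly_eval_superset[of ?A] lookup_add algebra_simps sum.distrib)
qed

lemma poly_eval_sum: "poly_eval v (sum f A) = (\<Sum>x \<in> A. poly_eval v (f x))"
  by (induction A rule: infinite_finite_induct) (auto simp: poly_eval_add)

lemma poly_eval_single:
  "poly_eval v (Poly_Mapping.single m c) = c * (\<Prod>i \<in> Poly_Mapping.keys m. (v $ i) ^ Poly_Mapping.lookup m i)"
  by (simp add: poly_eval_def)

lemma monomial_eval_add:
  "(\<Prod>i \<in> Poly_Mapping.keys (a + b). (v $ i) ^ Poly_Mapping.lookup (a + b) i) =
   (\<Prod>i \<in> Poly_Mapping.keys a. (v $ i) ^ Poly_Mapping.lookup a i) * (\<Prod>i \<in> Poly_Mapping.keys b. (v $ i) ^ Poly_Mapping.lookup b i)"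
  for a b :: "nat \<Rightarrow>\<^sub>0 nat" and v :: "complex vec"
proof -
  let ?A = "Poly_Mapping.keys a \<union> Poly_Mapping.keys b"
  have *: "(\<Prod>i \<in> Poly_Mapping.keys c. (v $ i) ^ Poly_Mapping.lookup c i) = (\<Prod>i \<in> ?A. (v $ i) ^ Poly_Mapping.lookup c i)"
    if "Poly_Mapping.keys c \<subseteq> ?A" for c
    by (rule prod.mono_neutral_left) (use that in \<open>auto simp: in_keys_iff\<close>)
  show ?thesis
    using *[of a] *[of b] *[of "a + b"] keys_add[of a b]
    by (simp add: lookup_add power_add prod.distrib)
qed

lemma sum_singles: "p = (\<Sum>m \<in> Poly_Mapping.keys p. Poly_Mapping.single m (Poly_Mapping.lookup p m))"
  by (rule poly_mapping_eqI) (auto simp: lookup_sum lookup_single when_def in_keys_iff)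

lemma poly_eval_mult: "poly_eval v (p * q) = poly_eval v p * poly_eval v q"
proof -
  have "p * q = (\<Sum>a \<in> Poly_Mapping.keys p. Poly_Mapping.single a (Poly_Mapping.lookup p a)) *
      (\<Sum>b \<in> Poly_Mapping.keys q. Poly_Mapping.single b (Poly_Mapping.lookup q b))"
    by (rule arg_cong2[OF sum_singles sum_singles])
  also have "\<dots> = (\<Sum>a \<in> Poly_Mapping.keys p. \<Sum>b \<in> Poly_Mapping.keys q.
      Poly_Mapping.single (a + b) (Poly_Mapping.lookup p a * Poly_Mapping.lookup q b))"
    by (simp add: sum_product mult_single)
  finally show ?thesis
    by (simp only: poly_eval_sum poly_eval_single monomial_eval_add)
       (simp add: poly_eval_def sum_product mult_ac)
qed

lemma polynomials_mult:
  assumes "p \<in> polynomials n" "q \<in> polynomials n"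
  shows "p * q \<in> polynomials n"
proof -
  have "Poly_Mapping.keys m \<subseteq> {..<n}" if m: "m \<in> Poly_Mapping.keys (p * q)" for m
  proof -
    obtain a b where "m = a + b" "a \<in> Poly_Mapping.keys p" "b \<in> Poly_Mapping.keys q"
      using subsetD[OF keys_mult m] by auto
    then show ?thesis
      using assms keys_add[of a b] unfolding polynomials_def by blast
  qed
  then show ?thesis by (auto simp: polynomials_def)
qed

lemma istopology_zariski:
  "istopology (\<lambda>U. \<exists>S \<subseteq> polynomials n. U = carrier_vec n - zero_locus n S)"
  unfolding istopology_def
proof (intro conjI allI impI)
  fix U V
  assume "\<exists>S \<subseteq> polynomials n. U = carrier_vec n - zero_locus n S"
    and "\<exists>S \<subseteq> polynomials n. V = carrier_vec n - zero_locus n S"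
  then obtain S T where S: "S \<subseteq> polynomials n" "U = carrier_vec n - zero_locus n S"
    and T: "T \<subseteq> polynomials n" "V = carrier_vec n - zero_locus n T"
    by blast
  let ?R = "(\<lambda>(p, q). p * q) ` (S \<times> T)"
  have "?R \<subseteq> polynomials n"
    using S(1) T(1) polynomials_mult by fastforce
  moreover have "U \<inter> V = carrier_vec n - zero_locus n ?R"
    unfolding S(2) T(2) zero_locus_def by (auto simp: poly_eval_mult)
  ultimately show "\<exists>S \<subseteq> polynomials n. U \<inter> V = carrier_vec n - zero_locus n S"
    by blast
next
  fix \<K>
  assume "\<forall>K \<in> \<K>. \<exists>S \<subseteq> polynomials n. K = carrier_vec n - zero_locus n S"
  then obtain S where S: "\<And>K. K \<in> \<K> \<Longrightarrow> S K \<subseteq> polynomials n"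
    "\<And>K. K \<in> \<K> \<Longrightarrow> K = carrier_vec n - zero_locus n (S K)"
    by metis
  have "\<Union>\<K> = (\<Union>K \<in> \<K>. K)"
    by simp
  also have "\<dots> = (\<Union>K \<in> \<K>. carrier_vec n - zero_locus n (S K))"
    by (rule SUP_cong[OF refl S(2)])
  also have "\<dots> = carrier_vec n - zero_locus n (\<Union>K \<in> \<K>. S K)"
    by (auto simp: zero_locus_def)
  finally show "\<exists>S \<subseteq> polynomials n. \<Union>\<K> = carrier_vec n - zero_locus n S"
    using S(1) by (intro exI[of _ "\<Union>K \<in> \<K>. S K"] conjI UN_least)
qed

lemma openin_zariski:
  "openin (zariski n) U \<longleftrightarrow> (\<exists>S \<subseteq> polynomials n. U = carrier_vec n - zero_locus n S)"
  unfolding zariski_def topology_inverse'[OF istopology_zariski] ..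

lemma topspace_zariski [simp]: "topspace (zariski n) = carrier_vec n"
proof
  show "topspace (zariski n) \<subseteq> carrier_vec n"
    using openin_topspace[of "zariski n"] unfolding openin_zariski by blast
  have "carrier_vec n = carrier_vec n - zero_locus n {1}"
    by (auto simp: zero_locus_def)
  moreover have "{1} \<subseteq> polynomials n"
    by (auto simp: polynomials_def)
  ultimately show "carrier_vec n \<subseteq> topspace (zariski n)"
    by (metis openin_subset openin_zariski)
qed

lemma closedin_zariski:
  "closedin (zariski n) Z \<longleftrightarrow> (\<exists>S \<subseteq> polynomials n. Z = zero_locus n S)"
proof -
  have sub: "zero_locus n S \<subseteq> carrier_vec n" for S
    by (auto simp: zero_locus_def)
  have eq: "Z \<subseteq> carrier_vec n \<and> carrier_vec n - Z = carrier_vec n - zero_locus n S \<longleftrightarrow>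
      Z = zero_locus n S" for S
    using sub[of S] by blast
  show ?thesis
    unfolding closedin_def openin_zariski topspace_zariski using eq by blast
qed

subsection \<open>Dimension of a topological space\<close>

definition irreducible_closed :: "'a topology \<Rightarrow> 'a set \<Rightarrow> bool" where
  "irreducible_closed X Z \<longleftrightarrow> closedin X Z \<and> Z \<noteq> {} \<and>
     (\<forall>A B. closedin X A \<and> closedin X B \<and> Z = A \<union> B \<longrightarrow> Z = A \<or> Z = B)"

definition krull_dim :: "'a topology \<Rightarrow> enat" where
  "krull_dim X = Sup {enat k | k. \<exists>Z :: nat \<Rightarrow> 'a set.
     (\<forall>i \<le> k. irreducible_closed X (Z i)) \<and> (\<forall>i < k. Z i \<subset> Z (Suc i))}"

subsection \<open>Modules and covariants\<close>

text \<open>A finite-dimensional complex module is given in coordinates: its underlying space is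
  \<^term>\<open>carrier_vec n :: complex vec set\<close> and the action is a homomorphism to the group of
  invertible matrices.\<close>

definition GL :: "nat \<Rightarrow> complex mat monoid" where
  "GL n = units_of (ring_mat TYPE(complex) n ())"

definition gmodule :: "('g, 'x) monoid_scheme \<Rightarrow> nat \<Rightarrow> ('g \<Rightarrow> complex mat) \<Rightarrow> bool" where
  "gmodule G n \<rho> \<longleftrightarrow> \<rho> \<in> hom G (GL n)"

definition polynomial_map :: "nat \<Rightarrow> nat \<Rightarrow> (complex vec \<Rightarrow> complex vec) \<Rightarrow> bool" where
  "polynomial_map n m \<phi> \<longleftrightarrow> (\<exists>p. (\<forall>j < m. p j \<in> polynomials n) \<and>
     (\<forall>v \<in> carrier_vec n. \<phi> v = vec m (\<lambda>j. poly_eval v (p j))))"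

definition covariant ::
  "('g, 'x) monoid_scheme \<Rightarrow> nat \<Rightarrow> ('g \<Rightarrow> complex mat) \<Rightarrow> nat \<Rightarrow> ('g \<Rightarrow> complex mat) \<Rightarrow>
   (complex vec \<Rightarrow> complex vec) \<Rightarrow> bool" where
  "covariant G n \<rho> m \<sigma> \<phi> \<longleftrightarrow> gmodule G n \<rho> \<and> gmodule G m \<sigma> \<and> polynomial_map n m \<phi> \<and>
     (\<forall>g \<in> carrier G. \<forall>v \<in> carrier_vec n. \<phi> (\<rho> g *\<^sub>v v) = \<sigma> g *\<^sub>v \<phi> v)"

definition faithful_covariant ::
  "('g, 'x) monoid_scheme \<Rightarrow> nat \<Rightarrow> ('g \<Rightarrow> complex mat) \<Rightarrow> nat \<Rightarrow> ('g \<Rightarrow> complex mat) \<Rightarrow>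
   (complex vec \<Rightarrow> complex vec) \<Rightarrow> bool" where
  "faithful_covariant G n \<rho> m \<sigma> \<phi> \<longleftrightarrow> covariant G n \<rho> m \<sigma> \<phi> \<and>
     (\<forall>g \<in> carrier G. (\<forall>w \<in> \<phi> ` carrier_vec n. \<sigma> g *\<^sub>v w = w) \<longrightarrow> g = \<one>\<^bsub>G\<^esub>)"

definition covariant_dim :: "nat \<Rightarrow> nat \<Rightarrow> (complex vec \<Rightarrow> complex vec) \<Rightarrow> enat" where
  "covariant_dim n m \<phi> =
     krull_dim (subtopology (zariski m) (Abstract_Topology.closure_of (zariski m) (\<phi> ` carrier_vec n)))"

text \<open>The infimum in \<^typ>\<open>enat\<close> of a nonempty set is attained, so this is the minimum.\<close>

definition covdim :: "('g, 'x) monoid_scheme \<Rightarrow> enat" where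
  "covdim G = Inf {d.
     \<exists>n \<rho> m \<sigma> \<phi>. faithful_covariant G n \<rho> m \<sigma> \<phi> \<and> d = covariant_dim n m \<phi>}"

end

theory Submission
  imports Defs
    "HOL-Computational_Algebra.Polynomial_Factorial"
    "HOL-Computational_Algebra.Fundamental_Theorem_Algebra"
    "HOL-Computational_Algebra.Field_as_Ring"
begin

text \<open>
  A covariant of dimension at most 2 spans a \<open>G\<close>-stable space of polynomials whose \<open>3 \<times> 3\<close>
  Jacobian minors vanish. Replacing a space by its initial forms keeps these properties, so one may
  pass to a finite faithful family of \<open>G\<close>-stable spaces that are homogeneous for the ordinary
  grading and for the gradings by the isotypic projections of all central elements. By Euler's
  identity the multidegrees of the family then span a lattice of rank at most 2, and this lattice
  determines the characters by which the centre acts.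

  If all spaces are one-dimensional, \<open>G\<close> is abelian and two of these characters embed it as
  diagonal matrices. Otherwise the lattice has rank at most 1, so the centre has a faithful
  character. Quotients of equal multidegree form a field of transcendence degree 1; restricting them
  to a general line and applying Lueroth's theorem yields coprime forms \<open>a\<close>, \<open>b\<close> of equal degree such
  that every space of the family is a common factor times binary forms in \<open>a\<close>, \<open>b\<close>. Hence \<open>G\<close> acts
  linearly on the span of \<open>a\<close> and \<open>b\<close>, and elements acting there as scalars are central, hence form
  a cyclic group. Twisting by a character of \<open>G\<close> makes this two-dimensional representation faithful.
\<close>

section \<open>Polynomials in countably many variables\<close>

text \<open>The hypothesis enters only through the vanishing of the minors. This is a first-order
  condition that survives degeneration, so no dimension theory is required for the spaces of initial
  forms. Faithfulness survives because an element fixing all initial forms acts unipotently, and a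
  unipotent operator of finite order over the complex numbers is trivial. Central elements supply
  the gradings because the final obstruction is central: an element that is scalar on the span of
  \<open>a\<close> and \<open>b\<close> is scalar on every member of the family. The grading of the
  neutral element is the ordinary one. Two independent polynomials of the same multidegree have a
  nonconstant quotient of multidegree zero, which uses up one of the two available dimensions; this
  is why the rank drops from 2 to 1. Lueroth's theorem for one variable suffices because restriction
  to a line loses nothing: if \<open>u / b\<close> depends functionally on \<open>f2 / f1\<close>,
  and \<open>f2 / f1\<close> varies along the line, then \<open>u\<close> vanishes identically once
  it vanishes on the line.\<close>

definition Const :: "complex \<Rightarrow> cpoly" where
  "Const c = Poly_Mapping.single 0 c"

definition Var :: "nat \<Rightarrow> cpoly" where
  "Var i = Poly_Mapping.single (Poly_Mapping.single i 1) 1"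

lemma Const_hom: "comm_ring_hom Const"
  by unfold_locales (auto simp: Const_def single_add mult_single)

interpretation Const: comm_ring_hom Const by (rule Const_hom)

lemma Const_eq_iff [simp]: "Const c = Const d \<longleftrightarrow> c = d"
  by (metis Const_def lookup_single_eq)

lemma Const_eq_0_iff [simp]: "Const c = 0 \<longleftrightarrow> c = 0"
  using Const_eq_iff[of c 0] by (simp del: Const_eq_iff)

lemma polynomials_0 [simp]: "0 \<in> polynomials n"
  and polynomials_1 [simp]: "1 \<in> polynomials n"
  by (auto simp: polynomials_def)

lemma polynomials_add: "p \<in> polynomials n \<Longrightarrow> q \<in> polynomials n \<Longrightarrow> p + q \<in> polynomials n"
  unfolding polynomials_def using keys_add[of p q] by blast

lemma polynomials_uminus: "p \<in> polynomials n \<Longrightarrow> - p \<in> polynomials n"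
  unfolding polynomials_def by simp

lemma polynomials_diff: "p \<in> polynomials n \<Longrightarrow> q \<in> polynomials n \<Longrightarrow> p - q \<in> polynomials n"
  using polynomials_add[of p n "- q"] polynomials_uminus[of q n] by simp

lemma polynomials_sum: "(\<And>i. i \<in> A \<Longrightarrow> f i \<in> polynomials n) \<Longrightarrow> sum f A \<in> polynomials n"
  by (induction A rule: infinite_finite_induct) (auto intro: polynomials_add)

lemma polynomials_power: "p \<in> polynomials n \<Longrightarrow> p ^ k \<in> polynomials n"
  by (induction k) (auto intro: polynomials_mult)

lemma polynomials_Const [simp]: "Const c \<in> polynomials n"
  by (auto simp: polynomials_def Const_def)

lemma polynomials_Var: "i < n \<Longrightarrow> Var i \<in> polynomials n"
  by (auto simp: polynomials_def Var_def)

lemma polynomials_mono: "n \<le> m \<Longrightarrow> polynomials n \<subseteq> polynomials m"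
  by (force simp: polynomials_def)

lemma ex_polynomials: "\<exists>n. p \<in> polynomials n"
proof -
  have "finite (\<Union>m\<in>Poly_Mapping.keys p. Poly_Mapping.keys m)" by auto
  then obtain n where "\<forall>x\<in>(\<Union>m\<in>Poly_Mapping.keys p. Poly_Mapping.keys m). x < n"
    using finite_nat_set_iff_bounded by blast
  then show ?thesis by (auto simp: polynomials_def intro!: exI[of _ n])
qed

lemma single_power_Var: "Poly_Mapping.single (Poly_Mapping.single i k) 1 = Var i ^ k"
proof (induction k)
  case (Suc k)
  have "Poly_Mapping.single i (Suc k) = Poly_Mapping.single i 1 + Poly_Mapping.single i k"
    by (simp flip: single_add)
  then show ?case
    using mult_single[of "Poly_Mapping.single i 1" "1::complex" "Poly_Mapping.single i k" 1]
    by (simp add: Suc.IH Var_def)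
qed simp

lemma single_sum_monomial:
  "finite A \<Longrightarrow> Poly_Mapping.single (sum h A) (1::complex) = (\<Prod>i\<in>A. Poly_Mapping.single (h i :: nat \<Rightarrow>\<^sub>0 nat) 1)"
proof (induction A rule: finite_induct)
  case (insert a A)
  then show ?case using mult_single[of "h a" "1::complex" "sum h A" 1] by simp
qed simp

lemma monomial_eq_prod:
  "Poly_Mapping.single m c = Const c * (\<Prod>i\<in>Poly_Mapping.keys m. Var i ^ Poly_Mapping.lookup m i)"
proof -
  have "Poly_Mapping.single m (1::complex) =
      (\<Prod>i\<in>Poly_Mapping.keys m. Poly_Mapping.single (Poly_Mapping.single i (Poly_Mapping.lookup m i)) 1)"
    by (subst sum_singles[of m], subst single_sum_monomial) auto
  then have "Poly_Mapping.single m (1::complex) =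
      (\<Prod>i\<in>Poly_Mapping.keys m. Var i ^ Poly_Mapping.lookup m i)"
    by (simp add: single_power_Var)
  then show ?thesis
    by (metis Const_def mult_single add.left_neutral mult.right_neutral)
qed

lemma polynomials_induct [consumes 1, case_names Const Var add mult]:
  assumes "p \<in> polynomials n"
    and C: "\<And>c. P (Const c)" and V: "\<And>i. i < n \<Longrightarrow> P (Var i)"
    and A: "\<And>p q. P p \<Longrightarrow> P q \<Longrightarrow> P (p + q)"
    and M: "\<And>p q. P p \<Longrightarrow> P q \<Longrightarrow> P (p * q)"
  shows "P p"
proof -
  have one: "P 1" using C[of 1] by simp
  have zero: "P 0" using C[of 0] by simp
  have pw: "P q \<Longrightarrow> P (q ^ k)" for q k by (induction k) (auto intro: M one)
  have pr: "finite B \<Longrightarrow> (\<And>i. i \<in> B \<Longrightarrow> P (f i)) \<Longrightarrow> P (prod f B)" for f :: "nat \<Rightarrow> cpoly" and B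
    by (induction B rule: finite_induct) (auto intro: M one)
  have sm: "finite B \<Longrightarrow> (\<And>i. i \<in> B \<Longrightarrow> P (f i)) \<Longrightarrow> P (sum f B)" for f :: "(nat \<Rightarrow>\<^sub>0 nat) \<Rightarrow> cpoly" and B
    by (induction B rule: finite_induct) (auto intro: A zero)
  have "P (\<Sum>m \<in> Poly_Mapping.keys p. Poly_Mapping.single m (Poly_Mapping.lookup p m))"
  proof (rule sm)
    fix m assume m: "m \<in> Poly_Mapping.keys p"
    show "P (Poly_Mapping.single m (Poly_Mapping.lookup p m))"
      unfolding monomial_eq_prod
      by (intro M C pr pw V) (use m assms(1) in \<open>auto simp: polynomials_def\<close>)
  qed simp
  then show ?thesis using sum_singles[of p] by simp
qed

lemma cpoly_induct [case_names Const Var add mult]: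
  assumes "\<And>c. P (Const c)" "\<And>i. P (Var i)"
    and "\<And>p q. P p \<Longrightarrow> P q \<Longrightarrow> P (p + q)"
    and "\<And>p q. P p \<Longrightarrow> P q \<Longrightarrow> P (p * q)"
  shows "P p"
proof -
  obtain n where "p \<in> polynomials n" using ex_polynomials by blast
  then show ?thesis by (induction rule: polynomials_induct) (use assms in auto)
qed

subsection \<open>Substitution\<close>

text \<open>The coefficient map \<open>\<kappa>\<close> is a parameter so that the universal
  property is proved once; evaluation, changes of variables, restriction to lines and planes, and
  the gradings are all instances.\<close>

definition subst :: "(complex \<Rightarrow> 'r::comm_ring_1) \<Rightarrow> (nat \<Rightarrow> 'r) \<Rightarrow> cpoly \<Rightarrow> 'r" where
  "subst \<kappa> x p = (\<Sum>m\<in>Poly_Mapping.keys p. \<kappa> (Poly_Mapping.lookup p m) *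
     (\<Prod>i\<in>Poly_Mapping.keys m. x i ^ Poly_Mapping.lookup m i))"

context
  fixes \<kappa> :: "complex \<Rightarrow> 'r::comm_ring_1"
  assumes k: "comm_ring_hom \<kappa>"
begin

interpretation k: comm_ring_hom \<kappa> by (rule k)

lemma subst_superset:
  assumes "finite A" "Poly_Mapping.keys p \<subseteq> A"
  shows "subst \<kappa> x p = (\<Sum>m\<in>A. \<kappa> (Poly_Mapping.lookup p m) *
     (\<Prod>i\<in>Poly_Mapping.keys m. x i ^ Poly_Mapping.lookup m i))"
  unfolding subst_def
  by (rule sum.mono_neutral_left) (use assms in \<open>auto simp: in_keys_iff\<close>)

lemma subst_single: "subst \<kappa> x (Poly_Mapping.single m c) =
    \<kappa> c * (\<Prod>i\<in>Poly_Mapping.keys m. x i ^ Poly_Mapping.lookup m i)"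
  by (simp add: subst_def)

lemma subst_Const: "subst \<kappa> x (Const c) = \<kappa> c"
  by (simp add: Const_def subst_single)

lemma subst_Var: "subst \<kappa> x (Var i) = x i"
  by (simp add: Var_def subst_single)

lemma subst_add: "subst \<kappa> x (p + q) = subst \<kappa> x p + subst \<kappa> x q"
proof -
  let ?A = "Poly_Mapping.keys p \<union> Poly_Mapping.keys q"
  have "Poly_Mapping.keys (p + q) \<subseteq> ?A" by (rule keys_add)
  then show ?thesis
    by (simp add: subst_superset[of ?A] lookup_add algebra_simps sum.distrib k.hom_add)
qed

lemma subst_sum: "subst \<kappa> x (sum f A) = (\<Sum>i\<in>A. subst \<kappa> x (f i))"
  by (induction A rule: infinite_finite_induct) (auto simp: subst_add subst_Const[of x 0, simplified])

lemma subst_monomial_add: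
  "(\<Prod>i \<in> Poly_Mapping.keys (a + b). x i ^ Poly_Mapping.lookup (a + b) i) =
   (\<Prod>i \<in> Poly_Mapping.keys a. x i ^ Poly_Mapping.lookup a i) *
   (\<Prod>i \<in> Poly_Mapping.keys b. x i ^ Poly_Mapping.lookup b i)"
  for a b :: "nat \<Rightarrow>\<^sub>0 nat" and x :: "nat \<Rightarrow> 'r"
proof -
  let ?A = "Poly_Mapping.keys a \<union> Poly_Mapping.keys b"
  have *: "(\<Prod>i \<in> Poly_Mapping.keys c. x i ^ Poly_Mapping.lookup c i) = (\<Prod>i \<in> ?A. x i ^ Poly_Mapping.lookup c i)"
    if "Poly_Mapping.keys c \<subseteq> ?A" for c
    by (rule prod.mono_neutral_left) (use that in \<open>auto simp: in_keys_iff\<close>)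
  show ?thesis
    using *[of a] *[of b] *[of "a + b"] keys_add[of a b]
    by (simp add: lookup_add power_add prod.distrib)
qed

lemma subst_mult: "subst \<kappa> x (p * q) = subst \<kappa> x p * subst \<kappa> x q"
proof -
  have "p * q = (\<Sum>a \<in> Poly_Mapping.keys p. Poly_Mapping.single a (Poly_Mapping.lookup p a)) *
      (\<Sum>b \<in> Poly_Mapping.keys q. Poly_Mapping.single b (Poly_Mapping.lookup q b))"
    by (rule arg_cong2[OF sum_singles sum_singles])
  also have "\<dots> = (\<Sum>a \<in> Poly_Mapping.keys p. \<Sum>b \<in> Poly_Mapping.keys q.
      Poly_Mapping.single (a + b) (Poly_Mapping.lookup p a * Poly_Mapping.lookup q b))"
    by (simp add: sum_product mult_single)
  finally show ?thesis
    by (simp only: subst_sum subst_single subst_monomial_add)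
       (simp add: subst_def sum_product mult_ac k.hom_mult)
qed

lemma subst_hom: "comm_ring_hom (subst \<kappa> x)"
  by unfold_locales (auto simp: subst_add subst_mult subst_Const[of x 1, simplified] subst_Const[of x 0, simplified])

end

lemma subst_cong:
  assumes "p \<in> polynomials n" "\<And>i. i < n \<Longrightarrow> x i = y i"
  shows "subst \<kappa> x p = subst \<kappa> y p"
  unfolding subst_def
  by (intro sum.cong prod.cong arg_cong2[of _ _ _ _ "(*)"] arg_cong2[of _ _ _ _ "(^)"] refl)
     (use assms in \<open>auto simp: polynomials_def\<close>)

lemma const_poly_hom: "comm_ring_hom (\<lambda>c::'a::comm_ring_1. [:c:])"
  by unfold_locales (auto simp: one_pCons)

lemma comm_ring_hom_comp:
  "comm_ring_hom f \<Longrightarrow> comm_ring_hom g \<Longrightarrow> comm_ring_hom (\<lambda>x. f (g x))"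
  for f :: "'b::comm_ring_1 \<Rightarrow> 'c::comm_ring_1" and g :: "'a::comm_ring_1 \<Rightarrow> 'b"
proof -
  assume "comm_ring_hom f" "comm_ring_hom g"
  then interpret f: comm_ring_hom f + g: comm_ring_hom g .
  show ?thesis by unfold_locales (auto simp: f.hom_add g.hom_add f.hom_mult g.hom_mult)
qed

lemma comm_ring_hom_poly: "comm_ring_hom (\<lambda>p. poly p (c::'a::comm_ring_1))"
  by unfold_locales auto

lemma comm_ring_hom_id: "comm_ring_hom (\<lambda>p. p::'a::comm_ring_1)"
  by unfold_locales auto

text \<open>The uniqueness half of the universal property. Identities between iterated substitutions
  are proved with it by looking at constants and variables only.\<close>

lemma comm_ring_hom_eqI:
  fixes p :: cpoly
  assumes "comm_ring_hom f" "comm_ring_hom g" "\<And>c. f (Const c) = g (Const c)" "\<And>i. f (Var i) = g (Var i)"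
  shows "f p = g p"
proof -
  interpret f: comm_ring_hom f by fact
  interpret g: comm_ring_hom g by fact
  show ?thesis
    by (induction p rule: cpoly_induct) (auto simp: assms f.hom_add g.hom_add f.hom_mult g.hom_mult)
qed

section \<open>Evaluation at points and the view as polynomials in one variable\<close>

definition ev :: "(nat \<Rightarrow> complex) \<Rightarrow> cpoly \<Rightarrow> complex" where
  "ev x = subst (\<lambda>c. c) x"

interpretation ev: comm_ring_hom "ev x"
  unfolding ev_def by (intro subst_hom comm_ring_hom_id)

lemma ev_Const [simp]: "ev x (Const c) = c" and ev_Var [simp]: "ev x (Var i) = x i"
  by (simp_all add: ev_def subst_Const subst_Var comm_ring_hom_id)

lemma poly_eval_eq_ev: "poly_eval v p = ev (\<lambda>i. v $ i) p"
  by (simp add: poly_eval_def ev_def subst_def)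

lemma ev_subst_Const: "ev x (subst Const y p) = ev (\<lambda>i. ev x (y i)) p"
  by (rule comm_ring_hom_eqI[OF comm_ring_hom_comp[OF ev.comm_ring_hom_axioms subst_hom[OF Const_hom]]
        ev.comm_ring_hom_axioms])
     (auto simp: subst_Const subst_Var Const_hom)

lemma polynomials_0D: "p \<in> polynomials 0 \<Longrightarrow> \<exists>c. p = Const c"
proof (induction rule: polynomials_induct)
  case (add p q) then show ?case by (metis Const.hom_add)
next
  case (mult p q) then show ?case by (metis Const.hom_mult)
qed auto

text \<open>Singles out one variable while keeping the coefficients in the full ring;
  \<open>coeff_uni_in\<close> records how few variables they involve.\<close>

definition uni :: "nat \<Rightarrow> cpoly \<Rightarrow> cpoly poly" where
  "uni n = subst (\<lambda>c. [:Const c:]) (\<lambda>i. if i = n then [:0, 1:] else [:Var i:])"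

lemma Const_poly_hom: "comm_ring_hom (\<lambda>c. [:Const c:])"
  by (rule comm_ring_hom_comp[OF const_poly_hom Const_hom])

interpretation uni: comm_ring_hom "uni n"
  unfolding uni_def by (intro subst_hom Const_poly_hom)

lemma uni_Const [simp]: "uni n (Const c) = [:Const c:]"
  and uni_Var: "uni n (Var i) = (if i = n then [:0, 1:] else [:Var i:])"
  by (simp_all add: uni_def subst_Const subst_Var Const_poly_hom)

lemma poly_uni_Var [simp]: "poly (uni n p) (Var n) = p"
  by (rule comm_ring_hom_eqI[OF comm_ring_hom_comp[OF comm_ring_hom_poly uni.comm_ring_hom_axioms]
        comm_ring_hom_id])
     (auto simp: uni_Var)

lemma uni_eq_0_iff [simp]: "uni n p = 0 \<longleftrightarrow> p = 0"
  by (metis poly_uni_Var poly_0 uni.hom_zero)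

lemma uni_const: "p \<in> polynomials n \<Longrightarrow> uni n p = [:p:]"
  by (induction rule: polynomials_induct) (auto simp: uni_Var uni.hom_add uni.hom_mult)

lemma uni_const': "p \<in> polynomials n \<Longrightarrow> n \<le> i \<Longrightarrow> uni i p = [:p:]"
  using uni_const polynomials_mono by blast

lemma coeff_uni_in: "p \<in> polynomials (Suc n) \<Longrightarrow> coeff (uni n p) k \<in> polynomials n"
proof (induction arbitrary: k rule: polynomials_induct)
  case (Const c) then show ?case by (auto simp: coeff_pCons split: nat.splits)
next
  case (Var i) then show ?case
    by (auto simp: coeff_pCons uni_Var less_Suc_eq intro: polynomials_Var split: nat.splits)
next
  case (add p q) then show ?case by (auto simp: uni.hom_add intro: polynomials_add)
next
  case (mult p q) then show ?case
    by (auto simp: uni.hom_mult coeff_mult intro!: polynomials_sum polynomials_mult)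
qed

lemma ev_upd: "ev (x(n := t)) p = poly (subst (\<lambda>c. [:c:]) (\<lambda>i. if i = n then [:0, 1:] else [:x i:]) p) t"
  by (rule comm_ring_hom_eqI[OF ev.comm_ring_hom_axioms
        comm_ring_hom_comp[OF comm_ring_hom_poly subst_hom[OF const_poly_hom]]])
     (auto simp: subst_Const subst_Var const_poly_hom)

lemma coeff_subst_uni:
  "coeff (subst (\<lambda>c. [:c:]) (\<lambda>i. if i = n then [:0, 1:] else [:x i:]) p) k = ev x (coeff (uni n p) k)"
proof (induction p arbitrary: k rule: cpoly_induct)
  case (Const c) show ?case by (auto simp: subst_Const const_poly_hom coeff_pCons split: nat.splits)
next
  case (Var i) show ?case by (auto simp: subst_Var const_poly_hom uni_Var coeff_pCons split: nat.splits)
next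
  case (add p q) then show ?case by (simp add: subst_add const_poly_hom uni.hom_add ev.hom_add)
next
  case (mult p q) then show ?case
    by (simp add: subst_mult const_poly_hom uni.hom_mult coeff_mult ev.hom_sum ev.hom_mult)
qed

text \<open>Induction on the number of variables: a point where the leading coefficient in the last
  variable is nonzero leaves a nonzero polynomial in that variable.\<close>

lemma ev_nonzero:
  assumes "p \<in> polynomials n" "p \<noteq> 0"
  shows "\<exists>x. ev x p \<noteq> 0"
  using assms
proof (induction n arbitrary: p)
  case 0
  then show ?case using polynomials_0D[of p] by auto
next
  case (Suc n)
  let ?q = "uni n p"
  have "lead_coeff ?q \<noteq> 0" using Suc.prems by simp
  then obtain x where x: "ev x (lead_coeff ?q) \<noteq> 0"
    using Suc.IH coeff_uni_in Suc.prems by blast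
  define r where "r = subst (\<lambda>c. [:c:]) (\<lambda>i. if i = n then [:0, 1:] else [:x i:]) p"
  have "coeff r (degree ?q) \<noteq> 0" using x by (simp add: r_def coeff_subst_uni)
  then have "r \<noteq> 0" by auto
  then obtain t where "poly r t \<noteq> 0"
    using poly_all_0_iff_0 by blast
  then show ?case unfolding r_def ev_upd[of x n t p, symmetric] by blast
qed

lemma cpoly_eqI: "(\<And>x. ev x p = ev x q) \<Longrightarrow> p = q"
proof -
  assume a: "\<And>x. ev x p = ev x q"
  obtain n where "p - q \<in> polynomials n" using ex_polynomials by blast
  moreover have "ev x (p - q) = 0" for x using a by (simp add: ev.hom_minus)
  ultimately show ?thesis using ev_nonzero by fastforce
qed

lemma polynomials_if_uni_const:
  assumes "\<And>i. n \<le> i \<Longrightarrow> degree (uni i p) = 0"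
  shows "p \<in> polynomials n"
proof -
  obtain m where "p \<in> polynomials m" using ex_polynomials by blast
  then show ?thesis
  proof (induction m)
    case 0 then show ?case using polynomials_mono[of 0 n] by auto
  next
    case (Suc m)
    show ?case
    proof (cases "n \<le> m")
      case True
      then obtain c where c: "uni m p = [:c:]" using assms degree_eq_zeroE by blast
      then have "c = p" using poly_uni_Var[of m p] by simp
      then show ?thesis using coeff_uni_in[OF Suc.prems, of 0] Suc.IH c by simp
    next
      case False
      then show ?thesis using Suc.prems polynomials_mono[of "Suc m" n] by auto
    qed
  qed
qed

text \<open>Degrees in the variables from \<open>n\<close> on add up in a nonzero product, so they
  vanish for the factors as well.\<close>

lemma polynomials_dvd:
  assumes "p * q \<in> polynomials n" "p * q \<noteq> 0"
  shows "p \<in> polynomials n"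
proof (rule polynomials_if_uni_const)
  fix i assume "n \<le> i"
  then have "degree (uni i p * uni i q) = 0"
    using uni_const'[OF assms(1)] by (simp flip: uni.hom_mult)
  then show "degree (uni i p) = 0" using assms(2) by (auto simp: degree_mult_eq)
qed

section \<open>Unique factorisation\<close>

text \<open>Multiplies every variable by a new parameter. The degree in the parameter is the total
  degree, whose additivity thus becomes that of univariate degrees.\<close>

definition tot :: "cpoly \<Rightarrow> cpoly poly" where
  "tot = subst (\<lambda>c. [:Const c:]) (\<lambda>i. [:0, Var i:])"

interpretation tot: comm_ring_hom tot
  unfolding tot_def by (intro subst_hom Const_poly_hom)

lemma tot_Const [simp]: "tot (Const c) = [:Const c:]" and tot_Var [simp]: "tot (Var i) = [:0, Var i:]"
  by (simp_all add: tot_def subst_Const subst_Var Const_poly_hom)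

lemma poly_tot_1 [simp]: "poly (tot p) 1 = p"
  by (rule comm_ring_hom_eqI[OF comm_ring_hom_comp[OF comm_ring_hom_poly tot.comm_ring_hom_axioms]
        comm_ring_hom_id]) auto

lemma poly_tot_0: "poly (tot p) 0 = Const (ev (\<lambda>_. 0) p)"
  by (rule comm_ring_hom_eqI[OF comm_ring_hom_comp[OF comm_ring_hom_poly tot.comm_ring_hom_axioms]
        comm_ring_hom_comp[OF Const_hom ev.comm_ring_hom_axioms]]) auto

lemma tot_eq_0_iff [simp]: "tot p = 0 \<longleftrightarrow> p = 0"
  by (metis poly_tot_1 poly_0 tot.hom_zero)

definition tdeg :: "cpoly \<Rightarrow> nat" where
  "tdeg p = degree (tot p)"

lemma tdeg_mult: "p \<noteq> 0 \<Longrightarrow> q \<noteq> 0 \<Longrightarrow> tdeg (p * q) = tdeg p + tdeg q"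
  by (simp add: tdeg_def tot.hom_mult degree_mult_eq)

lemma tdeg_Const [simp]: "tdeg (Const c) = 0" and tdeg_1 [simp]: "tdeg 1 = 0"
  by (simp_all add: tdeg_def)

lemma tdeg_0D: "tdeg p = 0 \<Longrightarrow> \<exists>c. p = Const c"
  unfolding tdeg_def by (metis degree_eq_zeroE poly_const_conv poly_tot_0 poly_tot_1)

lemma Const_dvd_1: "c \<noteq> 0 \<Longrightarrow> Const c dvd 1"
  by (rule dvdI[of _ _ "Const (1 / c)"]) (simp flip: Const.hom_mult)

lemma cpoly_unit_iff: "p dvd 1 \<longleftrightarrow> (\<exists>c. c \<noteq> 0 \<and> p = Const c)"
proof
  assume "p dvd 1"
  then obtain q where q: "1 = p * q" by (auto elim: dvdE)
  then have "p \<noteq> 0" "q \<noteq> 0" by auto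
  then have "tdeg p = 0" using tdeg_mult[of p q] by (simp flip: q)
  then show "\<exists>c. c \<noteq> 0 \<and> p = Const c" using tdeg_0D[of p] \<open>p \<noteq> 0\<close> by auto
qed (auto simp: Const_dvd_1)

lemma tdeg_pos: "p \<noteq> 0 \<Longrightarrow> \<not> p dvd 1 \<Longrightarrow> tdeg p > 0"
  using tdeg_0D[of p] cpoly_unit_iff[of p] by force

lemma ex_irreducible_factor:
  assumes "p \<noteq> 0" "\<not> p dvd 1"
  shows "\<exists>q::cpoly. irreducible q \<and> q dvd p"
  using assms
proof (induction "tdeg p" arbitrary: p rule: less_induct)
  case less
  show ?case
  proof (cases "irreducible p")
    case False
    then obtain a b where ab: "p = a * b" "\<not> a dvd 1" "\<not> b dvd 1"
      using less.prems by (auto simp: irreducible_def)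
    then have "a \<noteq> 0" "b \<noteq> 0" using less.prems by auto
    then have "tdeg a < tdeg p" using ab tdeg_pos[of b] by (simp add: tdeg_mult)
    then show ?thesis using less.hyps[of a] \<open>a \<noteq> 0\<close> ab by (meson dvd_mult2)
  qed auto
qed

text \<open>Primality is tested only against polynomials in the first \<open>n\<close> variables, so
  that it can be proved by induction on \<open>n\<close>.\<close>

definition prime_on :: "nat \<Rightarrow> cpoly \<Rightarrow> bool" where
  "prime_on n c \<longleftrightarrow> (\<forall>f\<in>polynomials n. \<forall>g\<in>polynomials n. c dvd f * g \<longrightarrow> c dvd f \<or> c dvd g)"

text \<open>Gauss's argument: if \<open>i\<close> and \<open>j\<close> are the first indices with
  coefficients not divisible by \<open>c\<close>, the coefficient of degree \<open>i + j\<close> of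
  the product is not divisible either. The set \<open>A\<close> confines the use of primality to
  where it is known.\<close>

lemma const_poly_dvd_mult_cases:
  fixes c :: "'a::idom"
  assumes pr: "\<And>x y. x \<in> A \<Longrightarrow> y \<in> A \<Longrightarrow> c dvd x * y \<Longrightarrow> c dvd x \<or> c dvd y"
    and a: "\<And>i. coeff a i \<in> A" and b: "\<And>i. coeff b i \<in> A" and dvd: "[:c:] dvd a * b"
  shows "[:c:] dvd a \<or> [:c:] dvd b"
proof (rule ccontr)
  assume "\<not> ?thesis"
  then have ex: "\<exists>i. \<not> c dvd coeff a i" "\<exists>i. \<not> c dvd coeff b i"
    by (auto simp: const_poly_dvd_iff)
  define i where "i = (LEAST i. \<not> c dvd coeff a i)"
  define j where "j = (LEAST j. \<not> c dvd coeff b j)"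
  have i: "\<not> c dvd coeff a i" "\<And>k. k < i \<Longrightarrow> c dvd coeff a k"
    unfolding i_def using LeastI_ex[OF ex(1)] not_less_Least by blast+
  have j: "\<not> c dvd coeff b j" "\<And>k. k < j \<Longrightarrow> c dvd coeff b k"
    unfolding j_def using LeastI_ex[OF ex(2)] not_less_Least by blast+
  have "coeff (a * b) (i + j) = coeff a i * coeff b j + (\<Sum>k\<in>{..i + j} - {i}. coeff a k * coeff b (i + j - k))"
    unfolding coeff_mult by (subst sum.remove[of _ i]) auto
  moreover have "c dvd (\<Sum>k\<in>{..i + j} - {i}. coeff a k * coeff b (i + j - k))"
  proof (rule dvd_sum)
    fix k assume "k \<in> {..i + j} - {i}"
    then have "k < i \<or> i + j - k < j" by auto
    then show "c dvd coeff a k * coeff b (i + j - k)" using i(2) j(2) by auto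
  qed
  moreover have "c dvd coeff (a * b) (i + j)" using dvd by (simp add: const_poly_dvd_iff)
  ultimately have "c dvd coeff a i * coeff b j" by (simp add: dvd_add_left_iff)
  then show False using pr[OF a b] i(1) j(1) by blast
qed

lemma prime_on_Suc:
  assumes c: "c \<in> polynomials n" "prime_on n c"
  shows "prime_on (Suc n) c"
  unfolding prime_on_def
proof (intro ballI impI)
  fix f g assume f: "f \<in> polynomials (Suc n)" and g: "g \<in> polynomials (Suc n)" and "c dvd f * g"
  then have "uni n c dvd uni n f * uni n g" by (metis dvd_def uni.hom_mult)
  then have "[:c:] dvd uni n f \<or> [:c:] dvd uni n g"
    using const_poly_dvd_mult_cases[of "polynomials n" c "uni n f" "uni n g"] c f g coeff_uni_in
    by (auto simp: prime_on_def uni_const)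
  moreover have "c dvd h" if d: "[:c:] dvd uni n h" for h
  proof -
    obtain k where k: "uni n h = [:c:] * k" using d by (rule dvdE)
    then have "h = c * poly k (Var n)" using poly_uni_Var[of n h] by simp
    then show ?thesis by simp
  qed
  ultimately show "c dvd f \<or> c dvd g" by blast
qed

context
  fixes n :: nat
  assumes IH: "\<And>c. irreducible c \<Longrightarrow> c \<in> polynomials n \<Longrightarrow> prime_on n c"
begin

text \<open>Passing to the fraction field of the lower variables makes \<open>c\<close> a unit; this
  is that cancellation without denominators. The irreducible factors of \<open>c\<close> are prime
  by \<open>IH\<close> and do not divide \<open>p\<close>, so they are removed one at a
  time.\<close>

lemma dvd_cancel_lower:
  assumes "c \<in> polynomials n" "c \<noteq> 0" "f \<in> polynomials (Suc n)" "p \<in> polynomials (Suc n)"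
    and "irreducible p" "degree (uni n p) > 0" "p dvd c * f"
  shows "p dvd f"
  using assms
proof (induction "tdeg c" arbitrary: c rule: less_induct)
  case less
  show ?case
  proof (cases "c dvd 1 \<or> f = 0")
    case True
    show ?thesis
    proof (cases "f = 0")
      case False
      then obtain e where e: "c = Const e" "e \<noteq> 0" using True by (auto simp: cpoly_unit_iff)
      then have "Const (1 / e) * (c * f) = f"
        by (simp add: mult.assoc[symmetric] flip: Const.hom_mult)
      then show ?thesis using less.prems(7) by (metis dvd_mult)
    qed simp
  next
    case False
    then obtain q where q: "irreducible q" "q dvd c" using ex_irreducible_factor less.prems(2) by blast
    then obtain d where d: "c = q * d" by (auto elim: dvdE)
    obtain s where s: "c * f = p * s" using less.prems by (auto elim: dvdE)
    have nz: "d \<noteq> 0" "q \<noteq> 0" "p * s \<noteq> 0" "s \<noteq> 0"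
      using d s less.prems False by auto
    have qin: "q \<in> polynomials n" "d \<in> polynomials n"
      using polynomials_dvd[of q d n] polynomials_dvd[of d q n] d less.prems by (auto simp: mult.commute)
    have "c \<in> polynomials (Suc n)" using less.prems polynomials_mono[of n "Suc n"] by auto
    then have "p * s \<in> polynomials (Suc n)"
      using s less.prems polynomials_mult by metis
    then have sin: "s \<in> polynomials (Suc n)"
      using polynomials_dvd[of s p] nz by (simp add: mult.commute)
    have "q dvd p * s" using s d by (metis dvd_triv_left mult.assoc)
    then have "q dvd p \<or> q dvd s"
      using prime_on_Suc[OF qin(1) IH[OF q(1) qin(1)]] sin less.prems by (auto simp: prime_on_def)
    \<comment> \<open>Otherwise the irreducible \<open>p\<close> would be a constant multiple of
      \<open>q\<close> and would not involve the last variable.\<close>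
    moreover have "\<not> q dvd p"
    proof
      assume "q dvd p"
      then obtain r where r: "p = q * r" by (auto elim: dvdE)
      then have "r dvd 1" using less.prems q by (auto simp: irreducible_def)
      then obtain e where "r = Const e" by (auto simp: cpoly_unit_iff)
      then have "p \<in> polynomials n" using r qin by (auto intro: polynomials_mult)
      then show False using less.prems uni_const by auto
    qed
    ultimately obtain s' where s': "s = q * s'" by (auto elim: dvdE)
    then have "d * f = p * s'" using s d nz by (simp add: algebra_simps)
    moreover have "tdeg d < tdeg c" using d nz q tdeg_pos[of q] by (auto simp: tdeg_mult irreducible_def)
    ultimately show ?thesis using less.hyps[of d] qin nz less.prems by auto
  qed
qed

text \<open>Division with remainder over the fraction field of the lower variables, with
  \<open>c\<close> as common denominator. Exact division is a separate alternative because the zero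
  remainder has degree 0, which need not lie below the degree of \<open>f\<close>.\<close>

lemma pseudo_division:
  assumes "u \<in> polynomials (Suc n)" "f \<in> polynomials (Suc n)" "f \<noteq> 0"
  shows "\<exists>c\<in>polynomials n. c \<noteq> 0 \<and> (\<exists>q\<in>polynomials (Suc n). c * u = q * f \<or>
     degree (uni n (c * u - q * f)) < degree (uni n f))"
  using assms
proof (induction "degree (uni n u)" arbitrary: u rule: less_induct)
  case less
  show ?case
  proof (cases "u = 0 \<or> degree (uni n u) < degree (uni n f)")
    case True
    then show ?thesis by (intro bexI[of _ 1] conjI bexI[of _ 0]) auto
  next
    case False
    let ?U = "uni n u" and ?F = "uni n f"
    define k where "k = degree ?U - degree ?F"
    define r where "r = lead_coeff ?F * u - lead_coeff ?U * Var n ^ k * f"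
    have up: "polynomials n \<subseteq> polynomials (Suc n)" by (rule polynomials_mono) simp
    have l: "lead_coeff ?U \<in> polynomials n" "lead_coeff ?F \<in> polynomials n" "lead_coeff ?F \<noteq> 0"
      using less.prems by (auto intro: coeff_uni_in)
    have V: "Var n ^ k \<in> polynomials (Suc n)" by (intro polynomials_power polynomials_Var) simp
    have rin: "r \<in> polynomials (Suc n)"
      unfolding r_def using l up V less.prems by (intro polynomials_diff polynomials_mult) auto
    have ur: "uni n r = smult (lead_coeff ?F) ?U - smult (lead_coeff ?U) (monom 1 k * ?F)"
      unfolding r_def using l
      by (simp add: uni.hom_minus uni.hom_mult uni.hom_power uni_const uni_Var monom_altdef)
    have deg: "degree (uni n r) < degree ?U" if "r \<noteq> 0"
    proof -
      have le: "degree (uni n r) \<le> degree ?U"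
        unfolding ur using False less.prems
        by (intro degree_diff_le) (auto simp: k_def degree_mult_eq degree_monom_eq intro: order.trans[OF degree_smult_le])
      have "coeff (uni n r) (degree ?U) = 0"
        unfolding ur using False by (simp add: coeff_monom_mult k_def)
      then show ?thesis using le that
        by (metis leading_coeff_0_iff le_neq_implies_less uni_eq_0_iff)
    qed
    show ?thesis
    proof (cases "r = 0")
      case True
      have "lead_coeff ?U * Var n ^ k \<in> polynomials (Suc n)"
        using l V up by (intro polynomials_mult) auto
      moreover have "lead_coeff ?F * u = lead_coeff ?U * Var n ^ k * f" using True by (simp add: r_def)
      ultimately show ?thesis using l(2,3) by blast
    next
      case False
      obtain c q where c: "c \<in> polynomials n" "c \<noteq> 0" "q \<in> polynomials (Suc n)"
        "c * r = q * f \<or> degree (uni n (c * r - q * f)) < degree ?F"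
        using less.hyps[OF deg[OF False] rin] less.prems by blast
      define q' where "q' = q + c * (lead_coeff ?U * Var n ^ k)"
      have *: "(c * lead_coeff ?F) * u - q' * f = c * r - q * f"
        by (simp add: r_def q'_def algebra_simps)
      have "q' \<in> polynomials (Suc n)"
        unfolding q'_def using c l V up by (intro polynomials_add polynomials_mult) auto
      moreover have "c * lead_coeff ?F \<in> polynomials n" "c * lead_coeff ?F \<noteq> 0"
        using c l by (auto intro: polynomials_mult)
      moreover have "(c * lead_coeff ?F) * u = q' * f \<or>
          degree (uni n ((c * lead_coeff ?F) * u - q' * f)) < degree ?F"
        using c(4) * by (metis eq_iff_diff_eq_0)
      ultimately show ?thesis by blast
    qed
  qed
qed

text \<open>Each prime factor of \<open>c\<close> divides \<open>q\<close> or \<open>f\<close> and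
  is cancelled there. Removing a factor in the lower variables leaves the degree in the last
  variable unchanged.\<close>

lemma split_lower:
  assumes "c \<in> polynomials n" "c \<noteq> 0" "f \<in> polynomials (Suc n)" "q \<in> polynomials (Suc n)"
    and "c * p = q * f" "p \<noteq> 0"
  shows "\<exists>q' f'. p = q' * f' \<and> degree (uni n f') = degree (uni n f)"
  using assms
proof (induction "tdeg c" arbitrary: c q f rule: less_induct)
  case less
  show ?case
  proof (cases "c dvd 1")
    case True
    then obtain e where e: "c = Const e" "e \<noteq> 0" by (auto simp: cpoly_unit_iff)
    then have "Const (1 / e) * (Const e * p) = p"
      by (simp add: mult.assoc[symmetric] flip: Const.hom_mult)
    then have "p = (Const (1 / e) * q) * f" using less.prems(5) e by (metis mult.assoc)
    then show ?thesis by blast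
  next
    case False
    then obtain r where r: "irreducible r" "r dvd c" using ex_irreducible_factor less.prems(2) by blast
    then obtain d where d: "c = r * d" by (auto elim: dvdE)
    have nz: "d \<noteq> 0" "r \<noteq> 0" using d less.prems by auto
    have rin: "r \<in> polynomials n" "d \<in> polynomials n"
      using polynomials_dvd[of r d n] polynomials_dvd[of d r n] d less.prems by (auto simp: mult.commute)
    have dc: "tdeg d < tdeg c" using d nz r tdeg_pos[of r] by (auto simp: tdeg_mult irreducible_def)
    have "q * f \<noteq> 0" using less.prems(2,5,6) by (metis mult_eq_0_iff)
    have "r dvd q * f" using less.prems(5) d by (metis dvd_triv_left mult.assoc)
    then have "r dvd q \<or> r dvd f"
      using prime_on_Suc[OF rin(1) IH[OF r(1) rin(1)]] less.prems by (auto simp: prime_on_def)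
    then show ?thesis
    proof
      assume "r dvd q"
      then obtain q1 where q1: "q = r * q1" by (auto elim: dvdE)
      then have "q1 \<in> polynomials (Suc n)"
        using polynomials_dvd[of q1 r] less.prems(4) \<open>q * f \<noteq> 0\<close> by (auto simp: mult.commute)
      moreover have "d * p = q1 * f" using less.prems(5) d q1 nz by (simp add: algebra_simps)
      ultimately show ?thesis using less.hyps[OF dc rin(2) nz(1) less.prems(3)] less.prems(6) by blast
    next
      assume "r dvd f"
      then obtain f1 where f1: "f = r * f1" by (auto elim: dvdE)
      then have "f1 \<in> polynomials (Suc n)"
        using polynomials_dvd[of f1 r] less.prems(3) \<open>q * f \<noteq> 0\<close> by (auto simp: mult.commute)
      moreover have "d * p = q * f1" using less.prems(5) d f1 nz by (simp add: algebra_simps)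
      moreover have "degree (uni n f1) = degree (uni n f)"
        using f1 rin nz \<open>q * f \<noteq> 0\<close> by (simp add: uni.hom_mult uni_const)
      ultimately show ?thesis using less.hyps[OF dc rin(2) nz(1) _ less.prems(4)] less.prems(6) by metis
    qed
  qed
qed

text \<open>A factor \<open>f\<close> of minimal degree violating primality of \<open>p\<close> would, by two pseudo-divisions,
  divide \<open>p\<close> up to a polynomial in fewer variables.\<close>

lemma irreducible_prime_on_Suc:
  assumes p: "irreducible p" "p \<in> polynomials (Suc n)"
  shows "prime_on (Suc n) p"
proof (cases "degree (uni n p) = 0")
  case True
  then obtain c where c: "uni n p = [:c:]" using degree_eq_zeroE by blast
  then have "c = p" using poly_uni_Var[of n p] by simp
  then have "p \<in> polynomials n" using coeff_uni_in[OF p(2), of 0] c by simp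
  then show ?thesis using prime_on_Suc IH p by blast
next
  case False
  define bad where "bad f \<longleftrightarrow> f \<in> polynomials (Suc n) \<and> \<not> p dvd f \<and>
      (\<exists>g\<in>polynomials (Suc n). \<not> p dvd g \<and> p dvd f * g)" for f
  have up: "polynomials n \<subseteq> polynomials (Suc n)" by (rule polynomials_mono) simp
  have p0: "p \<noteq> 0" using p by auto
  show ?thesis
  proof (rule ccontr)
    assume "\<not> ?thesis"
    then have "\<exists>f. bad f" unfolding prime_on_def bad_def by blast
    then obtain f where f: "bad f" and min: "\<And>f'. bad f' \<Longrightarrow> degree (uni n f) \<le> degree (uni n f')"
      using ex_has_least_nat[of bad _ "\<lambda>f. degree (uni n f)"] by blast
    obtain g where g: "g \<in> polynomials (Suc n)" "\<not> p dvd g" "p dvd f * g" using f by (auto simp: bad_def)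
    have fin: "f \<in> polynomials (Suc n)" and f0: "f \<noteq> 0" using f by (auto simp: bad_def)
    have small: "degree (uni n f) < degree (uni n p)"
    proof -
      obtain c q where c: "c \<in> polynomials n" "c \<noteq> 0" "q \<in> polynomials (Suc n)"
        "c * f = q * p \<or> degree (uni n (c * f - q * p)) < degree (uni n p)"
        using pseudo_division[OF fin p(2) p0] by blast
      have nd: "\<not> p dvd c * f" using dvd_cancel_lower[of c f p] c p False fin f by (auto simp: bad_def)
      then have "\<not> p dvd c * f - q * p" by (metis diff_add_cancel dvd_add dvd_triv_right)
      moreover have "p dvd (c * f - q * p) * g"
        using g(3) by (simp add: left_diff_distrib mult.assoc dvd_diff)
      moreover have "c * f - q * p \<in> polynomials (Suc n)"
        using c up fin p by (intro polynomials_diff polynomials_mult) auto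
      ultimately have "bad (c * f - q * p)" using g by (auto simp: bad_def)
      then show ?thesis using min c(4) nd by (metis dvd_triv_right order.strict_trans1)
    qed
    obtain c q where c: "c \<in> polynomials n" "c \<noteq> 0" "q \<in> polynomials (Suc n)"
      "c * p = q * f \<or> degree (uni n (c * p - q * f)) < degree (uni n f)"
      using pseudo_division[OF p(2) fin f0] by blast
    \<comment> \<open>A nonzero remainder is annihilated by \<open>g\<close> modulo
      \<open>p\<close>. By minimality of \<open>f\<close> it would be divisible by \<open>p\<close>,
      which its degree forbids.\<close>
    have eq: "c * p = q * f"
    proof (rule ccontr)
      assume ne: "c * p \<noteq> q * f"
      then have lt: "degree (uni n (c * p - q * f)) < degree (uni n f)" using c by blast
      have "c * p - q * f \<in> polynomials (Suc n)"
        using c up fin p by (intro polynomials_diff polynomials_mult) auto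
      moreover have "(c * p - q * f) * g = p * (c * g) - q * (f * g)" by (simp add: algebra_simps)
      then have "p dvd (c * p - q * f) * g" using g(3) by (simp add: dvd_diff dvd_mult)
      moreover have "\<not> bad (c * p - q * f)" using min lt by fastforce
      ultimately have "p dvd c * p - q * f" using g by (auto simp: bad_def)
      then obtain s where s: "c * p - q * f = p * s" by (auto elim: dvdE)
      then have "s \<noteq> 0" using ne by auto
      then have "degree (uni n (p * s)) \<ge> degree (uni n p)"
        using p0 by (simp add: uni.hom_mult degree_mult_eq)
      then show False using s lt small by simp
    qed
    obtain q' f' where f': "p = q' * f'" "degree (uni n f') = degree (uni n f)"
      using split_lower[OF c(1,2) fin c(3) eq p0] by blast
    then have "q' dvd 1 \<or> f' dvd 1" using p by (auto simp: irreducible_def)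
    then show False
    proof
      assume "q' dvd 1"
      then obtain e where "q' = Const e" "e \<noteq> 0" by (auto simp: cpoly_unit_iff)
      then have "degree (uni n p) = degree (uni n f')" using f' by (simp add: uni.hom_mult)
      then show False using f' small by simp
    next
      assume "f' dvd 1"
      then obtain e where "f' = Const e" by (auto simp: cpoly_unit_iff)
      then have "degree (uni n f) = 0" using f' by simp
      then obtain d where d: "uni n f = [:d:]" using degree_eq_zeroE by blast
      then have "d = f" using poly_uni_Var[of n f] by simp
      then have "f \<in> polynomials n" using coeff_uni_in[OF fin, of 0] d by simp
      then show False using dvd_cancel_lower[of f g p] f0 g p False by auto
    qed
  qed
qed

end

lemma irreducible_prime_on: "irreducible p \<Longrightarrow> p \<in> polynomials n \<Longrightarrow> prime_on n p"
proof (induction n arbitrary: p)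
  case 0
  then show ?case using polynomials_0D[of p] by (auto simp: irreducible_def cpoly_unit_iff)
next
  case (Suc n)
  then show ?case using irreducible_prime_on_Suc by blast
qed

theorem irreducible_imp_prime_cpoly:
  fixes p :: cpoly
  assumes "irreducible p"
  shows "prime_elem p"
proof (rule prime_elemI)
  fix f g assume d: "p dvd f * g"
  obtain i j k where ijk: "p \<in> polynomials i" "f \<in> polynomials j" "g \<in> polynomials k"
    using ex_polynomials by metis
  define n where "n = max i (max j k)"
  have "i \<le> n" "j \<le> n" "k \<le> n" by (auto simp: n_def)
  then have "p \<in> polynomials n" "f \<in> polynomials n" "g \<in> polynomials n"
    using ijk polynomials_mono by blast+
  then show "p dvd f \<or> p dvd g"
    using irreducible_prime_on[OF assms] d by (auto simp: prime_on_def)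
qed (use assms in \<open>auto simp: irreducible_def\<close>)

lemma ex_prime_factor: "p \<noteq> 0 \<Longrightarrow> \<not> p dvd 1 \<Longrightarrow> \<exists>q::cpoly. prime_elem q \<and> q dvd p"
  using ex_irreducible_factor irreducible_imp_prime_cpoly by blast

lemma tdeg_prime: "prime_elem p \<Longrightarrow> tdeg p > 0"
  using tdeg_pos[of p] by (auto simp: prime_elem_def)

section \<open>Coprime parts and divisibility without common primes\<close>

lemma ex_coprime_reduction:
  fixes A B :: cpoly
  assumes "B \<noteq> 0"
  shows "\<exists>g a b. A = g * a \<and> B = g * b \<and> (\<forall>p. prime_elem p \<longrightarrow> \<not> (p dvd a \<and> p dvd b))"
  using assms
proof (induction "tdeg B" arbitrary: A B rule: less_induct)
  case less
  show ?case
  proof (cases "\<exists>p. prime_elem p \<and> p dvd A \<and> p dvd B")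
    case True
    then obtain p A' B' where p: "prime_elem p" "A = p * A'" "B = p * B'" by (auto elim!: dvdE)
    then have "tdeg B' < tdeg B" "B' \<noteq> 0"
      using less.prems tdeg_prime[of p] by (auto simp: tdeg_mult)
    then obtain g a b where "A' = g * a" "B' = g * b" "\<forall>p. prime_elem p \<longrightarrow> \<not> (p dvd a \<and> p dvd b)"
      using less.hyps by blast
    then show ?thesis using p by (intro exI[of _ "p * g"] exI[of _ a] exI[of _ b]) (auto simp: mult.assoc)
  next
    case False
    then show ?thesis by (intro exI[of _ 1] exI[of _ A] exI[of _ B]) auto
  qed
qed

text \<open>A prime factor of \<open>x\<close> misses some \<open>m i\<close>, hence divides
  \<open>y\<close> and can be cancelled from both sides.\<close>

lemma dvd_if_no_common_prime:
  fixes x y :: cpoly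
  assumes "x \<noteq> 0" "\<And>i. i \<in> I \<Longrightarrow> x dvd y * m i"
    and "\<And>p. prime_elem p \<Longrightarrow> \<exists>i\<in>I. \<not> p dvd m i"
  shows "x dvd y"
  using assms(1,2)
proof (induction "tdeg x" arbitrary: x y rule: less_induct)
  case less
  show ?case
  proof (cases "x dvd 1")
    case False
    then obtain p where p: "prime_elem p" "p dvd x" using ex_prime_factor less.prems by blast
    then obtain x' where x': "x = p * x'" by (auto elim: dvdE)
    obtain i where i: "i \<in> I" "\<not> p dvd m i" using assms(3)[OF p(1)] by blast
    have "p dvd y * m i" using less.prems(2)[OF i(1)] p(2) dvd_trans by blast
    then have "p dvd y" using p(1) i(2) prime_elem_dvd_multD by blast
    then obtain y' where y': "y = p * y'" by (auto elim: dvdE)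
    have nz: "p \<noteq> 0" "x' \<noteq> 0" using p x' less.prems by auto
    have "x' dvd y' * m j" if "j \<in> I" for j
      using less.prems(2)[OF that] nz by (simp add: x' y' mult.assoc)
    moreover have "tdeg x' < tdeg x" using nz tdeg_prime[OF p(1)] by (simp add: x' tdeg_mult)
    ultimately have "x' dvd y'" using less.hyps nz by blast
    then show ?thesis by (simp add: x' y')
  qed (metis dvd_trans one_dvd)
qed

section \<open>Directional derivatives\<close>

definition line :: "(nat \<Rightarrow> complex) \<Rightarrow> (nat \<Rightarrow> complex) \<Rightarrow> cpoly \<Rightarrow> complex poly" where
  "line x v = subst (\<lambda>c. [:c:]) (\<lambda>i. [:x i, v i:])"

interpretation line: comm_ring_hom "line x v"
  unfolding line_def by (intro subst_hom const_poly_hom)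

lemma line_Const [simp]: "line x v (Const c) = [:c:]" and line_Var [simp]: "line x v (Var i) = [:x i, v i:]"
  by (simp_all add: line_def subst_Const subst_Var const_poly_hom)

lemma poly_subst: "poly (subst (\<lambda>c. [:c:]) \<gamma> f) t = ev (\<lambda>i. poly (\<gamma> i) t) f"
  by (rule comm_ring_hom_eqI[OF comm_ring_hom_comp[OF comm_ring_hom_poly subst_hom[OF const_poly_hom]]
        ev.comm_ring_hom_axioms])
     (auto simp: subst_Const subst_Var const_poly_hom)

lemma poly_line: "poly (line x v f) t = ev (\<lambda>i. x i + t * v i) f"
  by (simp add: line_def poly_subst)

lemma coeff_line_0: "coeff (line x v f) 0 = ev x f"
  using poly_line[of x v f 0] by (simp add: poly_0_coeff_0)

text \<open>The directional derivative as linear coefficient along a line; the Leibniz rule is then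
  multiplication of univariate polynomials.\<close>

definition dd :: "cpoly \<Rightarrow> (nat \<Rightarrow> complex) \<Rightarrow> (nat \<Rightarrow> complex) \<Rightarrow> complex" where
  "dd f x v = coeff (line x v f) 1"

lemma dd_Const [simp]: "dd (Const c) x v = 0" and dd_Var [simp]: "dd (Var i) x v = v i"
  by (simp_all add: dd_def)

lemma dd_add: "dd (f + g) x v = dd f x v + dd g x v"
  by (simp add: dd_def line.hom_add)

lemma dd_mult: "dd (f * g) x v = dd f x v * ev x g + ev x f * dd g x v"
  by (simp add: dd_def line.hom_mult coeff_mult coeff_line_0)

lemma dd_0 [simp]: "dd 0 x v = 0" by (simp add: dd_def)

lemma dd_Const_mult: "dd (Const c * f) x v = c * dd f x v"
  by (simp add: dd_mult)

lemma dd_sum: "dd (sum f A) x v = (\<Sum>i\<in>A. dd (f i) x v)"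
  by (induction A rule: infinite_finite_induct) (auto simp: dd_add)

lemma dd_linear: "dd f x (\<lambda>i. a * v i + b * w i) = a * dd f x v + b * dd f x w"
  by (induction f rule: cpoly_induct) (auto simp: dd_add dd_mult algebra_simps)

text \<open>The determinant of the differentials of \<open>f\<close>, \<open>g\<close>,
  \<open>h\<close> at \<open>x\<close> in the directions \<open>u\<close>, \<open>v\<close>,
  \<open>w\<close>, expanded along the row of \<open>f\<close>. Arbitrary directions take the place
  of partial derivatives, so that projections of \<open>x\<close> can be inserted later.\<close>

definition jac :: "cpoly \<Rightarrow> cpoly \<Rightarrow> cpoly \<Rightarrow> (nat \<Rightarrow> complex) \<Rightarrow>
    (nat \<Rightarrow> complex) \<Rightarrow> (nat \<Rightarrow> complex) \<Rightarrow> (nat \<Rightarrow> complex) \<Rightarrow> complex" where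
  "jac f g h x u v w =
     dd f x u * (dd g x v * dd h x w - dd g x w * dd h x v)
   - dd f x v * (dd g x u * dd h x w - dd g x w * dd h x u)
   + dd f x w * (dd g x u * dd h x v - dd g x v * dd h x u)"

text \<open>Cramer's rule: the coefficients of the new directions are cofactors divided by the
  determinant.\<close>

lemma jac_dual_basis:
  assumes "jac f g h x u v w \<noteq> 0"
  obtains v' :: "nat \<Rightarrow> nat \<Rightarrow> complex" where
    "dd f x (v' 0) = 1" "dd f x (v' 1) = 0" "dd f x (v' 2) = 0"
    "dd g x (v' 0) = 0" "dd g x (v' 1) = 1" "dd g x (v' 2) = 0"
    "dd h x (v' 0) = 0" "dd h x (v' 1) = 0" "dd h x (v' 2) = 1"
proof -
  define J where "J = jac f g h x u v w"
  have comb: "dd q x (\<lambda>i. a * u i + 1 * (b * v i + c * w i)) = a * dd q x u + b * dd q x v + c * dd q x w"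
    for q a b c
    by (subst dd_linear, subst dd_linear) simp
  define cmb where "cmb a b c = (\<lambda>i. a / J * u i + 1 * (b / J * v i + c / J * w i))" for a b c
  have dcmb: "dd q x (cmb a b c) = (a * dd q x u + b * dd q x v + c * dd q x w) / J" for q a b c
    unfolding cmb_def comb by (simp add: add_divide_distrib)
  define v' :: "nat \<Rightarrow> nat \<Rightarrow> complex" where "v' = (\<lambda>_. cmb 0 0 0)
    (0 := cmb (dd g x v * dd h x w - dd g x w * dd h x v) (dd g x w * dd h x u - dd g x u * dd h x w) (dd g x u * dd h x v - dd g x v * dd h x u),
     1 := cmb (dd h x v * dd f x w - dd h x w * dd f x v) (dd h x w * dd f x u - dd h x u * dd f x w) (dd h x u * dd f x v - dd h x v * dd f x u),
     2 := cmb (dd f x v * dd g x w - dd f x w * dd g x v) (dd f x w * dd g x u - dd f x u * dd g x w) (dd f x u * dd g x v - dd f x v * dd g x u))"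
  have J: "J \<noteq> 0" using assms by (simp add: J_def)
  have one: "z / J = 1" if "z = J" for z using that J by simp
  have zero: "z / J = 0" if "z = 0" for z using that by simp
  have v': "v' 0 = cmb (dd g x v * dd h x w - dd g x w * dd h x v) (dd g x w * dd h x u - dd g x u * dd h x w) (dd g x u * dd h x v - dd g x v * dd h x u)"
    "v' 1 = cmb (dd h x v * dd f x w - dd h x w * dd f x v) (dd h x w * dd f x u - dd h x u * dd f x w) (dd h x u * dd f x v - dd h x v * dd f x u)"
    "v' 2 = cmb (dd f x v * dd g x w - dd f x w * dd g x v) (dd f x w * dd g x u - dd f x u * dd g x w) (dd f x u * dd g x v - dd f x v * dd g x u)"
    by (simp_all add: v'_def)
  show ?thesis
    by (rule that[of v']; unfold v' dcmb; rule one zero; simp add: J_def jac_def algebra_simps)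
qed

section \<open>Algebraic dependence\<close>

interpretation cpoly: vector_space "\<lambda>c p. Const c * p"
  by unfold_locales (auto simp: algebra_simps Const.hom_add Const.hom_mult)

text \<open>More indices than the dimension allows. Repetitions in the family are treated apart,
  since \<open>dependent\<close> speaks of sets of vectors.\<close>

lemma (in vector_space) ex_relation:
  assumes "finite E" "finite T" "card T < card E" "\<And>e. e \<in> E \<Longrightarrow> f e \<in> span T"
  shows "\<exists>c. (\<exists>e\<in>E. c e \<noteq> 0) \<and> (\<Sum>e\<in>E. scale (c e) (f e)) = 0"
proof (cases "inj_on f E")
  case False
  then obtain d e where de: "d \<in> E" "e \<in> E" "d \<noteq> e" "f d = f e" by (auto simp: inj_on_def)
  define c where "c = (\<lambda>_. 0)(d := 1, e := - 1 :: 'a)"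
  have "(\<Sum>i\<in>E. scale (c i) (f i)) = (\<Sum>i\<in>{d, e}. scale (c i) (f i))"
    using assms(1) de by (intro sum.mono_neutral_right) (auto simp: c_def)
  also have "\<dots> = 0" using de by (auto simp: c_def)
  finally show ?thesis using de by (intro exI[of _ c]) (auto simp: c_def)
next
  case True
  have "dependent (f ` E)"
  proof (rule ccontr)
    assume "independent (f ` E)"
    then have "card (f ` E) \<le> card T"
      using independent_span_bound[OF assms(2), of "f ` E"] assms(4) by auto
    then show False using assms(3) card_image[OF True] by simp
  qed
  then obtain c where c: "(\<exists>v\<in>f ` E. c v \<noteq> 0)" "(\<Sum>v\<in>f ` E. scale (c v) v) = 0"
    using dependent_finite[of "f ` E"] assms(1) by auto
  then show ?thesis using sum.reindex[OF True, of "\<lambda>v. scale (c v) v"]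
    by (intro exI[of _ "c \<circ> f"]) (auto simp: comp_def)
qed

text \<open>Exponents are bounded variable by variable, not in total, so that the number of
  monomials is exactly a power.\<close>

definition box_monomials :: "nat \<Rightarrow> nat \<Rightarrow> (nat \<Rightarrow>\<^sub>0 nat) set" where
  "box_monomials k D = {m. Poly_Mapping.keys m \<subseteq> {..<k} \<and> (\<forall>i. Poly_Mapping.lookup m i \<le> D)}"

lemma bij_box_monomials:
  "bij_betw (\<lambda>m. restrict (Poly_Mapping.lookup m) {..<k}) (box_monomials k D) ({..<k} \<rightarrow>\<^sub>E {..D})"
proof (rule bij_betwI')
  fix x y assume xy: "x \<in> box_monomials k D" "y \<in> box_monomials k D"
  show "restrict (Poly_Mapping.lookup x) {..<k} = restrict (Poly_Mapping.lookup y) {..<k} \<longleftrightarrow> x = y"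
  proof
    assume r: "restrict (Poly_Mapping.lookup x) {..<k} = restrict (Poly_Mapping.lookup y) {..<k}"
    show "x = y"
    proof (rule poly_mapping_eqI)
      fix i
      show "Poly_Mapping.lookup x i = Poly_Mapping.lookup y i"
      proof (cases "i < k")
        case True then show ?thesis using fun_cong[OF r, of i] by simp
      next
        case False
        then have "i \<notin> Poly_Mapping.keys x" "i \<notin> Poly_Mapping.keys y" using xy by (auto simp: box_monomials_def)
        then show ?thesis by (simp add: in_keys_iff)
      qed
    qed
  qed simp
next
  fix x assume "x \<in> box_monomials k D"
  then show "restrict (Poly_Mapping.lookup x) {..<k} \<in> {..<k} \<rightarrow>\<^sub>E {..D}" by (auto simp: box_monomials_def)
next
  fix g assume g: "g \<in> {..<k} \<rightarrow>\<^sub>E {..D}"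
  define h where "h i = (if i < k then g i else 0)" for i
  have "finite {i. h i \<noteq> 0}" by (rule finite_subset[of _ "{..<k}"]) (auto simp: h_def)
  then have l: "Poly_Mapping.lookup (Abs_poly_mapping h) = h" by (simp add: Abs_poly_mapping_inverse)
  then have "Abs_poly_mapping h \<in> box_monomials k D"
    using g by (auto simp: box_monomials_def in_keys_iff h_def PiE_def Pi_def split: if_splits)
  moreover have "g = restrict h {..<k}" using g by (auto simp: h_def restrict_def PiE_def extensional_def fun_eq_iff)
  ultimately show "\<exists>x\<in>box_monomials k D. g = restrict (Poly_Mapping.lookup x) {..<k}" using l by metis
qed

lemma card_box_monomials: "card (box_monomials k D) = (D + 1) ^ k"
  using bij_betw_same_card[OF bij_box_monomials[of k D]] by (simp add: card_PiE)

lemma finite_box_monomials: "finite (box_monomials k D)"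
  using bij_betw_finite[OF bij_box_monomials[of k D]] by (simp add: finite_PiE)

definition box :: "nat \<Rightarrow> nat \<Rightarrow> cpoly set" where
  "box k D = {p. Poly_Mapping.keys p \<subseteq> box_monomials k D}"

lemma box_mono: "D \<le> D' \<Longrightarrow> box k D \<subseteq> box k D'"
  unfolding box_def box_monomials_def using order_trans by blast

lemma box_mult: "p \<in> box k D \<Longrightarrow> q \<in> box k E \<Longrightarrow> p * q \<in> box k (D + E)"
proof -
  assume p: "p \<in> box k D" and q: "q \<in> box k E"
  have "m \<in> box_monomials k (D + E)" if m: "m \<in> Poly_Mapping.keys (p * q)" for m
  proof -
    obtain a b where "m = a + b" "a \<in> Poly_Mapping.keys p" "b \<in> Poly_Mapping.keys q"
      using subsetD[OF keys_mult m] by auto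
    moreover have "a \<in> box_monomials k D" "b \<in> box_monomials k E"
      using p q calculation by (auto simp: box_def)
    ultimately show ?thesis
      using keys_add[of a b] unfolding box_monomials_def by (auto simp: lookup_add intro!: add_mono)
  qed
  then show ?thesis by (auto simp: box_def)
qed

lemma box_1: "1 \<in> box k D"
  by (auto simp: box_def box_monomials_def)

lemma box_power: "p \<in> box k D \<Longrightarrow> p ^ e \<in> box k (e * D)"
  by (induction e) (auto simp: box_1 intro: box_mult)

lemma box_prod: "finite A \<Longrightarrow> (\<And>i. i \<in> A \<Longrightarrow> f i \<in> box k (D i)) \<Longrightarrow> prod f A \<in> box k (sum D A)"
  by (induction A rule: finite_induct) (auto simp: box_1 intro: box_mult)

lemma polynomials_box: "p \<in> polynomials k \<Longrightarrow> \<exists>D. p \<in> box k D"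
proof -
  assume p: "p \<in> polynomials k"
  define D where "D = (\<Sum>m\<in>Poly_Mapping.keys p. \<Sum>i\<in>Poly_Mapping.keys m. Poly_Mapping.lookup m i)"
  have "Poly_Mapping.lookup m i \<le> D" if m: "m \<in> Poly_Mapping.keys p" for m i
  proof (cases "i \<in> Poly_Mapping.keys m")
    case True
    then have "Poly_Mapping.lookup m i \<le> (\<Sum>i\<in>Poly_Mapping.keys m. Poly_Mapping.lookup m i)"
      by (intro member_le_sum) auto
    also have "\<dots> \<le> D" unfolding D_def
      by (rule member_le_sum[OF m, of "\<lambda>m. \<Sum>i\<in>Poly_Mapping.keys m. Poly_Mapping.lookup m i"]) auto
    finally show ?thesis .
  qed (simp add: in_keys_iff)
  then show ?thesis using p by (intro exI[of _ D]) (auto simp: box_def box_monomials_def polynomials_def)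
qed

lemma box_span: "box k D \<subseteq> cpoly.span ((\<lambda>m. Poly_Mapping.single m 1) ` box_monomials k D)"
proof
  fix p assume p: "p \<in> box k D"
  have "(\<Sum>m\<in>Poly_Mapping.keys p. Poly_Mapping.single m (Poly_Mapping.lookup p m))
      = (\<Sum>m\<in>Poly_Mapping.keys p. Const (Poly_Mapping.lookup p m) * Poly_Mapping.single m 1)"
    by (intro sum.cong refl) (simp add: Const_def mult_single)
  moreover have "\<dots> \<in> cpoly.span ((\<lambda>m. Poly_Mapping.single m 1) ` box_monomials k D)"
    using p by (intro cpoly.span_sum cpoly.span_scale cpoly.span_base) (auto simp: box_def)
  ultimately show "p \<in> cpoly.span ((\<lambda>m. Poly_Mapping.single m 1) ` box_monomials k D)"
    using sum_singles[of p] by simp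
qed

text \<open>Dimension count: the number of monomials in the \<open>F a\<close> with exponents up to
  \<open>N\<close> grows with the power \<open>Suc k\<close> of \<open>N\<close>, while their values
  lie in a space whose dimension grows with the power \<open>k\<close>.\<close>

lemma algebraic_dependence:
  assumes F: "\<And>a. a < Suc k \<Longrightarrow> F a \<in> polynomials k"
  shows "\<exists>P\<in>polynomials (Suc k). P \<noteq> 0 \<and> subst Const F P = 0"
proof -
  have "\<exists>d. \<forall>a<Suc k. F a \<in> box k (d a)" using polynomials_box[OF F] by metis
  then obtain d' where d': "\<And>a. a < Suc k \<Longrightarrow> F a \<in> box k (d' a)" by blast
  define d where "d = (\<Sum>a<Suc k. d' a)"
  have d: "F a \<in> box k d" if "a < Suc k" for a
    using d'[OF that] box_mono[of "d' a" d k] member_le_sum[of a "{..<Suc k}" d'] that by (auto simp: d_def)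
  \<comment> \<open>Chosen so that \<open>?D + 1\<close> is at most \<open>(N + 1) * c\<close>. With
    \<open>N = c ^ k\<close> the dimension is then at most \<open>(N + 1) ^ k * N\<close>, just
    below the number of monomials.\<close>
  define c where "c = Suc k * d + 1"
  define N where "N = c ^ k"
  define E where "E = box_monomials (Suc k) N"
  define G where "G m = (\<Prod>i\<in>Poly_Mapping.keys m. F i ^ Poly_Mapping.lookup m i)" for m
  let ?D = "Suc k * (N * d)"
  let ?T = "(\<lambda>m. Poly_Mapping.single m 1) ` box_monomials k ?D :: cpoly set"
  have "G m \<in> cpoly.span ?T" if m: "m \<in> E" for m
  proof -
    have km: "Poly_Mapping.keys m \<subseteq> {..<Suc k}" "\<And>i. Poly_Mapping.lookup m i \<le> N"
      using m by (auto simp: E_def box_monomials_def)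
    have "G m \<in> box k (\<Sum>i\<in>Poly_Mapping.keys m. Poly_Mapping.lookup m i * d)"
      unfolding G_def using km by (intro box_prod box_power d) auto
    moreover have "(\<Sum>i\<in>Poly_Mapping.keys m. Poly_Mapping.lookup m i * d) \<le> (\<Sum>i\<in>Poly_Mapping.keys m. N * d)"
      using km by (intro sum_mono) auto
    then have "(\<Sum>i\<in>Poly_Mapping.keys m. Poly_Mapping.lookup m i * d) \<le> ?D"
      using mult_right_mono[OF card_mono[OF _ km(1)], of "N * d"] by simp
    ultimately show ?thesis using box_mono box_span by blast
  qed
  moreover have "card ?T < card E"
  proof -
    have "card ?T \<le> (?D + 1) ^ k"
      using card_image_le[OF finite_box_monomials, of "\<lambda>m. Poly_Mapping.single m (1::complex)" k ?D]
      by (simp add: card_box_monomials)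
    also have "?D + 1 \<le> (N + 1) * c" by (simp add: c_def algebra_simps)
    then have "(?D + 1) ^ k \<le> ((N + 1) * c) ^ k" by (rule power_mono) (rule le0)
    also have "\<dots> = (N + 1) ^ k * N" unfolding power_mult_distrib by (simp only: N_def)
    also have "\<dots> < (N + 1) ^ k * (N + 1)" by (rule mult_strict_left_mono) simp_all
    also have "\<dots> = card E" unfolding E_def card_box_monomials by (simp only: power_Suc mult.commute)
    finally show ?thesis .
  qed
  ultimately obtain u where u: "\<exists>e\<in>E. u e \<noteq> 0" "(\<Sum>e\<in>E. Const (u e) * G e) = 0"
    using cpoly.ex_relation[of E ?T G] finite_box_monomials by (auto simp: E_def)
  define P where "P = (\<Sum>e\<in>E. Poly_Mapping.single e (u e))"
  have fE: "finite E" by (simp add: E_def finite_box_monomials)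
  have "Poly_Mapping.lookup P e = u e" if "e \<in> E" for e
    using that fE by (simp add: P_def lookup_sum lookup_single when_def)
  then have "P \<noteq> 0" using u(1) by auto
  moreover have "P \<in> polynomials (Suc k)"
    unfolding P_def by (intro polynomials_sum) (auto simp: polynomials_def E_def box_monomials_def)
  moreover have "subst Const F P = 0"
    using u(2) by (simp add: P_def subst_sum[OF Const_hom] subst_single[OF Const_hom] G_def)
  ultimately show ?thesis by blast
qed

lemma subst_subst_const:
  "subst (\<lambda>c. [:c:]) \<gamma> (subst Const y p) = subst (\<lambda>c. [:c:]) (\<lambda>i. subst (\<lambda>c. [:c:]) \<gamma> (y i)) p"
  by (rule comm_ring_hom_eqI[OF comm_ring_hom_comp[OF subst_hom[OF const_poly_hom] subst_hom[OF Const_hom]]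
        subst_hom[OF const_poly_hom]])
    (auto simp: subst_Const subst_Var const_poly_hom Const_hom)

lemma subst_in_polynomials:
  assumes "p \<in> polynomials n" "\<And>i. i < n \<Longrightarrow> y i \<in> polynomials k"
  shows "subst Const y p \<in> polynomials k"
  using assms(1)
  by (induction rule: polynomials_induct)
    (auto simp: subst_Const subst_Var subst_add subst_mult Const_hom assms(2) intro: polynomials_add polynomials_mult)

text \<open>Serves as a limit at 0: an identity obtained after dividing by a power of
  \<open>s\<close> extends to \<open>s = 0\<close>.\<close>

lemma poly_eq_0_if: "(\<And>s. s \<noteq> 0 \<Longrightarrow> poly p s = 0) \<Longrightarrow> p = (0 :: complex poly)"
proof -
  assume "\<And>s. s \<noteq> 0 \<Longrightarrow> poly p s = 0"
  then have "poly ([:0, 1:] * p) s = 0" for s by (cases "s = 0") auto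
  then have "[:0, 1:] * p = 0" using poly_all_0_iff_0 by blast
  then show ?thesis by simp
qed

lemma ev_poly_Const: "ev y (poly R (Const s)) = (\<Sum>d\<le>degree R. ev y (coeff R d) * s ^ d)"
  by (simp add: poly_altdef ev.hom_sum ev.hom_mult ev.hom_power)

lemma ev_tot: "ev y (poly (tot p) (Const s)) = ev (\<lambda>i. s * y i) p"
  by (rule comm_ring_hom_eqI[OF comm_ring_hom_comp[OF comm_ring_hom_comp[OF ev.comm_ring_hom_axioms comm_ring_hom_poly] tot.comm_ring_hom_axioms]
        ev.comm_ring_hom_axioms])
    (auto simp: ev.hom_mult)

text \<open>The lowest homogeneous part of \<open>P(c + \<cdot>)\<close> survives along curves with tangent \<open>\<xi>\<close>.\<close>

lemma curve_nonvanishing: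
  assumes P: "P \<in> polynomials k" "P \<noteq> 0"
  obtains \<xi> where "\<And>\<gamma>. (\<And>i. i < k \<Longrightarrow> coeff (\<gamma> i) 0 = c i \<and> coeff (\<gamma> i) 1 = \<xi> i) \<Longrightarrow>
    subst (\<lambda>c. [:c:]) \<gamma> P \<noteq> 0"
proof -
  \<comment> \<open>The Taylor expansion of \<open>P\<close> at \<open>c\<close>; its part of lowest
    degree \<open>d0\<close> governs the behaviour near \<open>c\<close>.\<close>
  define Q where "Q = subst Const (\<lambda>i. Var i + Const (c i)) P"
  have "P = subst Const (\<lambda>i. Var i - Const (c i)) Q"
    unfolding Q_def
    by (rule cpoly_eqI) (simp add: ev_subst_Const ev.hom_add ev.hom_minus)
  then have "Q \<noteq> 0" using P(2) subst_Const[OF Const_hom, of "\<lambda>i. Var i - Const (c i)" 0] by auto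
  have ex: "\<exists>d. coeff (tot Q) d \<noteq> 0" using \<open>Q \<noteq> 0\<close> by (intro exI[of _ "degree (tot Q)"]) simp
  then obtain d0 where d0: "coeff (tot Q) d0 \<noteq> 0" "\<And>d. d < d0 \<Longrightarrow> coeff (tot Q) d = 0"
    using exists_least_iff[of "\<lambda>d. coeff (tot Q) d \<noteq> 0"] by blast
  obtain \<xi> where \<xi>: "ev \<xi> (coeff (tot Q) d0) \<noteq> 0"
    using d0(1) cpoly_eqI[of "coeff (tot Q) d0" 0] by auto
  show ?thesis
  proof (rule that[of \<xi>], rule notI)
    fix \<gamma> :: "nat \<Rightarrow> complex poly"
    assume \<gamma>: "\<And>i. i < k \<Longrightarrow> coeff (\<gamma> i) 0 = c i \<and> coeff (\<gamma> i) 1 = \<xi> i"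
      and zero: "subst (\<lambda>c. [:c:]) \<gamma> P = 0"
    \<comment> \<open>The difference quotient of the curve at its starting point. The default from
      \<open>k\<close> on makes the value at 0 equal to \<open>\<xi> i\<close> for every
      \<open>i\<close>.\<close>
    define \<eta> where "\<eta> i = (if i < k then poly_shift 1 (\<gamma> i) else [:\<xi> i:])" for i
    have \<eta>0: "poly (\<eta> i) 0 = \<xi> i" for i
      using \<gamma>[of i] by (auto simp: \<eta>_def poly_0_coeff_0 coeff_poly_shift)
    have \<gamma>\<eta>: "\<gamma> i = [:c i:] + [:0, 1:] * \<eta> i" if "i < k" for i
      using \<gamma>[OF that] that by (intro poly_eqI) (auto simp: \<eta>_def coeff_pCons coeff_poly_shift split: nat.splits)
    have "subst (\<lambda>c. [:c:]) \<gamma> P = subst (\<lambda>c. [:c:]) (\<lambda>i. [:c i:] + [:0, 1:] * \<eta> i) P"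
      by (rule subst_cong[OF P(1)]) (rule \<gamma>\<eta>)
    also have "\<dots> = subst (\<lambda>c. [:c:]) (\<lambda>i. [:0, 1:] * \<eta> i) Q"
      unfolding Q_def subst_subst_const
      by (simp add: subst_add subst_Var subst_Const const_poly_hom add.commute)
    finally have z: "subst (\<lambda>c. [:c:]) (\<lambda>i. [:0, 1:] * \<eta> i) Q = 0" using zero by simp
    \<comment> \<open>\<open>Q\<close> along the curve, divided by the power \<open>d0\<close> of
      the parameter. The \<open>max\<close> keeps \<open>d0\<close> inside the range, so that the
      value of \<open>H\<close> at 0 is the lowest part of \<open>Q\<close> at \<xi>.\<close>
    define H where "H = (\<Sum>d\<in>{d0..max d0 (degree (tot Q))}. monom 1 (d - d0) * subst (\<lambda>c. [:c:]) \<eta> (coeff (tot Q) d))"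
    have "poly H s = 0" if "s \<noteq> 0" for s
    proof -
      let ?y = "\<lambda>i. poly (\<eta> i) s"
      have "0 = ev (\<lambda>i. s * ?y i) Q" using arg_cong[OF z, of "\<lambda>p. poly p s"] by (simp add: poly_subst)
      also have "\<dots> = (\<Sum>d\<le>degree (tot Q). ev ?y (coeff (tot Q) d) * s ^ d)"
        by (simp add: ev_tot[symmetric] ev_poly_Const)
      also have "\<dots> = (\<Sum>d\<in>{d0..max d0 (degree (tot Q))}. ev ?y (coeff (tot Q) d) * s ^ d)"
        by (rule sum.mono_neutral_cong) (auto simp: d0(2) coeff_eq_0 not_le)
      also have "\<dots> = s ^ d0 * poly H s"
        unfolding H_def poly_sum sum_distrib_left
        by (intro sum.cong refl) (auto simp: poly_monom poly_subst power_add[symmetric] algebra_simps)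
      finally show ?thesis using that by simp
    qed
    then have "poly H 0 = 0" using poly_eq_0_if[of H] by simp
    moreover have "poly H 0 = (\<Sum>d\<in>{d0..max d0 (degree (tot Q))}. if d = d0 then ev \<xi> (coeff (tot Q) d) else 0)"
      unfolding H_def poly_sum by (intro sum.cong refl) (auto simp: poly_monom poly_subst \<eta>0)
    ultimately show False using \<xi> by simp
  qed
qed

section \<open>Lueroth's theorem\<close>

definition swap_poly :: "'a::comm_ring_1 poly poly \<Rightarrow> 'a poly poly" where
  "swap_poly P = (\<Sum>k\<le>degree P. map_poly (\<lambda>c. monom c k) (coeff P k))"

lemma coeff_swap_poly: "coeff (coeff (swap_poly P) i) k = coeff (coeff P k) i"
proof -
  have "coeff (coeff (swap_poly P) i) k = (\<Sum>j\<le>degree P. coeff (monom (coeff (coeff P j) i) j) k)"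
    by (simp add: swap_poly_def coeff_sum coeff_map_poly)
  also have "\<dots> = (\<Sum>j\<in>{..degree P}. if j = k then coeff (coeff P j) i else 0)"
    by (intro sum.cong) auto
  also have "\<dots> = coeff (coeff P k) i"
    by (auto simp: coeff_eq_0)
  finally show ?thesis .
qed

lemma swap_poly_hom: "comm_ring_hom (swap_poly :: 'a::comm_ring_1 poly poly \<Rightarrow> _)"
proof
  show "swap_poly (P * Q) = swap_poly P * swap_poly Q" for P Q :: "'a poly poly"
  proof (intro poly_eqI)
    fix i j
    have "coeff (coeff (swap_poly (P * Q)) i) j =
        (\<Sum>k\<le>j. \<Sum>l\<le>i. coeff (coeff P k) l * coeff (coeff Q (j - k)) (i - l))"
      by (simp add: coeff_swap_poly coeff_mult coeff_sum)
    also have "\<dots> = (\<Sum>l\<le>i. \<Sum>k\<le>j. coeff (coeff P k) l * coeff (coeff Q (j - k)) (i - l))"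
      by (rule sum.swap)
    also have "\<dots> = coeff (coeff (swap_poly P * swap_poly Q) i) j"
      by (simp add: coeff_swap_poly coeff_mult coeff_sum)
    finally show "coeff (coeff (swap_poly (P * Q)) i) j = \<dots>" .
  qed
qed (auto intro!: poly_eqI simp: coeff_swap_poly one_pCons coeff_pCons split: nat.splits)

interpretation swap_poly: comm_ring_hom swap_poly by (rule swap_poly_hom)

lemma swap_poly_swap_poly [simp]: "swap_poly (swap_poly P) = P"
  by (intro poly_eqI) (simp add: coeff_swap_poly)

lemma swap_poly_eq_0_iff [simp]: "swap_poly P = 0 \<longleftrightarrow> P = 0"
  by (metis swap_poly.hom_zero swap_poly_swap_poly)

abbreviation lift_poly :: "'a::comm_ring_1 poly \<Rightarrow> 'a poly poly" where
  "lift_poly \<equiv> map_poly (\<lambda>c. [:c:])"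

lemma coeff_lift_poly [simp]: "coeff (lift_poly u) k = [:coeff u k:]"
  by (simp add: coeff_map_poly)

lemma swap_lift_poly: "swap_poly (lift_poly u) = [:u:]"
  by (intro poly_eqI) (auto simp: coeff_swap_poly coeff_pCons split: nat.splits)

lemma swap_const_poly: "swap_poly [:u:] = lift_poly u"
  by (metis swap_lift_poly swap_poly_swap_poly)

lemma degree_le_swap: "degree (coeff P k) \<le> degree (swap_poly P)"
proof (rule degree_le, intro allI impI)
  fix i assume "degree (swap_poly P) < i"
  then have "coeff (swap_poly P) i = 0" by (rule coeff_eq_0)
  then show "coeff (coeff P k) i = 0" using coeff_swap_poly[of P i k] by simp
qed

text \<open>The polynomial \<open>u(x)v(t) - v(x)u(t)\<close>, as a polynomial in \<open>x\<close> with coefficients in \<open>\<complex>[t]\<close>.\<close>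

definition skew :: "complex poly \<Rightarrow> complex poly \<Rightarrow> complex poly poly" where
  "skew u v = smult v (lift_poly u) - smult u (lift_poly v)"

lemma coeff_skew: "coeff (skew u v) k = smult (coeff u k) v - smult (coeff v k) u"
  by (simp add: skew_def)

text \<open>Puts a number for the inner variable of the coefficients; the outer variable
  \<open>x\<close> remains.\<close>

definition spec :: "complex \<Rightarrow> complex poly poly \<Rightarrow> complex poly" where
  "spec t P = poly (swap_poly P) [:t:]"

lemma spec_dvd: "P dvd Q \<Longrightarrow> spec t P dvd spec t Q"
  by (auto simp: spec_def swap_poly.hom_mult elim!: dvdE)

lemma poly_lift_const: "poly (lift_poly u) [:t:] = [:poly u t:]"
  by (induction u) (auto simp: map_poly_pCons)

lemma spec_skew: "spec t (skew u v) = smult (poly v t) u - smult (poly u t) v"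
proof -
  have eq: "skew u v = [:v:] * lift_poly u - [:u:] * lift_poly v" by (simp add: skew_def)
  show ?thesis
    unfolding spec_def eq swap_poly.hom_minus swap_poly.hom_mult swap_lift_poly swap_const_poly
    by (simp add: poly_lift_const)
qed

abbreviation cfract :: "complex \<Rightarrow> complex poly fract" where
  "cfract c \<equiv> to_fract [:c:]"

lemma poly_cfract: "poly (map_poly cfract u) (to_fract [:0, 1:]) = to_fract u"
proof (induction u)
  case (pCons c u)
  have "to_fract (pCons c u) = to_fract ([:c:] + [:0, 1:] * u)" by simp
  then show ?case using pCons by (simp add: map_poly_pCons del: mult_pCons_left)
qed simp

text \<open>The left side is the evident polynomial over the field generated by \<open>a / b\<close>
  that vanishes at the variable; \<open>skew a b\<close> is the same polynomial with its denominator
  cleared.\<close>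

lemma map_poly_cfract_skew:
  assumes "b \<noteq> 0"
  shows "map_poly cfract a - smult (to_fract a / to_fract b) (map_poly cfract b)
      = smult (1 / to_fract b) (fract_poly (skew a b))"
  using assms
  by (intro poly_eqI) (simp add: coeff_map_poly coeff_skew field_simps flip: to_fract_mult to_fract_diff)

text \<open>A field strictly above the constants inside the rational functions of one
  variable.\<close>

locale fract_subfield =
  fixes K :: "complex poly fract set"
  assumes const: "cfract c \<in> K"
    and add: "x \<in> K \<Longrightarrow> y \<in> K \<Longrightarrow> x + y \<in> K"
    and mult: "x \<in> K \<Longrightarrow> y \<in> K \<Longrightarrow> x * y \<in> K"
    and inv: "x \<in> K \<Longrightarrow> inverse x \<in> K"
    and nonconst: "\<exists>q\<in>K. \<forall>c. q \<noteq> cfract c"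
begin

lemma zero: "0 \<in> K" using const[of 0] by simp

lemma uminus: "x \<in> K \<Longrightarrow> - x \<in> K"
proof -
  have "[:-1:] = (-1 :: complex poly)" by (simp add: one_pCons)
  then have "cfract (-1) = -1" by (metis to_fract_1 to_fract_uminus)
  then show "x \<in> K \<Longrightarrow> - x \<in> K" using mult[OF const[of "-1"], of x] by (simp del: pCons_eq_0_iff)
qed
lemma diff: "x \<in> K \<Longrightarrow> y \<in> K \<Longrightarrow> x - y \<in> K"
  using add[of x "- y"] uminus by simp
lemma divide: "x \<in> K \<Longrightarrow> y \<in> K \<Longrightarrow> x / y \<in> K"
  using mult inv by (simp add: divide_inverse)

definition rep :: "complex poly \<Rightarrow> complex poly \<Rightarrow> bool" where
  "rep u v \<longleftrightarrow> v \<noteq> 0 \<and> to_fract u / to_fract v \<in> K"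

definition nconst :: "complex poly \<Rightarrow> complex poly \<Rightarrow> bool" where
  "nconst u v \<longleftrightarrow> (\<forall>c. u \<noteq> smult c v)"

lemma nconst_iff: "v \<noteq> 0 \<Longrightarrow> nconst u v \<longleftrightarrow> (\<forall>c. to_fract u / to_fract v \<noteq> cfract c)"
proof -
  assume v: "v \<noteq> 0"
  have "u = smult c v \<longleftrightarrow> to_fract u / to_fract v = cfract c" for c
  proof -
    have "to_fract v * cfract c = to_fract (smult c v)" by (simp flip: to_fract_mult)
    then show ?thesis using v by (simp add: divide_eq_eq mult.commute)
  qed
  then show ?thesis by (simp add: nconst_def)
qed

lemma ex_rep: "q \<in> K \<Longrightarrow> \<exists>u v. rep u v \<and> q = to_fract u / to_fract v"
  unfolding rep_def by (cases q) (auto simp: Fract_conv_to_fract)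

definition size_of :: "complex poly \<Rightarrow> complex poly \<Rightarrow> nat" where
  "size_of u v = max (degree u) (degree v)"

text \<open>The candidate for a generator: a nonconstant fraction in \<open>K\<close> of least
  size.\<close>

lemma ex_minimal:
  obtains a b where "rep a b" "nconst a b"
    "\<And>u v. rep u v \<Longrightarrow> nconst u v \<Longrightarrow> size_of a b \<le> size_of u v"
proof -
  have "\<exists>z. rep (fst z) (snd z) \<and> nconst (fst z) (snd z)"
  proof -
    obtain q where q: "q \<in> K" "\<forall>c. q \<noteq> cfract c" using nonconst by blast
    obtain u v where uv: "rep u v" "q = to_fract u / to_fract v" using ex_rep[OF q(1)] by blast
    then have "nconst u v" using q(2) nconst_iff[of v u] by (auto simp: rep_def)
    then show ?thesis using uv by auto
  qed
  then obtain z where "rep (fst z) (snd z) \<and> nconst (fst z) (snd z)"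
    "\<forall>y. rep (fst y) (snd y) \<and> nconst (fst y) (snd y) \<longrightarrow> size_of (fst z) (snd z) \<le> size_of (fst y) (snd y)"
    using ex_has_least_nat[of "\<lambda>z. rep (fst z) (snd z) \<and> nconst (fst z) (snd z)" _ "\<lambda>z. size_of (fst z) (snd z)"]
    by blast
  then show ?thesis using that[of "fst z" "snd z"] by auto
qed

context
  fixes a b
  assumes ab: "rep a b" "nconst a b"
    and ab_min: "\<And>u v. rep u v \<Longrightarrow> nconst u v \<Longrightarrow> size_of a b \<le> size_of u v"
begin

lemma b0: "b \<noteq> 0" using ab by (simp add: rep_def)
lemma a0: "a \<noteq> 0" using ab by (auto simp: nconst_def dest: spec[of _ 0])

lemma skew_nonzero: "nconst u v \<Longrightarrow> v \<noteq> 0 \<Longrightarrow> skew u v \<noteq> 0"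
proof
  assume "nconst u v" "v \<noteq> 0" "skew u v = 0"
  then have "smult (coeff u (degree v)) v = smult (lead_coeff v) u"
    using coeff_skew[of u v "degree v"] by simp
  then have "u = smult (coeff u (degree v) / lead_coeff v) v"
    using \<open>v \<noteq> 0\<close> by (metis (no_types, lifting) leading_coeff_0_iff nonzero_eq_divide_eq smult_smult
        divide_self smult_1_left mult.commute divide_inverse)
  then show False using \<open>nconst u v\<close> by (auto simp: nconst_def)
qed

text \<open>A nonconstant common factor could be cancelled, which would lower the size.\<close>

lemma coprime_ab: "q dvd a \<Longrightarrow> q dvd b \<Longrightarrow> degree q = 0"
proof (rule ccontr)
  assume "q dvd a" "q dvd b" "degree q \<noteq> 0"
  then obtain a' b' where e: "a = q * a'" "b = q * b'" by (auto elim!: dvdE)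
  then have nz: "q \<noteq> 0" "a' \<noteq> 0" "b' \<noteq> 0" using a0 b0 by auto
  have "rep a' b'" using ab(1) nz by (simp add: rep_def e)
  moreover have "nconst a' b'" using ab(2) by (force simp: nconst_def e)
  moreover have "size_of a' b' < size_of a b"
    using \<open>degree q \<noteq> 0\<close> nz by (simp add: size_of_def e degree_mult_eq max_def)
  ultimately show False using ab_min by force
qed

text \<open>Membership in the ideal of polynomials over \<open>K\<close> that have the variable as a
  root; its monic generator is the minimal polynomial of the variable over \<open>K\<close>.\<close>

definition vanishing :: "complex poly fract poly \<Rightarrow> bool" where
  "vanishing P \<longleftrightarrow> (\<forall>i. coeff P i \<in> K) \<and> poly P (to_fract [:0, 1:]) = 0"

lemma vanishing_rep:
  assumes "rep u v"
  shows "vanishing (smult (1 / to_fract v) (fract_poly (skew u v)))"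
proof -
  have v: "v \<noteq> 0" using assms by (simp add: rep_def)
  show ?thesis
    unfolding vanishing_def map_poly_cfract_skew[OF v, symmetric]
  proof (intro conjI allI)
    show "coeff (map_poly cfract u - smult (to_fract u / to_fract v) (map_poly cfract v)) i \<in> K" for i
      using assms unfolding rep_def coeff_diff coeff_smult
      by (auto simp: coeff_map_poly simp del: times_divide_eq_left intro!: diff mult const)
  qed (use v in \<open>simp add: poly_cfract\<close>)
qed

text \<open>Division by a monic element of least degree keeps all coefficients in \<open>K\<close>,
  so the remainder is again in the ideal.\<close>

lemma ex_min_poly:
  obtains D where "vanishing D" "lead_coeff D = 1" "\<And>P. vanishing P \<Longrightarrow> D dvd P"
proof -
  define nz where "nz P \<longleftrightarrow> vanishing P \<and> P \<noteq> 0" for P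
  have "nz (smult (1 / to_fract b) (fract_poly (skew a b)))"
    unfolding nz_def using vanishing_rep[OF ab(1)] skew_nonzero[OF ab(2) b0] b0 by simp
  then obtain D0 where D0: "nz D0" and min: "\<And>P. nz P \<Longrightarrow> degree D0 \<le> degree P"
    using ex_has_least_nat[of nz _ degree] by blast
  define D where "D = smult (inverse (lead_coeff D0)) D0"
  have "D0 \<noteq> 0" using D0 by (simp add: nz_def)
  then have monic: "lead_coeff D = 1" "degree D = degree D0" by (auto simp: D_def)
  have van: "vanishing D"
    using D0 by (auto simp: nz_def vanishing_def D_def intro!: mult inv)
  have "D dvd P" if "vanishing P" for P
    using that
  proof (induction "degree P" arbitrary: P rule: less_induct)
    case less
    show ?case
    proof (cases "P = 0")
      case False
      then have le: "degree D \<le> degree P" using min[of P] less.prems monic by (simp add: nz_def)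
      define Q where "Q = P - smult (lead_coeff P) (monom 1 (degree P - degree D) * D)"
      have van_Q: "vanishing Q"
        using less.prems van unfolding vanishing_def Q_def
        by (auto simp: coeff_monom_mult intro!: diff mult zero)
      have "D dvd Q"
      proof (cases "Q = 0")
        case False
        have "degree Q \<le> degree P"
          unfolding Q_def using le
          by (intro degree_diff_le order.trans[OF degree_smult_le] order.trans[OF degree_mult_le])
            (auto simp: degree_monom_eq)
        moreover have "coeff Q (degree P) = 0"
          unfolding Q_def using le monic(1) by (simp add: coeff_monom_mult)
        ultimately have "degree Q < degree P"
          using False by (metis leading_coeff_0_iff le_neq_implies_less)
        then show ?thesis using less.hyps van_Q by blast
      qed simp
      moreover have "P = Q + D * smult (lead_coeff P) (monom 1 (degree P - degree D))"
        by (simp add: Q_def mult.commute)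
      ultimately show ?thesis by (metis dvd_add dvd_triv_left)
    qed simp
  qed
  then show ?thesis using that van monic by blast
qed

text \<open>The minimal polynomial of the variable over \<open>K\<close> has a nonconstant coefficient, whose size is
  at least that of \<open>a / b\<close>. Hence, made primitive, it coincides with \<open>skew a b\<close>.\<close>

lemma skew_dvd:
  assumes "rep u v"
  shows "skew a b dvd skew u v"
proof -
  let ?H = "skew a b"
  obtain D where D: "vanishing D" "lead_coeff D = 1" "\<And>P. vanishing P \<Longrightarrow> D dvd P"
    using ex_min_poly by blast
  define M where "M = primitive_part_fract D"
  define c where "c = fract_content D"
  have DM: "D = smult c (fract_poly M)"
    by (simp add: M_def c_def content_times_primitive_part_fract)
  have "D \<noteq> 0" using D by auto
  then have M0: "M \<noteq> 0" "c \<noteq> 0" using DM by auto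
  have cM: "content M = 1" using \<open>D \<noteq> 0\<close> by (simp add: M_def)
  have M_dvd: "M dvd skew u v" if "rep u v" for u v
  proof -
    have "v \<noteq> 0" using that by (simp add: rep_def)
    have "fract_poly M dvd smult (1 / to_fract v) (fract_poly (skew u v))"
      using D(3)[OF vanishing_rep[OF that]] DM M0 by (metis smult_dvd_cancel)
    then have "fract_poly M dvd fract_poly (skew u v)"
      using \<open>v \<noteq> 0\<close> by (simp add: dvd_smult_iff)
    then show ?thesis using fract_poly_dvdD cM by blast
  qed
  obtain Q where Q: "?H = M * Q" using M_dvd[OF ab(1)] by (auto elim: dvdE)
  have H0: "?H \<noteq> 0" by (rule skew_nonzero[OF ab(2) b0])
  \<comment> \<open>With constant coefficients only, the variable would be algebraic over the
    complex numbers.\<close>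
  have "\<exists>k. \<forall>e. coeff D k \<noteq> cfract e"
  proof (rule ccontr)
    assume "\<not> ?thesis"
    then obtain e where e: "\<And>k. coeff D k = cfract (e k)" by metis
    define d where "d = Abs_poly (\<lambda>k. if k \<le> degree D then e k else 0)"
    have "coeff d k = e k" for k
    proof -
      have "e k = 0" if "k > degree D"
        using e[of k] that by (simp add: coeff_eq_0)
      then show ?thesis unfolding d_def
        by (subst coeff_Abs_poly[of "degree D"]) auto
    qed
    then have "D = map_poly cfract d" by (intro poly_eqI) (simp add: coeff_map_poly e)
    then have "to_fract d = 0" using D(1) by (simp add: vanishing_def poly_cfract)
    then show False using \<open>D = map_poly cfract d\<close> \<open>D \<noteq> 0\<close> by simp
  qed
  then obtain k where k: "\<And>e. coeff D k \<noteq> cfract e" by blast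
  have "c * to_fract (lead_coeff M) = 1"
    using D(2) M0 by (simp add: DM degree_map_poly coeff_map_poly)
  then have "coeff D k = to_fract (coeff M k) / to_fract (lead_coeff M)"
    using M0 by (simp add: DM coeff_map_poly field_simps)
  then have "rep (coeff M k) (lead_coeff M)" "nconst (coeff M k) (lead_coeff M)"
    using D(1) k M0 by (auto simp: rep_def vanishing_def nconst_iff dest: spec[of _ k])
  then have "size_of a b \<le> size_of (coeff M k) (lead_coeff M)" by (rule ab_min)
  also have "\<dots> \<le> degree (swap_poly M)" by (simp add: size_of_def degree_le_swap)
  \<comment> \<open>After \<open>swap_poly\<close> the degree is the one in \<open>t\<close>. It is
    at least \<open>size_of a b\<close> for \<open>M\<close> and at most that for
    \<open>M * Q\<close>, so \<open>Q\<close> does not involve \<open>t\<close>.\<close>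
  finally have ge: "size_of a b \<le> degree (swap_poly M)" .
  have "degree (swap_poly ?H) \<le> size_of a b"
  proof (rule degree_le, intro allI impI)
    fix i assume "size_of a b < i"
    then have "coeff (coeff (swap_poly ?H) i) j = 0" for j
      by (simp add: coeff_swap_poly coeff_skew coeff_eq_0 size_of_def)
    then show "coeff (swap_poly ?H) i = 0" by (intro poly_eqI) simp
  qed
  moreover have "degree (swap_poly ?H) = degree (swap_poly M) + degree (swap_poly Q)"
    using H0 unfolding Q by (simp add: swap_poly.hom_mult degree_mult_eq)
  ultimately have "degree (swap_poly Q) = 0" using ge by simp
  then obtain q where q: "swap_poly Q = [:q:]" using degree_eq_zeroE by blast
  have "q dvd coeff (swap_poly ?H) i" for i
    by (simp add: Q swap_poly.hom_mult q)
  moreover have "coeff (swap_poly ?H) i = smult (coeff b i) a - smult (coeff a i) b" for i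
    by (intro poly_eqI) (simp add: coeff_swap_poly coeff_skew)
  ultimately have qd: "q dvd smult (coeff b i) a - smult (coeff a i) b" for i by metis
  obtain i where i: "coeff a i * lead_coeff b \<noteq> lead_coeff a * 0 + coeff b i * coeff a (degree b)"
  proof (rule ccontr)
    assume *: "\<not> thesis"
    have "coeff a i * lead_coeff b = coeff b i * coeff a (degree b)" for i
      using * that by auto
    then have "a = smult (coeff a (degree b) / lead_coeff b) b"
      using b0 by (intro poly_eqI) (simp add: field_simps)
    then show False using ab(2) by (auto simp: nconst_def)
  qed
  define j where "j = degree b"
  \<comment> \<open>A nonzero 2x2 minor of the coefficients of \<open>a\<close> and
    \<open>b\<close>. It recovers multiples of \<open>a\<close> and \<open>b\<close> from two
    coefficients of the swapped \<open>skew a b\<close>, all of which \<open>q\<close>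
    divides.\<close>
  define e where "e = coeff a i * coeff b j - coeff a j * coeff b i"
  have e: "e \<noteq> 0" using i by (simp add: e_def j_def mult.commute)
  have "smult e b = smult (coeff b j) (smult (coeff b i) a - smult (coeff a i) b)
      - smult (coeff b i) (smult (coeff b j) a - smult (coeff a j) b) + smult (2 * e) b"
    by (intro poly_eqI) (simp add: e_def algebra_simps)
  then have "smult e b = smult (coeff b i) (smult (coeff b j) a - smult (coeff a j) b)
      - smult (coeff b j) (smult (coeff b i) a - smult (coeff a i) b)"
    by (intro poly_eqI) (simp add: e_def algebra_simps)
  then have "q dvd smult e b" using qd by (metis dvd_diff dvd_smult)
  then have qb: "q dvd b" using e by (simp add: dvd_smult_iff)
  have "smult e a = smult (coeff a i) (smult (coeff b j) a - smult (coeff a j) b)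
      - smult (coeff a j) (smult (coeff b i) a - smult (coeff a i) b)"
    by (intro poly_eqI) (simp add: e_def algebra_simps)
  then have "q dvd smult e a" using qd by (metis dvd_diff dvd_smult)
  then have "q dvd a" using e by (simp add: dvd_smult_iff)
  then have "degree q = 0" using coprime_ab qb by blast
  then obtain r where "q = [:r:]" using degree_eq_zeroE by blast
  then have "Q = [:[:r:]:]"
    using q swap_const_poly by (metis map_poly_pCons swap_poly_swap_poly map_poly_0 pCons_0_0 pCons_eq_iff)
  moreover have "r \<noteq> 0" using calculation H0 Q by auto
  ultimately have "?H dvd M"
    by (intro dvdI[of _ _ "[:[:1 / r:]:]"]) (simp add: Q flip: one_pCons)
  then show ?thesis using M_dvd[OF assms] dvd_trans by blast
qed

definition at_gen :: "complex poly \<Rightarrow> complex poly fract" where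
  "at_gen N = poly (map_poly cfract N) (to_fract a / to_fract b)"

lemma at_gen_pCons: "at_gen (pCons c N) = cfract c + to_fract a / to_fract b * at_gen N"
  by (simp add: at_gen_def map_poly_pCons)

lemma at_gen_0 [simp]: "at_gen 0 = 0" by (simp add: at_gen_def)

lemma at_gen_add: "at_gen (N + M) = at_gen N + at_gen M"
proof (induction N M rule: poly_induct2)
  case (pCons c N d M)
  have "cfract (c + d) = cfract c + cfract d" by (simp flip: to_fract_add)
  then show ?case using pCons by (simp add: at_gen_pCons algebra_simps)
qed simp

lemma at_gen_smult: "at_gen (smult c N) = cfract c * at_gen N"
proof (induction N)
  case (pCons d N)
  have "cfract (c * d) = cfract c * cfract d" by (simp flip: to_fract_mult)
  then show ?case using pCons by (simp add: at_gen_pCons algebra_simps)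
qed simp

lemma at_gen_mult: "at_gen (N * M) = at_gen N * at_gen M"
proof (induction N)
  case (pCons d N)
  then show ?case by (simp add: at_gen_add at_gen_smult at_gen_pCons algebra_simps)
qed simp

lemma at_gen_const [simp]: "at_gen [:c:] = cfract c"
  by (simp add: at_gen_pCons)

definition gen_by :: "complex poly fract \<Rightarrow> bool" where
  "gen_by q \<longleftrightarrow> (\<exists>N D. at_gen D \<noteq> 0 \<and> q * at_gen D = at_gen N)"

lemma gen_by_mult: "gen_by q \<Longrightarrow> gen_by r \<Longrightarrow> gen_by (q * r)"
proof -
  assume "gen_by q" "gen_by r"
  then obtain N D N' D' where "at_gen D \<noteq> 0" "q * at_gen D = at_gen N"
    "at_gen D' \<noteq> 0" "r * at_gen D' = at_gen N'" by (auto simp: gen_by_def)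
  then have "at_gen (D * D') \<noteq> 0" "q * r * at_gen (D * D') = at_gen (N * N')"
    by (simp_all add: at_gen_mult ac_simps) (metis mult.assoc mult.left_commute)
  then show ?thesis unfolding gen_by_def by blast
qed

lemma gen_by_affine_quotient:
  assumes "to_fract (smult c0 b - smult c1 a) \<noteq> 0"
  shows "gen_by (to_fract (smult d0 a - smult d1 b) / to_fract (smult c0 b - smult c1 a))"
proof -
  have lin: "to_fract (smult e b - smult d a) = to_fract b * at_gen [:e, - d:]" for e d
  proof -
    have "to_fract (smult e b - smult d a) = cfract e * to_fract b - cfract d * to_fract a"
      by (simp flip: to_fract_mult to_fract_diff)
    moreover have "cfract (- d) = - cfract d" by (simp flip: to_fract_uminus)
    ultimately show ?thesis using b0 by (simp add: at_gen_pCons algebra_simps)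
  qed
  have *: "smult d0 a - smult d1 b = smult (- d1) b - smult (- d0) a" by simp
  have "at_gen [:c0, - c1:] \<noteq> 0" using assms unfolding lin by auto
  then show ?thesis unfolding gen_by_def * lin using b0
    by (intro exI[of _ "[:- d1, - (- d0):]"] exI[of _ "[:c0, - c1:]"]) simp
qed

text \<open>The transformation is invertible because \<open>c0\<close> and \<open>c1\<close> differ;
  solving for \<open>q\<close> gives the new numerator and denominator.\<close>

lemma gen_by_if_moebius:
  assumes "c0 \<noteq> c1" "q \<noteq> cfract c1" "gen_by ((q - cfract c0) / (q - cfract c1))"
  shows "gen_by q"
proof -
  obtain N D where ND: "at_gen D \<noteq> 0" "(q - cfract c0) / (q - cfract c1) * at_gen D = at_gen N"
    using assms(3) by (auto simp: gen_by_def)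
  have q: "q - cfract c1 \<noteq> 0" using assms(2) by simp
  then have "(q - cfract c0) * at_gen D = (q - cfract c1) * at_gen N"
    unfolding ND(2)[symmetric] by simp
  then have eq: "q * (at_gen D - at_gen N) = cfract c0 * at_gen D - cfract c1 * at_gen N"
    by (simp add: algebra_simps)
  have "at_gen D \<noteq> at_gen N"
  proof
    assume e: "at_gen D = at_gen N"
    then have "(cfract c0 - cfract c1) * at_gen D = 0" using eq by (auto simp: algebra_simps)
    moreover have "cfract c0 - cfract c1 \<noteq> 0" using assms(1) by simp
    ultimately show False using ND(1) by (metis mult_eq_0_iff)
  qed
  then have nz: "at_gen (D + smult (-1) N) \<noteq> 0"
    using at_gen_add[of "D - N" N] by auto
  have "cfract (- c) = - cfract c" for c by (simp flip: to_fract_uminus)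
  moreover have "cfract 1 = 1" by (simp flip: one_pCons)
  ultimately have "q * at_gen (D + smult (-1) N) = at_gen (smult c0 D + smult (- c1) N)"
    using eq by (simp only: at_gen_add at_gen_smult) (simp add: algebra_simps)
  then show ?thesis using nz unfolding gen_by_def by blast
qed

text \<open>Specialising \<open>skew a b dvd skew u v\<close> at numbers \<open>t\<close> yields
  quotients \<open>s t\<close> of smaller degree, and the ratio of two of them lies in
  \<open>K\<close> again. The ratio of the corresponding \<open>w t\<close> is, up to a constant, a
  Moebius transform of \<open>u / v\<close>.\<close>

lemma rep_gen_by:
  assumes "rep u v"
  shows "gen_by (to_fract u / to_fract v)"
  using assms
proof (induction "size_of u v" arbitrary: u v rule: less_induct)
  case less
  have v0: "v \<noteq> 0" using less.prems by (simp add: rep_def)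
  show ?case
  proof (cases "nconst u v")
    case False
    then obtain c where "to_fract u / to_fract v = cfract c" using nconst_iff[OF v0] by auto
    moreover have "cfract 1 = 1" by (simp flip: one_pCons)
    ultimately show ?thesis unfolding gen_by_def
      by (intro exI[of _ "[:c:]"] exI[of _ "[:1:]"]) simp
  next
    case True
    define m where "m = size_of a b"
    define w where "w t = smult (poly v t) u - smult (poly u t) v" for t
    define e where "e t = smult (poly b t) a - smult (poly a t) b" for t
    have w0: "w t \<noteq> 0" if "poly v t \<noteq> 0" for t
    proof
      assume "w t = 0"
      then have "u = smult (poly u t / poly v t) v"
        using that by (simp add: w_def) (metis divide_inverse left_inverse mult.commute smult_1_left smult_smult)
      then show False using True by (auto simp: nconst_def)
    qed
    have "degree b < m \<or> degree b = m" "degree a < m \<or> degree a = m" "degree a = m \<or> degree b = m"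
      by (auto simp: m_def size_of_def)
    then have "coeff a m \<noteq> 0 \<or> coeff b m \<noteq> 0" using a0 b0 by auto
    then have lead: "smult (coeff a m) b - smult (coeff b m) a \<noteq> 0"
    proof (intro notI)
      assume c: "coeff a m \<noteq> 0 \<or> coeff b m \<noteq> 0" "smult (coeff a m) b - smult (coeff b m) a = 0"
      then have eq: "smult (coeff b m) a = smult (coeff a m) b" by simp
      have "coeff b m \<noteq> 0" using c(1) eq b0 by auto
      then have "a = smult (coeff a m / coeff b m) b"
        using eq by (metis divide_inverse left_inverse mult.commute smult_1_left smult_smult)
      then show False using ab(2) by (auto simp: nconst_def)
    qed
    have m0: "m > 0"
    proof (rule ccontr)
      assume "\<not> m > 0"
      then have "degree a = 0" "degree b = 0" by (auto simp: m_def size_of_def)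
      then obtain x y where "a = [:x:]" "b = [:y:]" using degree_eq_zeroE by metis
      then have "a = smult (x / y) b" using b0 by simp
      then show False using ab(2) by (auto simp: nconst_def)
    qed
    \<comment> \<open>Besides zeros of \<open>v\<close>, those \<open>t\<close> are excluded at
      which \<open>e t\<close> loses its coefficient of degree \<open>m\<close>. Thus
      \<open>e t\<close> has positive degree and \<open>s t\<close> really is smaller.\<close>
    define good where "good t \<longleftrightarrow> poly v t \<noteq> 0 \<and> poly (smult (coeff a m) b - smult (coeff b m) a) t \<noteq> 0" for t
    have good_ex: "\<exists>t. good t \<and> poly z t \<noteq> 0" if "z \<noteq> 0" for z
    proof -
      have "v * (smult (coeff a m) b - smult (coeff b m) a) * z \<noteq> 0" using that v0 lead by simp
      then obtain t where "poly (v * (smult (coeff a m) b - smult (coeff b m) a) * z) t \<noteq> 0"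
        using poly_all_0_iff_0 by blast
      then show ?thesis unfolding good_def by auto
    qed
    have e0: "e t \<noteq> 0" "degree (e t) \<ge> m" if "good t" for t
    proof -
      have "coeff (e t) m \<noteq> 0" using that by (simp add: good_def e_def mult.commute)
      then show "e t \<noteq> 0" "degree (e t) \<ge> m" by (auto intro: le_degree)
    qed
    have "e t dvd w t" for t
      using spec_dvd[OF skew_dvd[OF less.prems], of t] by (simp add: spec_skew w_def e_def)
    then obtain s where s: "\<And>t. w t = e t * s t" unfolding dvd_def by metis
    obtain t0 where t0: "good t0" using good_ex[of 1] by auto
    \<comment> \<open>The condition says that \<open>u / v\<close> takes different values at
      \<open>t0\<close> and \<open>t1\<close>, as the Moebius transformation requires.\<close>
    obtain t1 where t1: "good t1" "poly (w t0) t1 \<noteq> 0" using good_ex[of "w t0"] w0 t0 by (auto simp: good_def)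
    define c0 where "c0 = poly u t0 / poly v t0"
    define c1 where "c1 = poly u t1 / poly v t1"
    have vt: "poly v t0 \<noteq> 0" "poly v t1 \<noteq> 0" using t0 t1 by (auto simp: good_def)
    have c01: "c0 \<noteq> c1" using t1(2) vt by (auto simp: c0_def c1_def w_def field_simps)
    have s0: "s t \<noteq> 0" if "good t" for t using s[of t] w0[of t] that by (auto simp: good_def)
    have sdeg: "degree (s t) < size_of u v" if "good t" for t
    proof -
      have "degree (w t) \<le> size_of u v"
        unfolding w_def by (intro degree_diff_le order.trans[OF degree_smult_le]) (auto simp: size_of_def)
      moreover have "degree (w t) = degree (e t) + degree (s t)"
        using s[of t] s0[OF that] e0[OF that] by (simp add: degree_mult_eq)
      ultimately show ?thesis using e0(2)[OF that] m0 by linarith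
    qed
    have quot: "to_fract (smult (poly v' t) u' - smult (poly u' t) v') / to_fract v'
        = cfract (poly v' t) * (to_fract u' / to_fract v') - cfract (poly u' t)" if "v' \<noteq> 0" for u' v' t
    proof -
      have "to_fract (smult (poly v' t) u' - smult (poly u' t) v')
          = cfract (poly v' t) * to_fract u' - cfract (poly u' t) * to_fract v'"
        by (simp flip: to_fract_mult to_fract_diff)
      then show ?thesis using that by (simp add: diff_divide_distrib)
    qed
    have wK: "to_fract (w t) / to_fract v \<in> K" for t
      unfolding w_def quot[OF v0] using less.prems by (intro diff mult const) (simp add: rep_def)
    have eK: "to_fract (e t) / to_fract b \<in> K" for t
      unfolding e_def quot[OF b0] using ab(1) by (intro diff mult const) (simp add: rep_def)
    have "to_fract (s t0) / to_fract (s t1)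
        = (to_fract (w t0) / to_fract v) / (to_fract (w t1) / to_fract v)
          * ((to_fract (e t1) / to_fract b) / (to_fract (e t0) / to_fract b))"
      using s e0(1)[OF t0] e0(1)[OF t1(1)] s0[OF t1(1)] b0 v0 by (simp add: field_simps)
    also have "\<dots> \<in> K" by (intro mult divide wK eK)
    finally have "rep (s t0) (s t1)" unfolding rep_def using s0[OF t1(1)] by blast
    moreover have "size_of (s t0) (s t1) < size_of u v"
      using sdeg[OF t0] sdeg[OF t1(1)] by (simp add: size_of_def)
    ultimately have g1: "gen_by (to_fract (s t0) / to_fract (s t1))" using less.hyps by blast
    have e_alt: "e t = smult (- poly a t) b - smult (- poly b t) a" for t by (simp add: e_def)
    have "gen_by (to_fract (e t0) / to_fract (e t1))"
      using gen_by_affine_quotient[of "- poly a t1" "- poly b t1" "poly b t0" "poly a t0"] e0(1)[OF t1(1)]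
      by (simp add: e_alt[of t1]) (simp add: e_def)
    from gen_by_mult[OF this g1] have "gen_by (to_fract (w t0) / to_fract (w t1))"
      by (simp add: s)
    moreover have wc: "to_fract (w t) = cfract (poly v t) * to_fract v * (to_fract u / to_fract v - cfract (poly u t / poly v t))"
      if "poly v t \<noteq> 0" for t
    proof -
      have "cfract (poly v t) * cfract (poly u t / poly v t) = cfract (poly u t)"
        using that by (simp flip: to_fract_mult)
      moreover have "to_fract (w t) = cfract (poly v t) * to_fract u - cfract (poly u t) * to_fract v"
        by (simp add: w_def flip: to_fract_mult to_fract_diff)
      ultimately show ?thesis using v0 by (simp add: algebra_simps)
    qed
    ultimately have g2: "gen_by (cfract (poly v t0) / cfract (poly v t1) *
        ((to_fract u / to_fract v - cfract c0) / (to_fract u / to_fract v - cfract c1)))"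
      using v0 vt by (simp add: c0_def c1_def)
    have c1: "cfract 1 = 1" by (simp flip: one_pCons)
    have "gen_by (cfract (poly v t1 / poly v t0))"
      unfolding gen_by_def
      by (intro exI[of _ "[:poly v t1 / poly v t0:]"] exI[of _ "[:1:]"]) (simp add: c1)
    moreover have "cfract (poly v t1 / poly v t0) * cfract (poly v t0) = cfract (poly v t1)"
      using vt by (simp flip: to_fract_mult)
    then have "cfract (poly v t1 / poly v t0) = cfract (poly v t1) / cfract (poly v t0)"
      using vt by (simp add: eq_divide_eq)
    ultimately have "gen_by (cfract (poly v t1) / cfract (poly v t0) * (cfract (poly v t0) / cfract (poly v t1) *
        ((to_fract u / to_fract v - cfract c0) / (to_fract u / to_fract v - cfract c1))))"
      using gen_by_mult[OF _ g2] by metis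
    then have "gen_by ((to_fract u / to_fract v - cfract c0) / (to_fract u / to_fract v - cfract c1))"
      using vt by simp
    then show ?thesis using gen_by_if_moebius c01 nconst_iff[OF v0, of u] True by blast
  qed
qed

end

theorem lueroth:
  obtains a b where "b \<noteq> 0" "to_fract a / to_fract b \<in> K"
    "\<And>q. q \<in> K \<Longrightarrow> \<exists>N D. poly (map_poly cfract D) (to_fract a / to_fract b) \<noteq> 0 \<and>
      q * poly (map_poly cfract D) (to_fract a / to_fract b) = poly (map_poly cfract N) (to_fract a / to_fract b)"
proof -
  obtain a b where ab: "rep a b" "nconst a b"
    "\<And>u v. rep u v \<Longrightarrow> nconst u v \<Longrightarrow> size_of a b \<le> size_of u v"
    using ex_minimal by blast
  show ?thesis
  proof (rule that[of b a])
    show "b \<noteq> 0" "to_fract a / to_fract b \<in> K" using ab(1) by (auto simp: rep_def)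
  next
    fix q assume "q \<in> K"
    then obtain u v where "rep u v" "q = to_fract u / to_fract v" using ex_rep by blast
    then show "\<exists>N D. poly (map_poly cfract D) (to_fract a / to_fract b) \<noteq> 0 \<and>
      q * poly (map_poly cfract D) (to_fract a / to_fract b) = poly (map_poly cfract N) (to_fract a / to_fract b)"
      using rep_gen_by[OF ab] by (simp add: gen_by_def[OF ab] at_gen_def[OF ab])
  qed
qed

end

section \<open>Krull dimension and directional derivatives\<close>

lemma ev_cong: "p \<in> polynomials n \<Longrightarrow> (\<And>i. i < n \<Longrightarrow> x i = y i) \<Longrightarrow> ev x p = ev y p"
  unfolding ev_def by (rule subst_cong)

definition param :: "nat \<Rightarrow> (nat \<Rightarrow> cpoly) \<Rightarrow> (nat \<Rightarrow> complex) \<Rightarrow> complex vec" where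
  "param m F y = vec m (\<lambda>j. ev y (F j))"

lemma param_carrier [simp]: "param m F y \<in> carrier_vec m"
  by (simp add: param_def)

lemma poly_eval_param: "P \<in> polynomials m \<Longrightarrow> poly_eval (param m F y) P = ev y (subst Const F P)"
  unfolding poly_eval_eq_ev ev_subst_Const by (rule ev_cong) (auto simp: param_def)

lemma closedin_zero_locus: "S \<subseteq> polynomials m \<Longrightarrow> closedin (zariski m) (zero_locus m S)"
  by (auto simp: closedin_zariski)

lemma closure_param_subset_zero_locus:
  assumes "P \<in> polynomials m" "subst Const F P = 0"
  shows "zariski m closure_of range (param m F) \<subseteq> zero_locus m {P}"
  using assms by (intro closure_of_minimal closedin_zero_locus) (auto simp: zero_locus_def poly_eval_param)

lemma range_param_subset_closure: "range (param m F) \<subseteq> zariski m closure_of range (param m F)"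
  by (intro closure_of_subset) auto

text \<open>A closed set missing part of the image yields a polynomial that pulls back to a nonzero
  one. For two such sets the product of the pullbacks is nonzero, so together they cannot cover the
  image.\<close>

lemma irreducible_closed_param:
  assumes C: "closedin (zariski m) C" "range (param m F) \<subseteq> C"
  shows "irreducible_closed (subtopology (zariski m) C) (zariski m closure_of range (param m F))"
    (is "irreducible_closed ?Y ?Z")
  unfolding irreducible_closed_def
proof (intro conjI allI impI)
  have "?Z \<subseteq> C" by (rule closure_of_minimal[OF C(2,1)])
  then show "closedin ?Y ?Z" by (simp add: closedin_closed_subtopology C(1))
  show "?Z \<noteq> {}" using range_param_subset_closure[of m F] by auto
  fix A B assume AB: "closedin ?Y A \<and> closedin ?Y B \<and> ?Z = A \<union> B"
  then have AB': "closedin (zariski m) A" "closedin (zariski m) B" "?Z = A \<union> B"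
    by (auto simp: closedin_closed_subtopology C(1))
  have sep: "\<exists>P. subst Const F P \<noteq> 0 \<and> (\<forall>y. param m F y \<in> D \<longrightarrow> ev y (subst Const F P) = 0)"
    if D: "closedin (zariski m) D" "\<not> ?Z \<subseteq> D" for D
  proof -
    obtain S where S: "S \<subseteq> polynomials m" "D = zero_locus m S" using D(1) by (auto simp: closedin_zariski)
    have "\<not> range (param m F) \<subseteq> D" using D closure_of_minimal by blast
    then obtain y P where P: "P \<in> S" "poly_eval (param m F y) P \<noteq> 0"
      using S by (auto simp: zero_locus_def)
    have e: "poly_eval (param m F z) P = ev z (subst Const F P)" for z
      using P S by (intro poly_eval_param) auto
    show ?thesis
    proof (intro exI conjI allI impI)
      show "subst Const F P \<noteq> 0" using P(2) e[of y] by auto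
      show "ev z (subst Const F P) = 0" if "param m F z \<in> D" for z
        using that P(1) S(2) e[of z] by (auto simp: zero_locus_def)
    qed
  qed
  show "?Z = A \<or> ?Z = B"
  proof (rule ccontr)
    assume "\<not> ?thesis"
    then have "\<not> ?Z \<subseteq> A" "\<not> ?Z \<subseteq> B" using AB'(3) by auto
    then obtain P Q where P: "subst Const F P \<noteq> 0" "\<And>y. param m F y \<in> A \<Longrightarrow> ev y (subst Const F P) = 0"
      and Q: "subst Const F Q \<noteq> 0" "\<And>y. param m F y \<in> B \<Longrightarrow> ev y (subst Const F Q) = 0"
      using sep AB' by meson
    have "ev y (subst Const F P * subst Const F Q) = ev y 0" for y
      using range_param_subset_closure[of m F] AB'(3) P(2)[of y] Q(2)[of y] by (auto simp: ev.hom_mult)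
    then have "subst Const F P * subst Const F Q = 0" by (rule cpoly_eqI)
    then show False using P Q by simp
  qed
qed

text \<open>A polynomial vanishing on one image but not on the next separates their
  closures.\<close>

lemma krull_dim_ge_3:
  fixes F :: "nat \<Rightarrow> nat \<Rightarrow> cpoly"
  assumes C: "closedin (zariski m) C" "\<And>k. k \<le> 3 \<Longrightarrow> range (param m (F k)) \<subseteq> C"
    and mono: "\<And>k. k < 3 \<Longrightarrow> range (param m (F k)) \<subseteq> range (param m (F (Suc k)))"
    and sep: "\<And>k. k < 3 \<Longrightarrow> \<exists>P\<in>polynomials m. subst Const (F k) P = 0 \<and> subst Const (F (Suc k)) P \<noteq> 0"
  shows "krull_dim (subtopology (zariski m) C) \<ge> 3"
proof -
  define Z where "Z k = zariski m closure_of range (param m (F k))" for k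
  have "irreducible_closed (subtopology (zariski m) C) (Z i)" if "i \<le> 3" for i
    unfolding Z_def by (rule irreducible_closed_param[OF C(1) C(2)[OF that]])
  moreover have "Z i \<subset> Z (Suc i)" if i: "i < 3" for i
  proof
    show "Z i \<subseteq> Z (Suc i)" unfolding Z_def by (rule closure_of_mono[OF mono[OF i]])
    obtain P where P: "P \<in> polynomials m" "subst Const (F i) P = 0" "subst Const (F (Suc i)) P \<noteq> 0"
      using sep[OF i] by blast
    obtain y where "ev y (subst Const (F (Suc i)) P) \<noteq> 0" using P(3) cpoly_eqI[of _ 0] by fastforce
    then have "param m (F (Suc i)) y \<notin> zero_locus m {P}" by (simp add: zero_locus_def poly_eval_param P(1))
    then have "\<not> Z (Suc i) \<subseteq> Z i"
      using closure_param_subset_zero_locus[OF P(1,2)] range_param_subset_closure[of m "F (Suc i)"]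
      by (auto simp: Z_def)
    then show "Z i \<noteq> Z (Suc i)" by blast
  qed
  ultimately have "enat 3 \<le> krull_dim (subtopology (zariski m) C)"
    unfolding krull_dim_def by (intro Sup_upper) blast
  then show ?thesis by (simp add: numeral_eq_enat)
qed

lemma dd_sum_direction:
  "dd f x (\<lambda>i. \<Sum>b<k. \<xi> b * v b i) = (\<Sum>b<(k::nat). \<xi> b * dd f x (v b))"
proof (induction k)
  case 0
  then show ?case using dd_linear[of f x 0 "\<lambda>_. 0" 0 "\<lambda>_. 0"] by simp
next
  case (Suc k)
  then show ?case using dd_linear[of f x 1 "\<lambda>i. \<Sum>b<k. \<xi> b * v b i" "\<xi> k" "v k"] by simp
qed

text \<open>At a point with nonzero minor, \<phi> is restricted to the affine subspaces spanned
  there by the first \<open>l\<close> dual vectors, \<open>l\<close> from 0 to 3. The closures of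
  the images form a strict chain: \<open>l + 1\<close> coordinates are dependent as polynomials in
  \<open>l\<close> parameters, but have independent differentials once there are
  \<open>l + 1\<close> parameters.\<close>

theorem jac_eq_0_if_dim_le_2:
  assumes p: "\<And>j. j < m \<Longrightarrow> p j \<in> polynomials n"
    and \<phi>: "\<And>v. v \<in> carrier_vec n \<Longrightarrow> \<phi> v = vec m (\<lambda>j. poly_eval v (p j))"
    and dim: "covariant_dim n m \<phi> \<le> 2" and ijk: "i < m" "j < m" "k < m"
  shows "jac (p i) (p j) (p k) x u v w = 0"
proof (rule ccontr)
  assume "jac (p i) (p j) (p k) x u v w \<noteq> 0"
  then obtain v' :: "nat \<Rightarrow> nat \<Rightarrow> complex" where v':
    "dd (p i) x (v' 0) = 1" "dd (p i) x (v' 1) = 0" "dd (p i) x (v' 2) = 0"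
    "dd (p j) x (v' 0) = 0" "dd (p j) x (v' 1) = 1" "dd (p j) x (v' 2) = 0"
    "dd (p k) x (v' 0) = 0" "dd (p k) x (v' 1) = 0" "dd (p k) x (v' 2) = 1"
    by (rule jac_dual_basis)
  define idx :: "nat \<Rightarrow> nat" where "idx = (\<lambda>_. k)(0 := i, 1 := j)"
  have idx: "idx a < m" for a using ijk by (simp add: idx_def)
  have dual: "dd (p (idx a)) x (v' b) = (if a = b then 1 else 0)" if "a < 3" "b < 3" for a b
  proof -
    have "a = 0 \<or> a = 1 \<or> a = 2" "b = 0 \<or> b = 1 \<or> b = 2" using that by auto
    then show ?thesis using v' by (elim disjE) (simp_all add: idx_def)
  qed
  define arg where "arg k i = Const (x i) + (\<Sum>b<k. Var b * Const (v' b i))" for k i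
  define F where "F k j = subst Const (arg k) (p j)" for k j
  have arg: "arg l i \<in> polynomials l" for l i
    unfolding arg_def by (intro polynomials_add polynomials_sum polynomials_mult polynomials_Var) auto
  have ev_F: "ev y (F l j) = ev (\<lambda>i. x i + (\<Sum>b<l. y b * v' b i)) (p j)" for y l j
    by (simp add: F_def ev_subst_Const arg_def ev.hom_add ev.hom_sum ev.hom_mult)
  have F_in: "F l j \<in> polynomials l" if "j < m" for l j
    unfolding F_def by (rule subst_in_polynomials[OF p[OF that] arg])
  define C where "C = zariski m closure_of (\<phi> ` carrier_vec n)"
  have sub: "\<phi> ` carrier_vec n \<subseteq> C"
    unfolding C_def by (intro closure_of_subset) (auto simp: \<phi>)
  have "krull_dim (subtopology (zariski m) C) \<ge> 3"
  proof (rule krull_dim_ge_3[of _ _ F])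
    show "closedin (zariski m) C" by (simp add: C_def)
    show "range (param m (F l)) \<subseteq> C" for l
    proof
      fix z assume "z \<in> range (param m (F l))"
      then obtain y where y: "z = param m (F l) y" by blast
      let ?u = "vec n (\<lambda>i. x i + (\<Sum>b<l. y b * v' b i))"
      have "z = \<phi> ?u"
        unfolding y by (subst \<phi>) (auto simp: param_def ev_F poly_eval_eq_ev intro!: eq_vecI ev_cong p)
      then show "z \<in> C" using sub by auto
    qed
    show "range (param m (F l)) \<subseteq> range (param m (F (Suc l)))" for l
    proof
      fix z assume "z \<in> range (param m (F l))"
      then obtain y where y: "z = param m (F l) y" by blast
      have "z = param m (F (Suc l)) (y(l := 0))"
        unfolding y param_def ev_F by (intro arg_cong[of _ _ "vec m"] ext arg_cong2[of _ _ _ _ ev]) auto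
      then show "z \<in> range (param m (F (Suc l)))" by blast
    qed
    fix l :: nat assume l: "l < 3"
    obtain P0 where P0: "P0 \<in> polynomials (Suc l)" "P0 \<noteq> 0" "subst Const (\<lambda>a. F l (idx a)) P0 = 0"
      using algebraic_dependence[of l "\<lambda>a. F l (idx a)"] F_in idx by blast
    define P where "P = subst Const (\<lambda>a. Var (idx a)) P0"
    have P_in: "P \<in> polynomials m"
      unfolding P_def by (rule subst_in_polynomials[OF P0(1)]) (auto intro: polynomials_Var idx)
    have comp: "subst Const H P = subst Const (\<lambda>a. H (idx a)) P0" for H
      by (rule cpoly_eqI) (simp add: P_def ev_subst_Const)
    have "subst Const (F (Suc l)) P \<noteq> 0"
    proof
      assume z: "subst Const (F (Suc l)) P = 0"
      obtain \<xi> where \<xi>: "\<And>\<gamma>. (\<And>a. a < Suc l \<Longrightarrow> coeff (\<gamma> a) 0 = ev x (p (idx a)) \<and> coeff (\<gamma> a) 1 = \<xi> a) \<Longrightarrow>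
          subst (\<lambda>c. [:c:]) \<gamma> P0 \<noteq> 0"
        by (rule curve_nonvanishing[OF P0(1,2), of "\<lambda>a. ev x (p (idx a))"]) blast
      \<comment> \<open>In this direction the chosen coordinates have derivatives \<xi>, so the
        curve \<gamma> has a tangent for which \<open>P0\<close> cannot vanish along it.\<close>
      define d where "d i = (\<Sum>b<Suc l. \<xi> b * v' b i)" for i
      define \<gamma> where "\<gamma> a = line x d (p (idx a))" for a
      have "coeff (\<gamma> a) 1 = \<xi> a" if "a < Suc l" for a
      proof -
        have "coeff (\<gamma> a) 1 = (\<Sum>b<Suc l. \<xi> b * dd (p (idx a)) x (v' b))"
          unfolding \<gamma>_def d_def dd_def[symmetric] by (rule dd_sum_direction)
        also have "\<dots> = (\<Sum>b<Suc l. if b = a then \<xi> b else 0)"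
          using that l by (intro sum.cong refl) (auto simp: dual)
        finally show ?thesis using that by simp
      qed
      then have "subst (\<lambda>c. [:c:]) \<gamma> P0 \<noteq> 0" by (intro \<xi>) (auto simp: \<gamma>_def coeff_line_0)
      moreover have "poly (subst (\<lambda>c. [:c:]) \<gamma> P0) t = 0" for t
      proof -
        have "0 = ev (\<lambda>b. t * \<xi> b) (subst Const (\<lambda>a. F (Suc l) (idx a)) P0)"
          using z comp by simp
        also have "\<dots> = poly (subst (\<lambda>c. [:c:]) \<gamma> P0) t"
          by (simp add: ev_subst_Const poly_subst ev_F \<gamma>_def poly_line d_def sum_distrib_left algebra_simps)
        finally show ?thesis by simp
      qed
      ultimately show False using poly_all_0_iff_0 by blast
    qed
    then show "\<exists>P\<in>polynomials m. subst Const (F l) P = 0 \<and> subst Const (F (Suc l)) P \<noteq> 0"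
      using P_in P0(3) comp by metis
  qed
  then have "(3::enat) \<le> 2" using dim unfolding covariant_dim_def C_def by (rule order_trans)
  then show False by (simp add: numeral_eq_enat)
qed

section \<open>Operators, actions and gradings\<close>

type_synonym cfun = "nat \<Rightarrow> complex"

definition polyop :: "(cfun \<Rightarrow> cfun) \<Rightarrow> bool" where
  "polyop M \<longleftrightarrow> (\<exists>y. \<forall>i x. ev x (y i) = M x i)"

definition linop :: "(cfun \<Rightarrow> cfun) \<Rightarrow> bool" where
  "linop M \<longleftrightarrow> (\<forall>a b x y. M (\<lambda>i. a * x i + b * y i) = (\<lambda>i. a * M x i + b * M y i))"

text \<open>Coordinate polynomials are determined by their values, by \<open>cpoly_eqI\<close>, so
  the choice is no ambiguity; for a \<open>polyop\<close> the result is characterised by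
  \<open>ev_pull\<close>.\<close>

definition pull :: "(cfun \<Rightarrow> cfun) \<Rightarrow> cpoly \<Rightarrow> cpoly" where
  "pull M = subst Const (SOME y. \<forall>i x. ev x (y i) = M x i)"

interpretation pull: comm_ring_hom "pull M"
  unfolding pull_def by (rule subst_hom[OF Const_hom])

lemma pull_Const [simp]: "pull M (Const c) = Const c"
  by (simp add: pull_def subst_Const Const_hom)

lemma ev_pull: "polyop M \<Longrightarrow> ev x (pull M f) = ev (M x) f"
proof -
  assume "polyop M"
  then have "\<forall>i x. ev x ((SOME y. \<forall>i x. ev x (y i) = M x i) i) = M x i"
    unfolding polyop_def by (rule someI_ex)
  then show ?thesis by (simp add: pull_def ev_subst_Const)
qed

lemma polyop_id: "polyop (\<lambda>x. x)"
  unfolding polyop_def by (intro exI[of _ Var]) simp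

lemma polyop_comp: "polyop M \<Longrightarrow> polyop N \<Longrightarrow> polyop (\<lambda>x. M (N x))"
proof -
  assume "polyop M" and N: "polyop N"
  then obtain y where "\<forall>i x. ev x (y i) = M x i" by (auto simp: polyop_def)
  then show ?thesis unfolding polyop_def using ev_pull[OF N] by (intro exI[of _ "\<lambda>i. pull N (y i)"]) simp
qed

lemma polyop_comb: "polyop M \<Longrightarrow> polyop N \<Longrightarrow> polyop (\<lambda>x i. a * M x i + b * N x i)"
proof -
  assume "polyop M" "polyop N"
  then obtain y z where "\<forall>i x. ev x (y i) = M x i" "\<forall>i x. ev x (z i) = N x i" by (auto simp: polyop_def)
  then show ?thesis unfolding polyop_def
    by (intro exI[of _ "\<lambda>i. Const a * y i + Const b * z i"]) (simp add: ev.hom_add ev.hom_mult)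
qed

lemma linop_comp: "linop M \<Longrightarrow> linop N \<Longrightarrow> linop (\<lambda>x. M (N x))"
  by (simp add: linop_def)

lemma linop_comb: "linop M \<Longrightarrow> linop N \<Longrightarrow> linop (\<lambda>x i. a * M x i + b * N x i)"
  by (simp add: linop_def algebra_simps)

lemma linopD: "linop M \<Longrightarrow> M (\<lambda>i. a * x i + b * y i) = (\<lambda>i. a * M x i + b * M y i)"
  by (simp add: linop_def)

lemma line_pull:
  assumes "polyop M" "linop M"
  shows "line x v (pull M f) = line (M x) (M v) f"
proof -
  have "M (\<lambda>i. x i + t * v i) = (\<lambda>i. M x i + t * M v i)" for t
    using linopD[OF assms(2), of 1 x t v] by simp
  then have "poly (line x v (pull M f)) = poly (line (M x) (M v) f)"
    by (intro ext) (simp add: poly_line ev_pull[OF assms(1)])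
  then show ?thesis by (simp add: poly_eq_poly_eq_iff)
qed

lemma dd_pull: "polyop M \<Longrightarrow> linop M \<Longrightarrow> dd (pull M f) x v = dd f (M x) (M v)"
  by (simp add: dd_def line_pull)

lemma jac_pull: "polyop M \<Longrightarrow> linop M \<Longrightarrow>
    jac (pull M f) (pull M g) (pull M h) x u v w = jac f g h (M x) (M u) (M v) (M w)"
  by (simp add: jac_def dd_pull)

text \<open>The one-parameter family of operators acting as \<open>c\<close> on the image of an idempotent \<open>\<pi>\<close> and
  trivially on its kernel.\<close>

definition scaling :: "(cfun \<Rightarrow> cfun) \<Rightarrow> complex \<Rightarrow> cfun \<Rightarrow> cfun" where
  "scaling \<pi> c x = (\<lambda>i. 1 * x i + (c - 1) * \<pi> x i)"

lemma polyop_scaling: "polyop \<pi> \<Longrightarrow> polyop (scaling \<pi> c)"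
  unfolding scaling_def by (rule polyop_comb[OF polyop_id])

lemma linop_id: "linop (\<lambda>x. x)" by (simp add: linop_def)

lemma linop_scaling: "linop \<pi> \<Longrightarrow> linop (scaling \<pi> c)"
  unfolding scaling_def by (rule linop_comb[OF linop_id])

lemma scaling_commute: "linop M \<Longrightarrow> (\<And>x. M (\<pi> x) = \<pi> (M x)) \<Longrightarrow> M (scaling \<pi> c x) = scaling \<pi> c (M x)"
  unfolding scaling_def by (subst linopD) simp_all

lemma scaling_scaling:
  assumes "linop \<pi>" "\<And>x. \<pi> (\<pi> x) = \<pi> x"
  shows "scaling \<pi> c (scaling \<pi> d x) = scaling \<pi> (c * d) x"
proof -
  have "\<pi> (scaling \<pi> d x) = (\<lambda>i. 1 * \<pi> x i + (d - 1) * \<pi> (\<pi> x) i)"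
    unfolding scaling_def by (rule linopD[OF assms(1)])
  then show ?thesis by (simp add: scaling_def assms(2) algebra_simps)
qed

text \<open>\<open>scaling\<close> with the factor \<open>c\<close> replaced by an indeterminate.
  The coefficient of degree \<open>k\<close> is the component of degree \<open>k\<close> in the
  grading by \<pi>.\<close>

definition graded :: "(cfun \<Rightarrow> cfun) \<Rightarrow> cpoly \<Rightarrow> cpoly poly" where
  "graded \<pi> = subst (\<lambda>c. [:Const c:]) (\<lambda>i. [:Var i - pull \<pi> (Var i), pull \<pi> (Var i):])"

interpretation graded: comm_ring_hom "graded \<pi>"
  unfolding graded_def by (intro subst_hom Const_poly_hom)

lemma graded_Const [simp]: "graded \<pi> (Const c) = [:Const c:]"
  by (simp add: graded_def subst_Const Const_poly_hom)

lemma poly_graded: "polyop \<pi> \<Longrightarrow> poly (graded \<pi> f) (Const c) = pull (scaling \<pi> c) f"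
proof (rule cpoly_eqI)
  fix x assume p: "polyop \<pi>"
  have "ev x (poly (graded \<pi> f) (Const c)) = ev (scaling \<pi> c x) f"
    by (rule comm_ring_hom_eqI[OF comm_ring_hom_comp[OF comm_ring_hom_comp[OF ev.comm_ring_hom_axioms comm_ring_hom_poly] graded.comm_ring_hom_axioms]
          ev.comm_ring_hom_axioms])
      (simp_all add: graded_def subst_Const subst_Var Const_poly_hom ev.hom_add ev.hom_mult ev.hom_minus ev_pull[OF p] scaling_def algebra_simps)
  then show "ev x (poly (graded \<pi> f) (Const c)) = ev x (pull (scaling \<pi> c) f)"
    by (simp add: ev_pull polyop_scaling p)
qed

lemma poly_eqI_Const: "(\<And>c. poly P (Const c) = poly Q (Const c)) \<Longrightarrow> P = Q"
proof (rule ccontr)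
  assume eq: "\<And>c. poly P (Const c) = poly Q (Const c)" and "P \<noteq> Q"
  then have "finite {z. poly (P - Q) z = 0}" by (intro poly_roots_finite) simp
  moreover have "range Const \<subseteq> {z. poly (P - Q) z = 0}" using eq by auto
  ultimately have "finite (range Const)" by (rule rev_finite_subset)
  then have "finite (UNIV :: complex set)" by (rule finite_imageD) (simp add: inj_def)
  then show False by (simp add: infinite_UNIV_char_0)
qed

text \<open>Components are determined by the scalings with all constants, so an operator commuting
  with the scalings commutes with taking components.\<close>

lemma map_poly_graded:
  assumes "polyop \<pi>" "polyop M" "\<And>c x. M (scaling \<pi> c x) = scaling \<pi> c (M x)"
  shows "coeff (graded \<pi> (pull M f)) k = pull M (coeff (graded \<pi> f) k)"
proof -
  have map: "poly (map_poly (pull M) R) (Const c) = pull M (poly R (Const c))" for R c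
    by (induction R) (simp_all add: map_poly_pCons pull.hom_add pull.hom_mult)
  have "graded \<pi> (pull M f) = map_poly (pull M) (graded \<pi> f)"
  proof (rule poly_eqI_Const)
    fix c
    have "pull (scaling \<pi> c) (pull M f) = pull M (pull (scaling \<pi> c) f)"
      by (rule cpoly_eqI) (simp add: ev_pull assms polyop_scaling)
    then show "poly (graded \<pi> (pull M f)) (Const c) = poly (map_poly (pull M) (graded \<pi> f)) (Const c)"
      by (simp add: map poly_graded assms(1))
  qed
  then show ?thesis by (simp add: coeff_map_poly)
qed

definition homog :: "(cfun \<Rightarrow> cfun) \<Rightarrow> nat \<Rightarrow> cpoly \<Rightarrow> bool" where
  "homog \<pi> k f \<longleftrightarrow> graded \<pi> f = monom f k"

lemma homog_iff:
  assumes "polyop \<pi>"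
  shows "homog \<pi> k f \<longleftrightarrow> (\<forall>c. pull (scaling \<pi> c) f = Const (c ^ k) * f)"
proof
  show "homog \<pi> k f \<Longrightarrow> \<forall>c. pull (scaling \<pi> c) f = Const (c ^ k) * f"
    by (simp add: poly_graded[OF assms, symmetric] homog_def poly_monom Const.hom_power mult.commute)
  show "\<forall>c. pull (scaling \<pi> c) f = Const (c ^ k) * f \<Longrightarrow> homog \<pi> k f"
    unfolding homog_def
    by (rule poly_eqI_Const) (simp add: poly_graded[OF assms] poly_monom Const.hom_power mult.commute)
qed

lemma homog_0 [simp]: "homog \<pi> k 0" by (simp add: homog_def)

lemma homog_add: "homog \<pi> k f \<Longrightarrow> homog \<pi> k g \<Longrightarrow> homog \<pi> k (f + g)"
  by (simp add: homog_def graded.hom_add add_monom)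

lemma homog_mult: "homog \<pi> k f \<Longrightarrow> homog \<pi> l g \<Longrightarrow> homog \<pi> (k + l) (f * g)"
  by (simp add: homog_def graded.hom_mult mult_monom)

lemma homog_Const: "homog \<pi> 0 (Const c)"
  by (simp add: homog_def monom_0)

lemma homog_Const_mult: "homog \<pi> k f \<Longrightarrow> homog \<pi> k (Const c * f)"
  using homog_mult[OF homog_Const] by simp

text \<open>Since \<pi> is idempotent, scalings compose multiplicatively. Hence scaling by
  \<open>c\<close> multiplies the indeterminate by \<open>c\<close>, and the coefficient of degree
  \<open>k\<close> by its \<open>k\<close>-th power.\<close>

lemma homog_coeff_graded:
  assumes "polyop \<pi>" "linop \<pi>" "\<And>x. \<pi> (\<pi> x) = \<pi> x"
  shows "homog \<pi> k (coeff (graded \<pi> f) k)"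
  unfolding homog_iff[OF assms(1)]
proof
  fix c
  have "graded \<pi> (pull (scaling \<pi> c) f) = pcompose (graded \<pi> f) [:0, Const c:]"
  proof (rule poly_eqI_Const)
    fix d
    have "pull (scaling \<pi> d) (pull (scaling \<pi> c) f) = pull (scaling \<pi> (d * c)) f"
      by (rule cpoly_eqI) (simp add: ev_pull polyop_scaling assms scaling_scaling mult.commute)
    then show "poly (graded \<pi> (pull (scaling \<pi> c) f)) (Const d) = poly (pcompose (graded \<pi> f) [:0, Const c:]) (Const d)"
      by (simp add: poly_pcompose poly_graded[OF assms(1)] flip: Const.hom_mult)
  qed
  then have "coeff (graded \<pi> (pull (scaling \<pi> c) f)) k = Const c ^ k * coeff (graded \<pi> f) k"
    by (simp add: coeff_pcompose_linear)
  moreover have "scaling \<pi> c (scaling \<pi> d x) = scaling \<pi> d (scaling \<pi> c x)" for d x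
    by (simp add: scaling_scaling assms mult.commute)
  ultimately show "pull (scaling \<pi> c) (coeff (graded \<pi> f) k) = Const (c ^ k) * coeff (graded \<pi> f) k"
    using map_poly_graded[OF assms(1) polyop_scaling[OF assms(1)], of c f k] by (simp add: Const.hom_power)
qed

text \<open>Lets several commuting gradings be treated in turn without losing homogeneity already
  achieved.\<close>

lemma homog_coeff_graded_other:
  assumes "polyop \<pi>" "polyop \<pi>'" "linop \<pi>" "linop \<pi>'" "\<And>x. \<pi> (\<pi>' x) = \<pi>' (\<pi> x)" "homog \<pi>' j f"
  shows "homog \<pi>' j (coeff (graded \<pi> f) k)"
  unfolding homog_iff[OF assms(2)]
proof
  fix c
  have "scaling \<pi>' c (scaling \<pi> d x) = scaling \<pi> d (scaling \<pi>' c x)" for d x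
  proof (rule scaling_commute)
    show "linop (scaling \<pi>' c)" by (rule linop_scaling[OF assms(4)])
    show "scaling \<pi>' c (\<pi> x) = \<pi> (scaling \<pi>' c x)" for x
      by (rule scaling_commute[symmetric]) (simp_all add: assms)
  qed
  then have "pull (scaling \<pi>' c) (coeff (graded \<pi> f) k) = coeff (graded \<pi> (pull (scaling \<pi>' c) f)) k"
    using map_poly_graded[OF assms(1) polyop_scaling[OF assms(2)], of c f k] by simp
  also have "pull (scaling \<pi>' c) f = Const (c ^ j) * f" using assms(6) homog_iff[OF assms(2)] by blast
  also have "coeff (graded \<pi> (Const (c ^ j) * f)) k = Const (c ^ j) * coeff (graded \<pi> f) k"
    by (simp add: graded.hom_mult)
  finally show "pull (scaling \<pi>' c) (coeff (graded \<pi> f) k) = Const (c ^ j) * coeff (graded \<pi> f) k" .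
qed

text \<open>Euler's identity for the grading by \<pi>: moving from \<open>x\<close> by
  \<open>t * \<pi> x\<close> is scaling by \<open>1 + t\<close>, which multiplies the value by the
  \<open>k\<close>-th power.\<close>

lemma dd_homog:
  assumes "polyop \<pi>" "homog \<pi> k f"
  shows "dd f x (\<pi> x) = of_nat k * ev x f"
proof -
  have "poly (line x (\<pi> x) f) = poly (smult (ev x f) ([:1, 1:] ^ k))"
  proof
    fix t
    have "pull (scaling \<pi> (1 + t)) f = Const ((1 + t) ^ k) * f" using assms homog_iff by blast
    then have "ev (scaling \<pi> (1 + t) x) f = (1 + t) ^ k * ev x f"
      by (metis ev_pull polyop_scaling[OF assms(1)] ev.hom_mult ev_Const)
    then show "poly (line x (\<pi> x) f) t = poly (smult (ev x f) ([:1, 1:] ^ k)) t"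
      by (simp add: poly_line scaling_def poly_power mult.commute add.commute)
  qed
  then have "line x (\<pi> x) f = smult (ev x f) ([:1, 1:] ^ k)" by (simp add: poly_eq_poly_eq_iff)
  moreover have "coeff ([:1, 1:] ^ k :: complex poly) 1 = of_nat k \<and> coeff ([:1, 1:] ^ k :: complex poly) 0 = 1"
    by (induction k) (auto simp: coeff_mult)
  ultimately show ?thesis by (simp add: dd_def mult.commute)
qed

definition initial :: "(cfun \<Rightarrow> cfun) \<Rightarrow> nat \<Rightarrow> cpoly set \<Rightarrow> cpoly set" where
  "initial \<pi> k W = {coeff (graded \<pi> f) k | f. f \<in> W \<and> (\<forall>i<k. coeff (graded \<pi> f) i = 0)}"

section \<open>Finite group actions and degeneration to initial forms\<close>

lemma (in group) finite_imp_exponent: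
  assumes "finite (carrier G)"
  shows "\<exists>e::nat. e > 0 \<and> (\<forall>g\<in>carrier G. g [^] e = \<one>)"
proof -
  have "\<exists>n::nat. n > 0 \<and> g [^] n = \<one>" if g: "g \<in> carrier G" for g
  proof -
    have "range (\<lambda>n::nat. g [^] n) \<subseteq> carrier G" using g by auto
    then have "\<not> inj (\<lambda>n::nat. g [^] n)"
      using assms finite_imageD finite_subset infinite_UNIV_nat by blast
    then obtain i j :: nat where ij: "i < j" "g [^] i = g [^] j"
      unfolding inj_def by (metis linorder_neqE_nat)
    have "g [^] i \<otimes> g [^] (j - i) = g [^] i \<otimes> \<one>"
      using nat_pow_mult[OF g, of i "j - i"] ij g by (metis le_add_diff_inverse less_imp_le nat_pow_closed r_one)
    then have "g [^] (j - i) = \<one>" using g by (metis l_cancel_one nat_pow_closed r_one)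
    then show ?thesis using ij by (intro exI[of _ "j - i"]) simp
  qed
  then obtain n :: "'a \<Rightarrow> nat" where n: "\<And>g. g \<in> carrier G \<Longrightarrow> n g > 0 \<and> g [^] n g = \<one>" by metis
  have "g [^] (\<Prod>h\<in>carrier G. n h) = \<one>" if g: "g \<in> carrier G" for g
  proof -
    have "(\<Prod>h\<in>carrier G. n h) = n g * (\<Prod>h\<in>carrier G - {g}. n h)"
      using assms g by (rule prod.remove)
    then show ?thesis using n[OF g] g by (simp flip: nat_pow_pow)
  qed
  moreover have "(\<Prod>h\<in>carrier G. n h) > 0" using n by (intro prod_pos) auto
  ultimately show ?thesis by blast
qed

locale poly_action = group G for G (structure) +
  fixes L :: "'a \<Rightarrow> cfun \<Rightarrow> cfun"
  assumes fin: "finite (carrier G)"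
    and pol: "g \<in> carrier G \<Longrightarrow> polyop (L g)"
    and lin: "g \<in> carrier G \<Longrightarrow> linop (L g)"
    and L_mult: "g \<in> carrier G \<Longrightarrow> h \<in> carrier G \<Longrightarrow> L (g \<otimes> h) x = L g (L h x)"
    and L_one: "L \<one> x = x"
begin

abbreviation act :: "'a \<Rightarrow> cpoly \<Rightarrow> cpoly" where
  "act g \<equiv> pull (L g)"

text \<open>Pulling back along a left action on points reverses the order of the factors.\<close>

lemma act_act: "g \<in> carrier G \<Longrightarrow> h \<in> carrier G \<Longrightarrow> act g (act h f) = act (h \<otimes> g) f"
  by (rule cpoly_eqI) (simp add: ev_pull pol L_mult)

lemma act_one: "act \<one> f = f"
  by (rule cpoly_eqI) (simp add: ev_pull pol L_one)

lemma act_inv: "g \<in> carrier G \<Longrightarrow> act g (act (inv g) f) = f"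
  by (simp add: act_act act_one)

lemma act_inv': "g \<in> carrier G \<Longrightarrow> act (inv g) (act g f) = f"
  by (simp add: act_act act_one)

lemma act_eq_0_iff: "g \<in> carrier G \<Longrightarrow> act g f = 0 \<longleftrightarrow> f = 0"
  by (metis act_inv' pull.hom_zero)

lemma act_pow: "g \<in> carrier G \<Longrightarrow> (act g ^^ k) f = act (g [^] k) f"
  by (induction k arbitrary: f) (simp_all add: act_one act_act funpow_swap1)

text \<open>A set of spaces instead of a single one, because passing to initial forms breaks a space
  up by degree. Faithfulness and the rank condition are imposed on all members jointly.\<close>

definition family :: "cpoly set set \<Rightarrow> bool" where
  "family \<W> \<longleftrightarrow> finite \<W> \<and>
     (\<forall>W\<in>\<W>. cpoly.subspace W \<and> (\<exists>F. finite F \<and> W \<subseteq> cpoly.span F) \<and> (\<forall>g\<in>carrier G. \<forall>f\<in>W. act g f \<in> W)) \<and>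
     (\<forall>g\<in>carrier G. (\<forall>W\<in>\<W>. \<forall>f\<in>W. act g f = f) \<longrightarrow> g = \<one>) \<and>
     (\<forall>f\<in>\<Union>\<W>. \<forall>g\<in>\<Union>\<W>. \<forall>h\<in>\<Union>\<W>. \<forall>x u v w. jac f g h x u v w = 0)"

lemma
  assumes "family \<W>"
  shows family_finite: "finite \<W>"
    and family_subspace: "W \<in> \<W> \<Longrightarrow> cpoly.subspace W"
    and family_finite_dim: "W \<in> \<W> \<Longrightarrow> \<exists>F. finite F \<and> W \<subseteq> cpoly.span F"
    and family_stable: "W \<in> \<W> \<Longrightarrow> g \<in> carrier G \<Longrightarrow> f \<in> W \<Longrightarrow> act g f \<in> W"
    and family_faithful: "g \<in> carrier G \<Longrightarrow> (\<And>W f. W \<in> \<W> \<Longrightarrow> f \<in> W \<Longrightarrow> act g f = f) \<Longrightarrow> g = \<one>"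
    and family_jac: "p \<in> \<Union>\<W> \<Longrightarrow> q \<in> \<Union>\<W> \<Longrightarrow> r \<in> \<Union>\<W> \<Longrightarrow> jac p q r x u v w = 0"
  using assms unfolding family_def by ((elim conjE, simp; fail) | (elim conjE, blast))+

text \<open>The \<open>k\<close>-th power of \<open>g\<close> adds \<open>k\<close> times
  \<open>w\<close>; at the exponent of the group this must be 0, and the characteristic is
  0.\<close>

lemma unipotent_trivial:
  assumes "g \<in> carrier G" "act g f = f + w" "act g w = w"
  shows "w = 0"
proof -
  have "(act g ^^ k) f = f + Const (of_nat k) * w" for k
    by (induction k) (simp_all add: assms pull.hom_add pull.hom_mult Const.hom_add algebra_simps)
  moreover obtain e :: nat where e: "e > 0" "g [^] e = \<one>" using finite_imp_exponent[OF fin] assms(1) by blast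
  ultimately have "f = f + Const (of_nat e) * w" using act_pow[OF assms(1), of e f] act_one by metis
  then show ?thesis using e(1) by simp
qed

context
  fixes \<pi>
  assumes pi: "polyop \<pi>" "linop \<pi>" "\<And>x. \<pi> (\<pi> x) = \<pi> x" "\<And>g x. g \<in> carrier G \<Longrightarrow> L g (\<pi> x) = \<pi> (L g x)"
begin

lemma act_coeff_graded: "g \<in> carrier G \<Longrightarrow> coeff (graded \<pi> (act g f)) k = act g (coeff (graded \<pi> f) k)"
  by (intro map_poly_graded pi pol scaling_commute lin) auto

lemma subspace_initial: "cpoly.subspace W \<Longrightarrow> cpoly.subspace (initial \<pi> k W)"
  unfolding cpoly.subspace_def
proof (intro conjI ballI allI)
  assume W: "0 \<in> W \<and> (\<forall>x\<in>W. \<forall>y\<in>W. x + y \<in> W) \<and> (\<forall>c. \<forall>x\<in>W. Const c * x \<in> W)"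
  show "0 \<in> initial \<pi> k W" unfolding initial_def using W by (auto intro!: exI[of _ 0])
  fix x assume "x \<in> initial \<pi> k W"
  then obtain f where f: "f \<in> W" "x = coeff (graded \<pi> f) k" "\<forall>i<k. coeff (graded \<pi> f) i = 0"
    by (auto simp: initial_def)
  show "Const c * x \<in> initial \<pi> k W" for c
    unfolding initial_def using W f
    by (auto intro!: exI[of _ "Const c * f"] simp: graded.hom_mult)
  fix y assume "y \<in> initial \<pi> k W"
  then obtain g where g: "g \<in> W" "y = coeff (graded \<pi> g) k" "\<forall>i<k. coeff (graded \<pi> g) i = 0"
    by (auto simp: initial_def)
  show "x + y \<in> initial \<pi> k W"
    unfolding initial_def using W f g
    by (auto intro!: exI[of _ "f + g"] simp: graded.hom_add)
qed

lemma coeff_graded_span: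
  "f \<in> cpoly.span F \<Longrightarrow> coeff (graded \<pi> f) k \<in> cpoly.span ((\<lambda>f. coeff (graded \<pi> f) k) ` F)"
proof (induction rule: cpoly.span_induct_alt)
  case base then show ?case by (simp add: cpoly.span_zero)
next
  case (step c x y)
  have "Const c * coeff (graded \<pi> x) k \<in> cpoly.span ((\<lambda>f. coeff (graded \<pi> f) k) ` F)"
    using step by (intro cpoly.span_scale cpoly.span_base) auto
  from cpoly.span_add[OF this step(2)] show ?case by (simp add: graded.hom_add graded.hom_mult)
qed

lemma degree_graded_span:
  "f \<in> cpoly.span F \<Longrightarrow> (\<And>f. f \<in> F \<Longrightarrow> degree (graded \<pi> f) \<le> N) \<Longrightarrow> degree (graded \<pi> f) \<le> N"
proof (induction rule: cpoly.span_induct_alt)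
  case (step c x y)
  then show ?case
    by (auto simp: graded.hom_add graded.hom_mult intro!: degree_add_le order.trans[OF degree_smult_le])
qed simp

text \<open>The determinant of the scaled polynomials vanishes for all \<open>c\<close> and is a
  power of \<open>c\<close> times a polynomial in \<open>c\<close>, whose value at 0 is the
  determinant of the initial parts.\<close>

lemma jac_initial:
  fixes F :: "nat \<Rightarrow> cpoly"
  assumes F: "\<And>i. i < 3 \<Longrightarrow> degree (graded \<pi> (F i)) \<le> N" "\<And>i l. i < 3 \<Longrightarrow> l < d i \<Longrightarrow> coeff (graded \<pi> (F i)) l = 0"
    and jac: "\<And>x u v w. jac (F 0) (F 1) (F 2) x u v w = 0"
  shows "jac (coeff (graded \<pi> (F 0)) (d 0)) (coeff (graded \<pi> (F 1)) (d 1)) (coeff (graded \<pi> (F 2)) (d 2)) x u v w = 0"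
proof -
  define R where "R i v = (\<Sum>l\<in>{d i..max (d i) N}. monom (dd (coeff (graded \<pi> (F i)) l) x v) (l - d i))" for i :: nat and v
  have R0: "poly (R i v) 0 = dd (coeff (graded \<pi> (F i)) (d i)) x v" for i v
  proof -
    have "poly (R i v) 0 = (\<Sum>l\<in>{d i..max (d i) N}. if l = d i then dd (coeff (graded \<pi> (F i)) l) x v else 0)"
      unfolding R_def poly_sum by (intro sum.cong refl) (auto simp: poly_monom)
    then show ?thesis by simp
  qed
  have R: "dd (pull (scaling \<pi> c) (F i)) x v = c ^ d i * poly (R i v) c" if i: "i < 3" for i v c
  proof -
    have "dd (pull (scaling \<pi> c) (F i)) x v = (\<Sum>l\<le>degree (graded \<pi> (F i)). dd (coeff (graded \<pi> (F i)) l) x v * c ^ l)"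
      by (simp add: poly_graded[OF pi(1), symmetric] poly_altdef dd_sum dd_mult flip: Const.hom_power)
    also have "\<dots> = (\<Sum>l\<in>{d i..max (d i) N}. dd (coeff (graded \<pi> (F i)) l) x v * c ^ l)"
      using F(1)[OF i] by (intro sum.mono_neutral_cong) (auto simp: F(2)[OF i] coeff_eq_0 not_le)
    also have "\<dots> = c ^ d i * poly (R i v) c"
      unfolding R_def poly_sum sum_distrib_left
      by (intro sum.cong refl) (auto simp: poly_monom power_add[symmetric] algebra_simps)
    finally show ?thesis .
  qed
  define J where "J = R 0 u * (R 1 v * R 2 w - R 1 w * R 2 v) - R 0 v * (R 1 u * R 2 w - R 1 w * R 2 u)
      + R 0 w * (R 1 u * R 2 v - R 1 v * R 2 u)"
  have "poly J c = 0" if c: "c \<noteq> 0" for c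
  proof -
    have "0 = jac (pull (scaling \<pi> c) (F 0)) (pull (scaling \<pi> c) (F 1)) (pull (scaling \<pi> c) (F 2)) x u v w"
      by (simp add: jac_pull polyop_scaling linop_scaling pi jac jac[unfolded One_nat_def])
    also have "\<dots> = c ^ d 0 * c ^ d 1 * c ^ d 2 * poly J c"
      unfolding jac_def J_def by (simp add: R algebra_simps)
    finally show ?thesis using c by simp
  qed
  then have "poly J 0 = 0" using poly_eq_0_if[of J] by simp
  then show ?thesis by (simp add: J_def jac_def R0)
qed

text \<open>Faithfulness is the delicate property. If \<open>g\<close> fixes all initial forms,
  taking \<open>act g w - w\<close> raises the order. Among the elements moved by \<open>g\<close>,
  one whose difference has the largest order therefore has a fixed difference, and
  \<open>unipotent_trivial\<close> rules it out.\<close>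

lemma family_initial:
  assumes fam: "family \<W>"
  obtains N where "family ((\<lambda>(W, k). initial \<pi> k W) ` (\<W> \<times> {..N}))"
proof -
  note sub = family_subspace[OF fam] and ex = family_finite_dim[OF fam] and st = family_stable[OF fam]
    and fa = family_faithful[OF fam] and ja = family_jac[OF fam] and finW = family_finite[OF fam]
  have "\<exists>F. \<forall>W\<in>\<W>. finite (F W) \<and> W \<subseteq> cpoly.span (F W)"
    by (rule bchoice) (use ex in blast)
  then obtain F where F: "\<And>W. W \<in> \<W> \<Longrightarrow> finite (F W) \<and> W \<subseteq> cpoly.span (F W)" by blast
  define N where "N = Max (insert 0 ((\<lambda>f. degree (graded \<pi> f)) ` (\<Union>W\<in>\<W>. F W)))"
  have N: "degree (graded \<pi> f) \<le> N" if "W \<in> \<W>" "f \<in> W" for W f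
  proof (rule degree_graded_span)
    show "f \<in> cpoly.span (F W)" using F that by blast
    show "degree (graded \<pi> f) \<le> N" if "f \<in> F W" for f
      unfolding N_def using that finW F \<open>W \<in> \<W>\<close> by (intro Max_ge) auto
  qed
  let ?V = "(\<lambda>(W, k). initial \<pi> k W) ` (\<W> \<times> {..N})"
  have "family ?V"
    unfolding family_def
  proof (intro conjI ballI allI impI)
    show "finite ?V" using finW by auto
  next
    fix V assume "V \<in> ?V"
    then obtain W k where V: "V = initial \<pi> k W" "W \<in> \<W>" by auto
    show "cpoly.subspace V" unfolding V by (intro subspace_initial sub V)
    show "\<exists>F. finite F \<and> V \<subseteq> cpoly.span F"
    proof (intro exI conjI)
      show "finite ((\<lambda>f. coeff (graded \<pi> f) k) ` F W)" using F V by blast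
      show "V \<subseteq> cpoly.span ((\<lambda>f. coeff (graded \<pi> f) k) ` F W)"
        using F[OF V(2)] by (auto simp: V(1) initial_def intro: coeff_graded_span)
    qed
    fix g f assume g: "g \<in> carrier G" and "f \<in> V"
    then obtain h where "h \<in> W" "f = coeff (graded \<pi> h) k" "\<forall>i<k. coeff (graded \<pi> h) i = 0"
      by (auto simp: V initial_def)
    then show "act g f \<in> V"
      unfolding V initial_def using st[OF V(2) g] by (auto simp: act_coeff_graded[OF g] intro!: exI[of _ "act g h"])
  next
    fix g assume g: "g \<in> carrier G" and fixd: "\<forall>V\<in>?V. \<forall>f\<in>V. act g f = f"
    show "g = \<one>"
    proof (rule fa[OF g], rule ccontr)
      fix W f assume W: "W \<in> \<W>" and "f \<in> W" "act g f \<noteq> f"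
      define low where "low w = (LEAST k. coeff (graded \<pi> w) k \<noteq> 0)" for w
      have low: "coeff (graded \<pi> w) (low w) \<noteq> 0" "\<And>k. k < low w \<Longrightarrow> coeff (graded \<pi> w) k = 0" "low w \<le> N"
        if "w \<in> W" "w \<noteq> 0" for w
      proof -
        have "\<exists>k. coeff (graded \<pi> w) k \<noteq> 0"
        proof (rule ccontr)
          assume "\<not> ?thesis"
          then have "graded \<pi> w = 0" by (intro poly_eqI) simp
          then have "pull (scaling \<pi> 1) w = 0" using poly_graded[OF pi(1), of w 1] by simp
          moreover have "pull (scaling \<pi> 1) w = w"
            by (rule cpoly_eqI) (simp add: ev_pull polyop_scaling pi scaling_def)
          ultimately show False using that by simp
        qed
        then show 1: "coeff (graded \<pi> w) (low w) \<noteq> 0" unfolding low_def by (rule LeastI_ex)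
        show "coeff (graded \<pi> w) k = 0" if "k < low w" for k
          using not_less_Least[OF that[unfolded low_def]] by simp
        show "low w \<le> N" using le_degree[OF 1] N[OF W that(1)] by simp
      qed
      define P where "P f \<longleftrightarrow> f \<in> W \<and> act g f \<noteq> f" for f
      define mu where "mu f = low (act g f - f)" for f
      have inW: "act g f - f \<in> W" if "f \<in> W" for f
        using sub[OF W] st[OF W g that] that by (rule cpoly.subspace_diff)
      \<comment> \<open>The degree bound \<open>N\<close> also bounds orders, so a largest one
        exists.\<close>
      have "mu h \<le> N" if "P h" for h unfolding mu_def using that by (intro low(3) inW) (auto simp: P_def)
      then obtain h where h: "P h" "\<And>h'. P h' \<Longrightarrow> mu h' \<le> mu h"
        using ex_has_greatest_nat[of P f mu "N + 1"] \<open>f \<in> W\<close> \<open>act g f \<noteq> f\<close> P_def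
        by (metis less_Suc_eq_le Suc_eq_plus1)
      define w where "w = act g h - h"
      have w: "w \<in> W" "w \<noteq> 0" using h(1) inW by (auto simp: w_def P_def)
      have "act g w = w"
      proof (rule ccontr)
        assume nw: "act g w \<noteq> w"
        then have "P w" using w by (simp add: P_def)
        then have le: "low (act g w - w) \<le> low w" using h(2)[of w] by (simp add: mu_def w_def)
        have w': "act g w - w \<in> W" "act g w - w \<noteq> 0" using inW w nw by auto
        have "coeff (graded \<pi> w) (low w) \<in> initial \<pi> (low w) W"
          unfolding initial_def using w low(2)[OF w] by blast
        then have "act g (coeff (graded \<pi> w) (low w)) = coeff (graded \<pi> w) (low w)"
          using fixd W low(3)[OF w] by auto
        then have "coeff (graded \<pi> (act g w - w)) (low w) = 0"
          by (simp add: graded.hom_minus act_coeff_graded[OF g])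
        moreover have "coeff (graded \<pi> (act g w - w)) k = 0" if "k < low w" for k
          using low(2)[OF w that] by (simp add: graded.hom_minus act_coeff_graded[OF g])
        ultimately show False using low(1)[OF w'] le by (metis le_neq_implies_less)
      qed
      then have "w = 0" using unipotent_trivial[OF g, of h w] by (simp add: w_def)
      then show False using w by simp
    qed
  next
    fix f0 f1 f2 x u v w
    assume f: "f0 \<in> \<Union>?V" "f1 \<in> \<Union>?V" "f2 \<in> \<Union>?V"
    have ex: "\<exists>F k. F \<in> \<Union>\<W> \<and> f = coeff (graded \<pi> F) k \<and> (\<forall>l<k. coeff (graded \<pi> F) l = 0)"
      if "f \<in> \<Union>?V" for f
      using that unfolding initial_def by blast
    obtain F0 k0 where f0: "F0 \<in> \<Union>\<W>" "f0 = coeff (graded \<pi> F0) k0" "\<And>l. l < k0 \<Longrightarrow> coeff (graded \<pi> F0) l = 0"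
      using ex[OF f(1)] by blast
    obtain F1 k1 where f1: "F1 \<in> \<Union>\<W>" "f1 = coeff (graded \<pi> F1) k1" "\<And>l. l < k1 \<Longrightarrow> coeff (graded \<pi> F1) l = 0"
      using ex[OF f(2)] by blast
    obtain F2 k2 where f2: "F2 \<in> \<Union>\<W>" "f2 = coeff (graded \<pi> F2) k2" "\<And>l. l < k2 \<Longrightarrow> coeff (graded \<pi> F2) l = 0"
      using ex[OF f(3)] by blast
    define F :: "nat \<Rightarrow> cpoly" where "F = (\<lambda>_. F2)(0 := F0, 1 := F1)"
    define d :: "nat \<Rightarrow> nat" where "d = (\<lambda>_. k2)(0 := k0, 1 := k1)"
    have "jac (coeff (graded \<pi> (F 0)) (d 0)) (coeff (graded \<pi> (F 1)) (d 1)) (coeff (graded \<pi> (F 2)) (d 2)) x u v w = 0"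
    proof (rule jac_initial[of F N d])
      fix i :: nat assume "i < 3"
      then have i: "i = 0 \<or> i = 1 \<or> i = 2" by auto
      show "degree (graded \<pi> (F i)) \<le> N" using i f0 f1 f2 N by (auto simp: F_def)
      show "coeff (graded \<pi> (F i)) l = 0" if "l < d i" for l using i that f0 f1 f2 by (auto simp: F_def d_def)
    qed (use f0 f1 f2 ja in \<open>auto simp: F_def\<close>)
    then show "jac f0 f1 f2 x u v w = 0" by (simp add: F_def d_def f0 f1 f2)
  qed
  then show ?thesis using that by blast
qed

end

text \<open>One projection after another; each new step keeps the earlier homogeneity because the
  projections commute.\<close>

lemma ex_homogeneous_family:
  assumes "finite PP" "family \<W>"
    and "\<And>\<pi>. \<pi> \<in> PP \<Longrightarrow> polyop \<pi>" "\<And>\<pi>. \<pi> \<in> PP \<Longrightarrow> linop \<pi>" "\<And>\<pi> x. \<pi> \<in> PP \<Longrightarrow> \<pi> (\<pi> x) = \<pi> x"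
    and "\<And>\<pi> g x. \<pi> \<in> PP \<Longrightarrow> g \<in> carrier G \<Longrightarrow> L g (\<pi> x) = \<pi> (L g x)"
    and "\<And>\<pi> \<pi>' x. \<pi> \<in> PP \<Longrightarrow> \<pi>' \<in> PP \<Longrightarrow> \<pi> (\<pi>' x) = \<pi>' (\<pi> x)"
  shows "\<exists>\<V>. family \<V> \<and> (\<forall>V\<in>\<V>. \<forall>\<pi>\<in>PP. \<exists>k. \<forall>f\<in>V. homog \<pi> k f)"
  using assms
proof (induction PP rule: finite_induct)
  case empty
  then show ?case by blast
next
  case (insert \<pi> PP)
  then obtain \<V> where V: "family \<V>" "\<forall>V\<in>\<V>. \<forall>\<pi>\<in>PP. \<exists>k. \<forall>f\<in>V. homog \<pi> k f" by auto
  have pi: "polyop \<pi>" "linop \<pi>" "\<And>x. \<pi> (\<pi> x) = \<pi> x" "\<And>g x. g \<in> carrier G \<Longrightarrow> L g (\<pi> x) = \<pi> (L g x)"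
    using insert.prems by auto
  obtain N where N: "family ((\<lambda>(W, k). initial \<pi> k W) ` (\<V> \<times> {..N}))"
    by (rule family_initial[of \<pi> \<V>, OF pi V(1)])
  have "\<exists>j. \<forall>f\<in>initial \<pi> k W. homog \<pi>' j f" if Wp: "W \<in> \<V>" "\<pi>' \<in> insert \<pi> PP" for W k \<pi>'
  proof (cases "\<pi>' = \<pi>")
    case True
    then show ?thesis using homog_coeff_graded[of \<pi>, OF pi(1-3)] by (auto simp: initial_def)
  next
    case False
    then obtain j where j: "\<forall>f\<in>W. homog \<pi>' j f" using V(2) Wp False by blast
    have "homog \<pi>' j (coeff (graded \<pi> f) k)" if "f \<in> W" for f
    proof (rule homog_coeff_graded_other[of \<pi> \<pi>'])
      show "\<pi> (\<pi>' x) = \<pi>' (\<pi> x)" for x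
        using insert.prems(6)[of \<pi> \<pi>' x] \<open>\<pi>' \<in> insert \<pi> PP\<close> by blast
    qed (use pi insert.prems(2,3) \<open>\<pi>' \<in> insert \<pi> PP\<close> j that in blast)+
    then show ?thesis by (auto simp: initial_def)
  qed
  then show ?case using N by (intro exI[of _ "(\<lambda>(W, k). initial \<pi> k W) ` (\<V> \<times> {..N})"]) auto
qed

end

section \<open>Lattices of small rank\<close>

definition int_lattice :: "('i \<Rightarrow> int) set \<Rightarrow> bool" where
  "int_lattice \<Lambda> \<longleftrightarrow> (\<lambda>_. 0) \<in> \<Lambda> \<and> (\<forall>x\<in>\<Lambda>. \<forall>y\<in>\<Lambda>. (\<lambda>i. x i - y i) \<in> \<Lambda>)"

lemma int_lattice_diff: "int_lattice \<Lambda> \<Longrightarrow> x \<in> \<Lambda> \<Longrightarrow> y \<in> \<Lambda> \<Longrightarrow> (\<lambda>i. x i - y i) \<in> \<Lambda>"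
  by (simp add: int_lattice_def)

lemma int_lattice_uminus: "int_lattice \<Lambda> \<Longrightarrow> x \<in> \<Lambda> \<Longrightarrow> (\<lambda>i. - x i) \<in> \<Lambda>"
  using int_lattice_diff[of \<Lambda> "\<lambda>_. 0" x] by (simp add: int_lattice_def)

lemma int_lattice_diff_mult:
  assumes "int_lattice \<Lambda>" "x \<in> \<Lambda>" "y \<in> \<Lambda>"
  shows "(\<lambda>i. x i - n * y i) \<in> \<Lambda>"
proof -
  have nat: "(\<lambda>i. x i - int k * z i) \<in> \<Lambda>" if "z \<in> \<Lambda>" for z k
  proof (induction k)
    case (Suc k)
    show ?case using int_lattice_diff[OF assms(1) Suc that] by (simp add: algebra_simps)
  qed (use assms in simp)
  show ?thesis
  proof (cases "n \<ge> 0")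
    case True
    then show ?thesis using nat[OF assms(3), of "nat n"] by simp
  next
    case False
    then show ?thesis using nat[OF int_lattice_uminus[OF assms(1,3)], of "nat (- n)"] by simp
  qed
qed

text \<open>The values at \<open>e\<close> form a nonzero ideal of the integers; division with
  remainder shows that the least positive value generates it.\<close>

lemma int_lattice_pivot:
  assumes L: "int_lattice \<Lambda>" "x \<in> \<Lambda>" "x e \<noteq> 0"
  obtains d where "d \<in> \<Lambda>" "d e \<noteq> 0" "\<And>y. y \<in> \<Lambda> \<Longrightarrow> \<exists>n. y e = n * d e"
proof -
  define P where "P y \<longleftrightarrow> y \<in> \<Lambda> \<and> y e > 0" for y
  have "\<exists>y. P y"
  proof (cases "x e > 0")
    case False
    then show ?thesis using int_lattice_uminus[OF L(1,2)] L(3)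
      by (intro exI[of _ "\<lambda>i. - x i"]) (auto simp: P_def)
  qed (use L in \<open>auto simp: P_def\<close>)
  then obtain d where d: "P d" and min: "\<And>y. P y \<Longrightarrow> nat (d e) \<le> nat (y e)"
    using ex_has_least_nat[of P _ "\<lambda>y. nat (y e)"] by blast
  have "\<exists>n. y e = n * d e" if y: "y \<in> \<Lambda>" for y
  proof -
    let ?r = "\<lambda>i. y i - (y e div d e) * d i"
    have r: "?r \<in> \<Lambda>" using int_lattice_diff_mult L(1) y d by (auto simp: P_def)
    have re: "?r e = y e mod d e" by (simp add: minus_div_mult_eq_mod)
    have "y e mod d e = 0"
    proof (rule ccontr)
      assume "y e mod d e \<noteq> 0"
      moreover have "0 \<le> y e mod d e" "y e mod d e < d e" using d by (auto simp: P_def)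
      ultimately have "P ?r" using r re by (auto simp: P_def)
      then have "nat (d e) \<le> nat (y e mod d e)" using min[of ?r] re by simp
      then show False using \<open>y e mod d e < d e\<close> \<open>0 \<le> y e mod d e\<close> by simp
    qed
    then show ?thesis by (intro exI[of _ "y e div d e"]) (metis div_mult_mod_eq add.right_neutral)
  qed
  then show ?thesis using that[of d] d by (auto simp: P_def)
qed

lemma int_lattice_rank_1:
  assumes L: "int_lattice \<Lambda>" and minors: "\<And>x y i j. x \<in> \<Lambda> \<Longrightarrow> y \<in> \<Lambda> \<Longrightarrow> x i * y j = x j * y i"
  shows "\<exists>d\<in>\<Lambda>. \<forall>x\<in>\<Lambda>. \<exists>n. \<forall>i. x i = n * d i"
proof (cases "\<exists>x\<in>\<Lambda>. \<exists>e. x e \<noteq> 0")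
  case True
  then obtain x e where "x \<in> \<Lambda>" "x e \<noteq> 0" by blast
  then obtain d where d: "d \<in> \<Lambda>" "d e \<noteq> 0" "\<And>y. y \<in> \<Lambda> \<Longrightarrow> \<exists>n. y e = n * d e"
    using int_lattice_pivot[OF L] by blast
  have "\<exists>n. \<forall>i. y i = n * d i" if y: "y \<in> \<Lambda>" for y
  proof -
    obtain n where n: "y e = n * d e" using d(3)[OF y] by blast
    have "y i = n * d i" for i
    proof -
      have "d e * y i = d e * (n * d i)" using minors[OF y d(1), of i e] n by (simp add: algebra_simps)
      then show ?thesis using d(2) by simp
    qed
    then show ?thesis by blast
  qed
  then show ?thesis using d(1) by (intro bexI[of _ d] ballI)
next
  case False
  then have "x i = 0" if "x \<in> \<Lambda>" for x i using that by auto
  then show ?thesis using L by (intro bexI[of _ "\<lambda>_. 0"]) (auto simp: int_lattice_def)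
qed

definition int_det3 :: "('i \<Rightarrow> int) \<Rightarrow> ('i \<Rightarrow> int) \<Rightarrow> ('i \<Rightarrow> int) \<Rightarrow> 'i \<Rightarrow> 'i \<Rightarrow> 'i \<Rightarrow> int" where
  "int_det3 x y z i j k = x i * (y j * z k - y k * z j) - x j * (y i * z k - y k * z i) + x k * (y i * z j - y j * z i)"

text \<open>A pivot at one coordinate \<open>e\<close> splits off one generator; the elements
  vanishing at \<open>e\<close> satisfy the condition for rank 1.\<close>

lemma int_lattice_rank_2:
  assumes L: "int_lattice \<Lambda>"
    and minors: "\<And>x y z i j k. x \<in> \<Lambda> \<Longrightarrow> y \<in> \<Lambda> \<Longrightarrow> z \<in> \<Lambda> \<Longrightarrow> int_det3 x y z i j k = 0"
  shows "\<exists>d\<in>\<Lambda>. \<exists>d'\<in>\<Lambda>. \<forall>x\<in>\<Lambda>. \<exists>m n. \<forall>i. x i = m * d i + n * d' i"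
proof (cases "\<exists>x\<in>\<Lambda>. \<exists>e. x e \<noteq> 0")
  case True
  then obtain x e where "x \<in> \<Lambda>" "x e \<noteq> 0" by blast
  then obtain d where d: "d \<in> \<Lambda>" "d e \<noteq> 0" "\<And>y. y \<in> \<Lambda> \<Longrightarrow> \<exists>n. y e = n * d e"
    using int_lattice_pivot[OF L] by blast
  define L' where "L' = {x \<in> \<Lambda>. x e = 0}"
  have "int_lattice L'" using L by (auto simp: int_lattice_def L'_def)
  \<comment> \<open>In the determinant of \<open>d\<close>, \<open>x\<close>, \<open>y\<close> at
    \<open>e\<close>, \<open>i\<close>, \<open>j\<close> the first column is \<open>d e\<close>, 0,
    0, so it equals \<open>d e\<close> times the 2x2 minor.\<close>
  moreover have "x i * y j = x j * y i" if "x \<in> L'" "y \<in> L'" for x y i j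
    using minors[OF d(1), of x y e i j] that d(2) by (auto simp: int_det3_def L'_def)
  ultimately have "\<exists>d'\<in>L'. \<forall>x\<in>L'. \<exists>n. \<forall>i. x i = n * d' i"
    by (rule int_lattice_rank_1)
  then obtain d' where d': "d' \<in> L'" "\<forall>x\<in>L'. \<exists>n. \<forall>i. x i = n * d' i" by (rule bexE)
  have "\<exists>m n. \<forall>i. y i = m * d i + n * d' i" if y: "y \<in> \<Lambda>" for y
  proof -
    obtain m where m: "y e = m * d e" using d(3)[OF y] by blast
    have "(\<lambda>i. y i - m * d i) \<in> L'" using int_lattice_diff_mult[OF L y d(1)] m by (simp add: L'_def)
    then obtain n where n: "\<forall>i. y i - m * d i = n * d' i" using bspec[OF d'(2)] by blast
    have "y i = m * d i + n * d' i" for i using n[rule_format, of i] by simp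
    then show ?thesis by blast
  qed
  then show ?thesis using d(1) d'(1) by (intro bexI[of _ d] bexI[of _ d'] ballI) (auto simp: L'_def)
next
  case False
  then have "x i = 0" if "x \<in> \<Lambda>" for x i using that by auto
  then show ?thesis using L by (intro bexI[of _ "\<lambda>_. 0"]) (auto simp: int_lattice_def)
qed

text \<open>The generated subgroup, built by adding or subtracting one generator at a time; an
  induction then compares an arbitrary element with members of \<open>A\<close> only.\<close>

inductive_set int_span :: "('i \<Rightarrow> int) set \<Rightarrow> ('i \<Rightarrow> int) set" for A where
  int_span_zero: "(\<lambda>_. 0) \<in> int_span A"
| int_span_add: "x \<in> int_span A \<Longrightarrow> a \<in> A \<Longrightarrow> (\<lambda>i. x i + a i) \<in> int_span A"
| int_span_diff: "x \<in> int_span A \<Longrightarrow> a \<in> A \<Longrightarrow> (\<lambda>i. x i - a i) \<in> int_span A"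

lemma int_span_base: "a \<in> A \<Longrightarrow> a \<in> int_span A"
  using int_span_add[OF int_span_zero, of a A] by simp

lemma int_lattice_int_span: "int_lattice (int_span A)"
  unfolding int_lattice_def
proof (intro conjI ballI)
  fix x y assume x: "x \<in> int_span A" and "y \<in> int_span A"
  from this(2) show "(\<lambda>i. x i - y i) \<in> int_span A"
  proof induction
    case (int_span_add y a)
    then show ?case using int_span.int_span_diff[of "\<lambda>i. x i - y i" A a] by (simp add: algebra_simps)
  next
    case (int_span_diff y a)
    then show ?case using int_span.int_span_add[of "\<lambda>i. x i - y i" A a] by (simp add: algebra_simps)
  qed (use x in simp)
qed (rule int_span_zero)

lemma int_span_minors_2:
  assumes "\<And>x y i j. x \<in> A \<Longrightarrow> y \<in> A \<Longrightarrow> x i * y j = x j * y i"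
  shows "x \<in> int_span A \<Longrightarrow> y \<in> int_span A \<Longrightarrow> x i * y j = x j * y i"
proof -
  have 1: "x i * y j = x j * y i" if "x \<in> int_span A" "y \<in> A" for x y
    using that by induction (auto simp: algebra_simps assms)
  show "x i * y j = x j * y i" if "x \<in> int_span A" "y \<in> int_span A"
    using that(2,1)
  proof induction
    case (int_span_add y a)
    then show ?case using 1[of x a] by (simp add: algebra_simps)
  next
    case (int_span_diff y a)
    then show ?case using 1[of x a] by (simp add: algebra_simps)
  qed simp
qed

text \<open>The determinant is additive in its first argument, and its cyclic symmetry brings the
  other two arguments there in turn.\<close>

lemma int_span_minors_3:
  assumes A: "\<And>x y z i j k. x \<in> A \<Longrightarrow> y \<in> A \<Longrightarrow> z \<in> A \<Longrightarrow> int_det3 x y z i j k = 0"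
  shows "x \<in> int_span A \<Longrightarrow> y \<in> int_span A \<Longrightarrow> z \<in> int_span A \<Longrightarrow> int_det3 x y z i j k = 0"
proof -
  have lin: "int_det3 (\<lambda>i. x i + a i) y z i j k = int_det3 x y z i j k + int_det3 a y z i j k"
    "int_det3 (\<lambda>i. x i - a i) y z i j k = int_det3 x y z i j k - int_det3 a y z i j k"
    "int_det3 (\<lambda>_. 0) y z i j k = 0" for x a y z
    by (simp_all add: int_det3_def algebra_simps)
  have rot: "int_det3 x y z i j k = int_det3 y z x i j k" for x y z
    by (simp add: int_det3_def algebra_simps)
  have 1: "int_det3 x y z i j k = 0" if "x \<in> int_span A" "y \<in> A" "z \<in> A" for x y z
    using that by induction (simp_all add: lin A)
  have 2: "int_det3 y x z i j k = 0" if "y \<in> int_span A" "x \<in> int_span A" "z \<in> A" for x y z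
    using that(1,2,3) by induction (simp_all add: lin, use rot 1 in metis, use rot 1 in metis)
  have 3: "int_det3 z x y i j k = 0" if "z \<in> int_span A" "x \<in> int_span A" "y \<in> int_span A" for x y z
    using that(1,2,3) by induction (simp_all add: lin, use rot 2 in metis, use rot 2 in metis)
  show "x \<in> int_span A \<Longrightarrow> y \<in> int_span A \<Longrightarrow> z \<in> int_span A \<Longrightarrow> int_det3 x y z i j k = 0" by (rule 3)
qed

section \<open>Isotypic projections for central elements\<close>

lemma polyop_sum: "(\<And>k. k < n \<Longrightarrow> polyop (M k)) \<Longrightarrow> polyop (\<lambda>x i. \<Sum>k<(n::nat). c k * M k x i)"
proof (induction n)
  case 0
  then show ?case unfolding polyop_def by (intro exI[of _ "\<lambda>_. 0"]) simp
next
  case (Suc n)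
  then show ?case using polyop_comb[of "\<lambda>x i. \<Sum>k<n. c k * M k x i" "M n" 1 "c n"] by simp
qed

lemma linop_sum: "(\<And>k. k < n \<Longrightarrow> linop (M k)) \<Longrightarrow> linop (\<lambda>x i. \<Sum>k<(n::nat). c k * M k x i)"
proof (induction n)
  case (Suc n)
  then show ?case using linop_comb[of "\<lambda>x i. \<Sum>k<n. c k * M k x i" "M n" 1 "c n"] by simp
qed (simp add: linop_def)

lemma linop_apply_sum: "linop M \<Longrightarrow> M (\<lambda>i. \<Sum>k<(n::nat). c k * y k i) = (\<lambda>i. \<Sum>k<n. c k * M (y k) i)"
proof (induction n)
  case 0
  then show ?case using linopD[of M 0 "\<lambda>_. 0" 0 "\<lambda>_. 0"] by simp
next
  case (Suc n)
  then show ?case using linopD[of M 1 "\<lambda>i. \<Sum>k<n. c k * y k i" "c n" "y n"] by simp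
qed

lemma polyop_funpow: "polyop M \<Longrightarrow> polyop (M ^^ k)"
proof (induction k)
  case 0 then show ?case using polyop_id by (simp add: id_def)
next
  case (Suc k) then show ?case using polyop_comp[of M "M ^^ k"] by (simp add: comp_def)
qed

lemma linop_funpow: "linop M \<Longrightarrow> linop (M ^^ k)"
proof (induction k)
  case 0 then show ?case using linop_id by (simp add: id_def)
next
  case (Suc k) then show ?case using linop_comp[of M "M ^^ k"] by (simp add: comp_def)
qed

lemma sum_root_of_unity_powers:
  fixes z :: complex
  assumes "z ^ e = 1" "z \<noteq> 1"
  shows "(\<Sum>k<e. z ^ k) = 0"
  using geometric_sum[OF assms(2), of e] assms(1) by simp

definition prim_root :: "nat \<Rightarrow> complex" where
  "prim_root e = cis (2 * pi / e)"

lemma prim_root_power: "prim_root e ^ k = cis (2 * pi * k / e)"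
  by (simp add: prim_root_def DeMoivre mult.commute)

lemma prim_root_nz [simp]: "prim_root e \<noteq> 0"
  by (simp add: prim_root_def)

lemma prim_root_power_e: "e > 0 \<Longrightarrow> prim_root e ^ e = 1"
  by (simp add: prim_root_power)

lemma prim_root_inj: "i < e \<Longrightarrow> j < e \<Longrightarrow> prim_root e ^ i = prim_root e ^ j \<Longrightarrow> i = j"
proof -
  assume a: "i < e" "j < e" "prim_root e ^ i = prim_root e ^ j"
  have "inj_on (\<lambda>k::nat. cis (2 * pi * real k / real e)) {..<e}"
    using bij_betw_roots_unity[of e] a by (auto simp: bij_betw_def)
  then show ?thesis using a by (auto simp: prim_root_power inj_on_def)
qed

text \<open>For \<open>A\<close> of order dividing \<open>e\<close> this is the projection onto the
  eigenspace of \<open>prim_root e ^ i\<close>: the average of the powers of \<open>A\<close>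
  against the inverse eigenvalues.\<close>

definition isotypic :: "(cfun \<Rightarrow> cfun) \<Rightarrow> nat \<Rightarrow> nat \<Rightarrow> cfun \<Rightarrow> cfun" where
  "isotypic A e i x = (\<lambda>a. \<Sum>k<e. (inverse (prim_root e ^ (i * k)) / e) * (A ^^ k) x a)"

lemma polyop_isotypic: "polyop A \<Longrightarrow> polyop (isotypic A e i)"
  unfolding isotypic_def by (intro polyop_sum polyop_funpow)

lemma linop_isotypic: "linop A \<Longrightarrow> linop (isotypic A e i)"
  unfolding isotypic_def by (intro linop_sum linop_funpow)

lemma isotypic_commute:
  assumes "linop M" "\<And>x. M (A x) = A (M x)"
  shows "M (isotypic A e i x) = isotypic A e i (M x)"
proof -
  have "M ((A ^^ k) x) = (A ^^ k) (M x)" for k by (induction k) (simp_all add: assms(2))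
  then show ?thesis unfolding isotypic_def by (subst linop_apply_sum[OF assms(1)]) simp
qed

text \<open>Because of this case the ordinary grading by degree is among those coming from the
  centre.\<close>

lemma isotypic_id: "e > 0 \<Longrightarrow> isotypic (\<lambda>x. x) e 0 = (\<lambda>x. x)"
proof -
  assume "e > 0"
  moreover have "((\<lambda>x. x) ^^ k) x = x" for k and x :: cfun by (induction k) simp_all
  ultimately show ?thesis by (intro ext) (simp add: isotypic_def)
qed

context
  fixes A e
  assumes A: "linop A" "\<And>x. (A ^^ e) x = x" and e: "e > 0"
begin

lemma isotypic_eigen: "A (isotypic A e i x) = (\<lambda>a. prim_root e ^ i * isotypic A e i x a)"
proof
  fix a
  define f where "f k = inverse (prim_root e ^ (i * k)) / e * (A ^^ k) x a" for k
  have "f e = f 0"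
    using A(2) e prim_root_power_e[OF e] by (simp add: f_def power_mult mult.commute)
  have "A (isotypic A e i x) a = (\<Sum>k<e. (inverse (prim_root e ^ (i * k)) / e) * (A ^^ Suc k) x a)"
    unfolding isotypic_def by (subst linop_apply_sum[OF A(1)]) simp
  also have "\<dots> = (\<Sum>k<e. prim_root e ^ i * f (Suc k))"
    by (intro sum.cong refl) (simp add: f_def power_add field_simps)
  also have "\<dots> = prim_root e ^ i * (\<Sum>k<e. f (Suc k))" by (simp add: sum_distrib_left)
  also have "(\<Sum>k<e. f (Suc k)) = (\<Sum>k<Suc e. f k) - f 0" by (subst sum.lessThan_Suc_shift) simp
  also have "\<dots> = (\<Sum>k<e. f k)" using \<open>f e = f 0\<close> by simp
  finally show "A (isotypic A e i x) a = prim_root e ^ i * isotypic A e i x a" by (simp add: isotypic_def f_def)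
qed

lemma isotypic_eigen_funpow: "(A ^^ k) (isotypic A e i x) = (\<lambda>a. prim_root e ^ (i * k) * isotypic A e i x a)"
proof (induction k)
  case (Suc k)
  have "(A ^^ Suc k) (isotypic A e i x) = A (\<lambda>a. prim_root e ^ (i * k) * isotypic A e i x a + 0 * x a)"
    using Suc by simp
  also have "\<dots> = (\<lambda>a. prim_root e ^ (i * k) * A (isotypic A e i x) a)"
    by (subst linopD[OF A(1)]) simp
  finally show ?case by (simp add: isotypic_eigen power_add mult_ac)
qed simp

lemma isotypic_orthogonal:
  assumes "i < e" "j < e"
  shows "isotypic A e j (isotypic A e i x) = (if i = j then isotypic A e i x else (\<lambda>_. 0))"
proof
  fix a
  have "isotypic A e j (isotypic A e i x) a
      = (\<Sum>k<e. (prim_root e ^ i / prim_root e ^ j) ^ k) / e * isotypic A e i x a"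
    unfolding isotypic_def[of A e j] isotypic_eigen_funpow sum_divide_distrib sum_distrib_right
    by (intro sum.cong refl) (simp add: power_divide power_mult[symmetric] field_simps)
  moreover have "(\<Sum>k<e. (prim_root e ^ i / prim_root e ^ j) ^ k) = (if i = j then of_nat e else 0)"
  proof (cases "i = j")
    case False
    have "(prim_root e ^ i / prim_root e ^ j) ^ e = 1"
      using prim_root_power_e[OF e] by (simp add: power_divide) (metis power_mult mult.commute power_one)
    moreover have "prim_root e ^ i / prim_root e ^ j \<noteq> 1"
      using prim_root_inj[OF assms] False by auto
    ultimately show ?thesis using sum_root_of_unity_powers False by auto
  qed simp
  ultimately show "isotypic A e j (isotypic A e i x) a = (if i = j then isotypic A e i x else (\<lambda>_. 0)) a"
    using e by simp
qed

lemma isotypic_sum: "(\<Sum>i<e. isotypic A e i x a) = x a"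
proof -
  have "(\<Sum>i<e. isotypic A e i x a) = (\<Sum>k<e. (\<Sum>i<e. inverse (prim_root e ^ (i * k))) / e * (A ^^ k) x a)"
    unfolding isotypic_def by (subst sum.swap) (simp add: sum_distrib_right sum_divide_distrib)
  also have "\<dots> = (\<Sum>k<e. if k = 0 then (A ^^ k) x a else 0)"
  proof (intro sum.cong refl)
    fix k assume k: "k \<in> {..<e}"
    have "(\<Sum>i<e. inverse (prim_root e ^ (i * k))) = (\<Sum>i<e. (inverse (prim_root e ^ k)) ^ i)"
      by (intro sum.cong refl) (simp add: power_inverse power_mult[symmetric] mult.commute)
    also have "\<dots> = (if k = 0 then of_nat e else 0)"
    proof (cases "k = 0")
      case False
      have "inverse (prim_root e ^ k) ^ e = 1"
        using prim_root_power_e[OF e] by (simp add: power_inverse) (metis power_mult mult.commute power_one)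
      moreover have "inverse (prim_root e ^ k) \<noteq> 1"
        using prim_root_inj[of k e 0] k False by auto
      ultimately show ?thesis using sum_root_of_unity_powers False by auto
    qed simp
    finally show "(\<Sum>i<e. inverse (prim_root e ^ (i * k))) / e * (A ^^ k) x a = (if k = 0 then (A ^^ k) x a else 0)"
      using e by simp
  qed
  finally show ?thesis using e by simp
qed

text \<open>\<open>A\<close> multiplies each eigenspace by its eigenvalue, so it is a composite of
  scalings, one for each \<open>i\<close>; \<open>S m\<close> is the image of \<open>x\<close> under
  the first \<open>m\<close> of them.\<close>

lemma pull_eq_if_homog:
  assumes pA: "polyop A" and h: "\<And>i. i < e \<Longrightarrow> homog (isotypic A e i) (d i) f"
  shows "pull A f = Const (\<Prod>i<e. (prim_root e ^ i) ^ d i) * f"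
proof (rule cpoly_eqI)
  fix x
  define S where "S m = (\<lambda>a. x a + (\<Sum>i<m. (prim_root e ^ i - 1) * isotypic A e i x a))" for m
  have iso_S: "isotypic A e m (S m) = isotypic A e m x" if m: "m < e" for m
  proof -
    have "isotypic A e m (S m) = (\<lambda>a. 1 * isotypic A e m x a + 1 * isotypic A e m (\<lambda>a. \<Sum>i<m. (prim_root e ^ i - 1) * isotypic A e i x a) a)"
      using linopD[OF linop_isotypic[OF A(1), of e m], of 1 x 1] by (simp add: S_def)
    also have "isotypic A e m (\<lambda>a. \<Sum>i<m. (prim_root e ^ i - 1) * isotypic A e i x a)
        = (\<lambda>a. \<Sum>i<m. (prim_root e ^ i - 1) * isotypic A e m (isotypic A e i x) a)"
      by (rule linop_apply_sum[OF linop_isotypic[OF A(1)]])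
    also have "\<dots> = (\<lambda>a. 0)" using m by (intro ext sum.neutral) (auto simp: isotypic_orthogonal)
    finally show ?thesis by simp
  qed
  have "ev (S m) f = (\<Prod>i<m. (prim_root e ^ i) ^ d i) * ev x f" if "m \<le> e" for m
    using that
  proof (induction m)
    case 0 then show ?case by (simp add: S_def)
  next
    case (Suc m)
    then have m: "m < e" by simp
    have "S (Suc m) = scaling (isotypic A e m) (prim_root e ^ m) (S m)"
      unfolding scaling_def iso_S[OF m] by (simp add: S_def add.assoc)
    moreover have "pull (scaling (isotypic A e m) (prim_root e ^ m)) f = Const ((prim_root e ^ m) ^ d m) * f"
      using h[OF m] homog_iff[OF polyop_isotypic[OF pA]] by blast
    ultimately have "ev (S (Suc m)) f = (prim_root e ^ m) ^ d m * ev (S m) f"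
      by (metis ev_pull polyop_scaling polyop_isotypic[OF pA] ev.hom_mult ev_Const)
    then show ?case using Suc by simp
  qed
  then have "ev (S e) f = (\<Prod>i<e. (prim_root e ^ i) ^ d i) * ev x f" by simp
  moreover have "S e = A x"
  proof
    fix a
    have "x = (\<lambda>a. \<Sum>i<e. 1 * isotypic A e i x a)" by (simp add: isotypic_sum)
    then have "A x a = (\<Sum>i<e. 1 * A (isotypic A e i x) a)"
      using linop_apply_sum[OF A(1), where n = e and c = "\<lambda>_. 1" and y = "\<lambda>i. isotypic A e i x"] by metis
    then have "A x a = (\<Sum>i<e. prim_root e ^ i * isotypic A e i x a)" by (simp add: isotypic_eigen)
    moreover have "S e a = (\<Sum>i<e. prim_root e ^ i * isotypic A e i x a)"
      using isotypic_sum[of x a] by (simp add: S_def algebra_simps sum_subtractf)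
    ultimately show "S e a = A x a" by simp
  qed
  ultimately show "ev x (pull A f) = ev x (Const (\<Prod>i<e. (prim_root e ^ i) ^ d i) * f)"
    by (simp add: ev_pull[OF pA] ev.hom_mult)
qed

end

section \<open>Twisting a projective representation\<close>

text \<open>After dividing by the gcd, \<open>l' + k * c'\<close> has to be prime to
  \<open>e\<close>. With \<open>k\<close> the product of the primes of \<open>e\<close> not dividing
  \<open>l'\<close>, each prime of \<open>e\<close> divides exactly one of \<open>l'\<close> and
  \<open>k * c'\<close>.\<close>

lemma ex_gcd_shift_dvd:
  fixes l c e :: nat
  assumes "e > 0"
  shows "\<exists>k. gcd (l + k * c) e dvd gcd l c"
proof (cases "l = 0 \<and> c = 0")
  case False
  define g where "g = gcd l c"
  have g: "g \<noteq> 0" using False by (simp add: g_def)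
  obtain l' c' where lc: "l = g * l'" "c = g * c'" "coprime l' c'"
    using gcd_coprime_exists[of l c] g unfolding g_def by (metis mult.commute)
  define P where "P = {p \<in> prime_factors e. \<not> p dvd l'}"
  define k where "k = \<Prod>P"
  have finP: "finite P" by (simp add: P_def)
  have pk: "p dvd k \<longleftrightarrow> p \<in> P" if pp: "prime p" "p dvd e" for p
  proof
    assume "p dvd k"
    then obtain q where "q \<in> P" "p dvd q"
      unfolding k_def using prime_dvd_prod_iff[OF finP pp(1), of "\<lambda>x. x"] by auto
    then show "p \<in> P" using pp primes_dvd_imp_eq[of p q] by (auto simp: P_def)
  qed (use dvd_prodI[OF finP, of p "\<lambda>x. x"] in \<open>simp add: k_def\<close>)
  have "coprime (l' + k * c') e"
  proof (rule ccontr)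
    assume "\<not> ?thesis"
    then have "gcd (l' + k * c') e \<noteq> 1" by (simp add: coprime_iff_gcd_eq_1)
    then obtain p where "prime p" "p dvd gcd (l' + k * c') e" using prime_factor_nat by blast
    then have p: "prime p" "p dvd l' + k * c'" "p dvd e" by auto
    show False
    proof (cases "p dvd l'")
      case True
      then have "p dvd k * c'" using p(2) by (simp add: dvd_add_right_iff)
      moreover have "\<not> p dvd c'"
        using coprime_common_divisor[OF lc(3) True] not_prime_unit[of p] p(1) by blast
      ultimately have "p dvd k" using prime_dvd_mult_iff[OF p(1)] by blast
      then show False using pk[OF p(1,3)] True by (simp add: P_def)
    next
      case False
      then have "p dvd k" using pk[OF p(1,3)] p assms by (simp add: P_def prime_factors_dvd)
      then have "p dvd l'" using p(2) dvd_add_left_iff[of p "k * c'" l'] by simp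
      then show False using False by simp
    qed
  qed
  then have "coprime (gcd (g * (l' + k * c')) e) (l' + k * c')"
    by (meson coprime_commute coprime_divisors dvd_refl gcd_dvd2)
  then have "gcd (g * (l' + k * c')) e dvd g"
    using coprime_dvd_mult_left_iff[of _ "l' + k * c'" g] gcd_dvd1 by blast
  then show ?thesis by (intro exI[of _ k]) (simp add: g_def[symmetric] lc(1,2) algebra_simps)
qed simp

lemma power_gcd_eq_1:
  fixes z :: complex and a b :: nat
  assumes "z ^ a = 1" "z ^ b = 1"
  shows "z ^ gcd a b = 1"
  using assms
proof (induction a b rule: gcd_nat_induct)
  case (step m n)
  have "z ^ m = (z ^ n) ^ (m div n) * z ^ (m mod n)"
    by (simp flip: power_mult power_add)
  then have "z ^ (m mod n) = 1" using step.prems by simp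
  then show ?case using step by (metis gcd_red_nat)
qed simp

definition (in group) character_on :: "'a set \<Rightarrow> ('a \<Rightarrow> complex) \<Rightarrow> bool" where
  "character_on S \<chi> \<longleftrightarrow> (\<forall>g\<in>S. \<chi> g \<noteq> 0) \<and> (\<forall>g\<in>S. \<forall>h\<in>S. \<chi> (g \<otimes> h) = \<chi> g * \<chi> h)"

context group
begin

lemma character_on_one: "character_on S \<chi> \<Longrightarrow> \<one> \<in> S \<Longrightarrow> \<chi> \<one> = 1"
  unfolding character_on_def by (metis l_one mult_cancel_right1 one_closed)

lemma character_on_mono: "character_on S \<chi> \<Longrightarrow> T \<subseteq> S \<Longrightarrow> character_on T \<chi>"
  by (auto simp: character_on_def)

lemma character_on_mult: "character_on S \<chi> \<Longrightarrow> character_on S \<psi> \<Longrightarrow> character_on S (\<lambda>g. \<chi> g * \<psi> g)"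
  by (auto simp: character_on_def)

lemma character_on_power: "character_on S \<chi> \<Longrightarrow> character_on S (\<lambda>g. \<chi> g ^ k)"
  by (auto simp: character_on_def power_mult_distrib)

context
  fixes S :: "'a set"
  assumes S: "S \<subseteq> carrier G" "finite S" "\<one> \<in> S" "\<And>s t. s \<in> S \<Longrightarrow> t \<in> S \<Longrightarrow> s \<otimes> t \<in> S"
begin

lemma character_on_pow: "character_on S \<chi> \<Longrightarrow> s \<in> S \<Longrightarrow> s [^] (k::nat) \<in> S \<and> \<chi> (s [^] k) = \<chi> s ^ k"
  by (induction k) (auto simp: S character_on_one, auto simp: character_on_def)

text \<open>Translation by \<open>s\<close> permutes the finite set \<open>S\<close>; the product of
  all values of \<chi> is compared before and after.\<close>

lemma character_on_power_card: "character_on S \<chi> \<Longrightarrow> s \<in> S \<Longrightarrow> \<chi> s ^ card S = 1"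
proof -
  assume c: "character_on S \<chi>" and s: "s \<in> S"
  have inj: "inj_on (\<lambda>t. s \<otimes> t) S" unfolding inj_on_def using S(1) s by (metis Units_eq Units_l_cancel subsetD)
  moreover have sub: "(\<lambda>t. s \<otimes> t) ` S \<subseteq> S" using S s by auto
  ultimately have im: "(\<lambda>t. s \<otimes> t) ` S = S" using S(2) by (metis endo_inj_surj)
  have "(\<Prod>t\<in>S. \<chi> t) = (\<Prod>t\<in>S. \<chi> (s \<otimes> t))"
    using prod.reindex[OF inj, of \<chi>] im by simp
  also have "\<dots> = (\<Prod>t\<in>S. \<chi> s * \<chi> t)" using c s by (intro prod.cong) (auto simp: character_on_def)
  also have "\<dots> = \<chi> s ^ card S * (\<Prod>t\<in>S. \<chi> t)" by (simp add: prod.distrib)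
  finally have "(\<chi> s ^ card S - 1) * (\<Prod>t\<in>S. \<chi> t) = 0" by (simp add: algebra_simps)
  moreover have "(\<Prod>t\<in>S. \<chi> t) \<noteq> 0" using c S(2) by (auto simp: character_on_def)
  ultimately show ?thesis by simp
qed

context
  fixes \<theta>
  assumes \<theta>: "character_on S \<theta>" "inj_on \<theta> S"
begin

lemma card_pos: "card S > 0" using S by (auto simp: card_gt_0_iff)

text \<open>By counting, an injective character attains every root of unity of order dividing
  \<open>card S\<close>, so \<open>S\<close> is cyclic.\<close>

lemma ex_generator:
  obtains s0 where "s0 \<in> S" "\<And>z. z ^ card S = 1 \<Longrightarrow> \<exists>j. z = \<theta> s0 ^ j"
proof -
  let ?e = "card S"
  let ?w = "cis (2 * pi / ?e)"
  have "\<theta> ` S \<subseteq> {z. z ^ ?e = 1}" using character_on_power_card[OF \<theta>(1)] by auto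
  moreover have "card (\<theta> ` S) = ?e" by (rule card_image[OF \<theta>(2)])
  ultimately have im: "\<theta> ` S = {z. z ^ ?e = 1}"
    using card_pos by (intro card_subset_eq finite_roots_unity) (auto simp: card_roots_unity_eq)
  have w: "?w ^ j = cis (2 * pi * j / ?e)" for j :: nat by (simp add: DeMoivre mult.commute)
  have "?w \<in> {z. z ^ ?e = 1}" using card_pos w[of ?e] by simp
  then obtain s0 where s0: "s0 \<in> S" "\<theta> s0 = ?w" using im by (metis (no_types, lifting) imageE)
  have "\<exists>j. z = \<theta> s0 ^ j" if "z ^ ?e = 1" for z
  proof -
    have "z \<in> (\<lambda>k::nat. cis (2 * pi * real k / real ?e)) ` {..<?e}"
      using bij_betw_roots_unity[OF card_pos] that by (auto simp: bij_betw_def)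
    then show ?thesis using s0 w by auto
  qed
  then show ?thesis using that s0 by blast
qed

lemma character_eq_power:
  assumes "character_on S \<chi>"
  obtains l where "\<And>s. s \<in> S \<Longrightarrow> \<chi> s = \<theta> s ^ l"
proof -
  obtain s0 where s0: "s0 \<in> S" "\<And>z. z ^ card S = 1 \<Longrightarrow> \<exists>j. z = \<theta> s0 ^ j" by (rule ex_generator) blast
  obtain l where l: "\<chi> s0 = \<theta> s0 ^ l" using s0(2) character_on_power_card[OF assms s0(1)] by blast
  have "\<chi> s = \<theta> s ^ l" if s: "s \<in> S" for s
  proof -
    obtain j where j: "\<theta> s = \<theta> s0 ^ j" using s0(2) character_on_power_card[OF \<theta>(1) s] by blast
    then have "\<theta> s = \<theta> (s0 [^] j)" "s0 [^] j \<in> S" using character_on_pow[OF \<theta>(1) s0(1)] by auto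
    then have "s = s0 [^] j" using \<theta>(2) s by (meson inj_onD)
    then show ?thesis using character_on_pow[OF assms s0(1)] l j by (simp add: power_mult[symmetric] mult.commute)
  qed
  then show ?thesis using that by blast
qed

text \<open>Writing \<mu> and \<chi> as powers \<open>l\<close> and \<open>c\<close> of \<theta>,
  the twist is the power \<open>l + k * c\<close>. By the choice of \<open>k\<close>, an element on
  which it is trivial is killed by both exponents.\<close>

lemma ex_twist2:
  assumes "character_on S \<mu>" "character_on S \<chi>"
  obtains k :: nat where "\<And>s. s \<in> S \<Longrightarrow> \<mu> s * \<chi> s ^ k = 1 \<Longrightarrow> \<mu> s = 1 \<and> \<chi> s = 1"
proof -
  obtain l where l: "\<And>s. s \<in> S \<Longrightarrow> \<mu> s = \<theta> s ^ l" by (rule character_eq_power[OF assms(1)]) blast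
  obtain c where c: "\<And>s. s \<in> S \<Longrightarrow> \<chi> s = \<theta> s ^ c" by (rule character_eq_power[OF assms(2)]) blast
  obtain k where k: "gcd (l + k * c) (card S) dvd gcd l c" using ex_gcd_shift_dvd[OF card_pos] by blast
  have "\<mu> s = 1 \<and> \<chi> s = 1" if s: "s \<in> S" "\<mu> s * \<chi> s ^ k = 1" for s
  proof -
    have "\<theta> s ^ (l + k * c) = 1"
      using s l c by (simp add: power_add power_mult[symmetric] mult.commute)
    then have "\<theta> s ^ gcd (l + k * c) (card S) = 1"
      using character_on_power_card[OF \<theta>(1) s(1)] power_gcd_eq_1 by blast
    moreover obtain m n where "l = gcd (l + k * c) (card S) * m" "c = gcd (l + k * c) (card S) * n"
      using k by (meson dvdE dvd_trans gcd_dvd1 gcd_dvd2)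
    ultimately show ?thesis using l c s by (metis power_mult power_one)
  qed
  then show ?thesis using that by blast
qed

text \<open>The characters are handled one at a time, the partially twisted \<mu> taking the place
  of \<mu> in the next application of \<open>ex_twist2\<close>.\<close>

lemma ex_twist:
  assumes "finite J" "character_on S \<mu>" "S \<subseteq> T" "\<And>j. j \<in> J \<Longrightarrow> character_on T (\<chi> j)"
  shows "\<exists>\<psi>. character_on T \<psi> \<and> (\<forall>s\<in>S. \<mu> s * \<psi> s = 1 \<longrightarrow> \<mu> s = 1 \<and> (\<forall>j\<in>J. \<chi> j s = 1))"
  using assms
proof (induction J rule: finite_induct)
  case empty
  then show ?case by (intro exI[of _ "\<lambda>_. 1"]) (auto simp: character_on_def)
next
  case (insert i J)
  then obtain \<psi> where \<psi>: "character_on T \<psi>"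
    "\<And>s. s \<in> S \<Longrightarrow> \<mu> s * \<psi> s = 1 \<Longrightarrow> \<mu> s = 1 \<and> (\<forall>j\<in>J. \<chi> j s = 1)" by auto
  have twisted: "character_on S (\<lambda>s. \<mu> s * \<psi> s)"
    using insert.prems \<psi>(1) by (intro character_on_mult) (auto intro: character_on_mono)
  have i: "character_on T (\<chi> i)" "character_on S (\<chi> i)"
    using insert.prems by (auto intro: character_on_mono)
  obtain k :: nat where k: "\<And>s. s \<in> S \<Longrightarrow> \<mu> s * \<psi> s * \<chi> i s ^ k = 1 \<Longrightarrow> \<mu> s * \<psi> s = 1 \<and> \<chi> i s = 1"
    by (rule ex_twist2[OF twisted i(2)]) blast
  have "character_on T (\<lambda>s. \<psi> s * \<chi> i s ^ k)"
    by (intro character_on_mult character_on_power \<psi> i)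
  moreover have "\<mu> s = 1 \<and> (\<forall>j\<in>insert i J. \<chi> j s = 1)" if "s \<in> S" "\<mu> s * (\<psi> s * \<chi> i s ^ k) = 1" for s
    using k[OF that(1)] \<psi>(2)[OF that(1)] that(2) by (auto simp: mult.assoc)
  ultimately show ?case by blast
qed

end
end

section \<open>Embeddings from two-dimensional representations\<close>

definition matrix_rep :: "('a \<Rightarrow> complex mat) \<Rightarrow> bool" where
  "matrix_rep M \<longleftrightarrow> (\<forall>g\<in>carrier G. M g \<in> carrier_mat 2 2) \<and> M \<one> = 1\<^sub>m 2 \<and>
     (\<forall>g\<in>carrier G. \<forall>h\<in>carrier G. M (g \<otimes> h) = M g * M h)"

lemma embeds_if_faithful_matrix_rep:
  assumes M: "matrix_rep M" and ker: "\<And>g. g \<in> carrier G \<Longrightarrow> M g = 1\<^sub>m 2 \<Longrightarrow> g = \<one>"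
  shows "\<exists>H. subgroup H (GL 2) \<and> G \<cong> (GL 2)\<lparr>carrier := H\<rparr>"
proof -
  have c: "M g \<in> carrier_mat 2 2" if "g \<in> carrier G" for g using M that by (simp add: matrix_rep_def)
  have m: "M (g \<otimes> h) = M g * M h" if "g \<in> carrier G" "h \<in> carrier G" for g h using M that by (simp add: matrix_rep_def)
  have one: "M \<one> = 1\<^sub>m 2" using M by (simp add: matrix_rep_def)
  have inv: "M g * M (inv g) = 1\<^sub>m 2 \<and> M (inv g) * M g = 1\<^sub>m 2" if "g \<in> carrier G" for g
    using that m[of g "inv g"] m[of "inv g" g] one by simp
  have gl: "M g \<in> carrier (GL 2)" if g: "g \<in> carrier G" for g
    using c[OF g] c[OF inv_closed[OF g]] inv[OF g]
    by (auto simp: GL_def units_of_def Units_def ring_mat_def)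
  interpret R: ring "ring_mat TYPE(complex) 2 ()" by (rule ring_mat)
  interpret GL: group "GL 2" unfolding GL_def by (rule R.units_group)
  have hom: "M \<in> hom G (GL 2)"
    using gl m by (auto simp: hom_def GL_def units_of_def ring_mat_def)
  then interpret M: group_hom G "GL 2" M by unfold_locales
  have "inj_on M (carrier G)"
    by (rule M.inj_on_one_iff[THEN iffD2]) (use ker in \<open>auto simp: GL_def units_of_def ring_mat_def\<close>)
  moreover have "subgroup (M ` carrier G) (GL 2)" by (rule M.img_is_subgroup)
  ultimately show ?thesis using hom
    by (intro exI[of _ "M ` carrier G"]) (auto simp: is_iso_def iso_def hom_def bij_betw_def)
qed

text \<open>Only elements acting as scalars obstruct faithfulness, and on those, which form a cyclic group
  as witnessed by \<open>\<theta>\<close>, a suitable product of the characters \<open>\<chi> j\<close> repairs it.\<close>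

lemma embeds_if_faithful_up_to_characters:
  assumes fin: "finite (carrier G)" and M: "matrix_rep M"
    and J: "finite J" "\<And>j. j \<in> J \<Longrightarrow> character_on (carrier G) (\<chi> j)"
    and S: "S = {g \<in> carrier G. \<exists>l. M g = l \<cdot>\<^sub>m 1\<^sub>m 2}"
    and \<theta>: "character_on S \<theta>" "inj_on \<theta> S"
    and ker: "\<And>g. g \<in> carrier G \<Longrightarrow> M g = 1\<^sub>m 2 \<Longrightarrow> (\<And>j. j \<in> J \<Longrightarrow> \<chi> j g = 1) \<Longrightarrow> g = \<one>"
  shows "\<exists>H. subgroup H (GL 2) \<and> G \<cong> (GL 2)\<lparr>carrier := H\<rparr>"
proof -
  have c: "M g \<in> carrier_mat 2 2" if "g \<in> carrier G" for g using M that by (simp add: matrix_rep_def)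
  have m: "M (g \<otimes> h) = M g * M h" if "g \<in> carrier G" "h \<in> carrier G" for g h using M that by (simp add: matrix_rep_def)
  have one: "M \<one> = 1\<^sub>m 2" using M by (simp add: matrix_rep_def)
  define \<mu> where "\<mu> g = M g $$ (0, 0)" for g
  have scal: "M g = \<mu> g \<cdot>\<^sub>m 1\<^sub>m 2" if g: "g \<in> S" for g
  proof -
    obtain l where "M g = l \<cdot>\<^sub>m 1\<^sub>m 2" using g by (auto simp: S)
    then show ?thesis by (simp add: \<mu>_def)
  qed
  have ss: "x \<cdot>\<^sub>m (y \<cdot>\<^sub>m A) = (x * y) \<cdot>\<^sub>m A" for x y and A :: "complex mat"
    by (intro eq_matI) auto
  have sm: "(x \<cdot>\<^sub>m 1\<^sub>m 2) * (y \<cdot>\<^sub>m 1\<^sub>m 2) = (x * y) \<cdot>\<^sub>m (1\<^sub>m 2 :: complex mat)" for x y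
    using mult_smult_assoc_mat[of "1\<^sub>m 2" 2 2 "y \<cdot>\<^sub>m 1\<^sub>m 2" 2 x] ss by simp
  have sub: "S \<subseteq> carrier G" by (auto simp: S)
  have closed_S: "s \<otimes> t \<in> S" if "s \<in> S" "t \<in> S" for s t
  proof -
    have "M (s \<otimes> t) = (\<mu> s * \<mu> t) \<cdot>\<^sub>m 1\<^sub>m 2" using m sub that scal sm by (metis subsetD)
    then show ?thesis unfolding S using that sub by auto
  qed
  have one_S: "\<one> \<in> S"
  proof -
    have "M \<one> = 1 \<cdot>\<^sub>m 1\<^sub>m 2" using one by auto
    then show ?thesis unfolding S by blast
  qed
  have finS: "finite S" using sub fin finite_subset by blast
  have \<mu>_mult: "\<mu> (s \<otimes> t) = \<mu> s * \<mu> t" if "s \<in> S" "t \<in> S" for s t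
  proof -
    have "M (s \<otimes> t) = (\<mu> s * \<mu> t) \<cdot>\<^sub>m 1\<^sub>m 2" using m sub that scal sm by (metis subsetD)
    then show ?thesis by (simp add: \<mu>_def)
  qed
  have \<mu>_nz: "\<mu> s \<noteq> 0" if "s \<in> S" for s
  proof
    assume z: "\<mu> s = 0"
    have s: "s \<in> carrier G" using that sub by blast
    have "M s = 0\<^sub>m 2 2" using scal[OF that] z by auto
    then have "M (s \<otimes> inv s) = 0\<^sub>m 2 2" using m[OF s inv_closed[OF s]] c[OF inv_closed[OF s]] by simp
    then have "1\<^sub>m 2 = (0\<^sub>m 2 2 :: complex mat)" using s one by simp
    then have "(1\<^sub>m 2 :: complex mat) $$ (0,0) = 0\<^sub>m 2 2 $$ (0,0)" by simp
    then show False by simp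
  qed
  have "character_on S \<mu>" using \<mu>_mult \<mu>_nz by (auto simp: character_on_def)
  then obtain \<psi> where \<psi>: "character_on (carrier G) \<psi>"
    "\<And>s. s \<in> S \<Longrightarrow> \<mu> s * \<psi> s = 1 \<Longrightarrow> \<mu> s = 1 \<and> (\<forall>j\<in>J. \<chi> j s = 1)"
    using ex_twist[of S \<theta> J \<mu> "carrier G" \<chi>, OF sub finS one_S closed_S \<theta> J(1) _ sub J(2)] by blast
  define R where "R g = \<psi> g \<cdot>\<^sub>m M g" for g
  have "matrix_rep R"
    unfolding matrix_rep_def
  proof (intro conjI ballI)
    show "R \<one> = 1\<^sub>m 2" using one character_on_one[OF \<psi>(1)] by (auto simp: R_def)
    fix g h assume g: "g \<in> carrier G" and h: "h \<in> carrier G"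
    show "R g \<in> carrier_mat 2 2" using c[OF g] by (simp add: R_def)
    show "R (g \<otimes> h) = R g * R h"
      using \<psi>(1) m[OF g h] mult_smult_assoc_mat[OF c[OF g], of "\<psi> h \<cdot>\<^sub>m M h" 2 "\<psi> g"]
        mult_smult_distrib[OF c[OF g] c[OF h], of "\<psi> h"] c[OF h] g h
      by (simp add: R_def character_on_def ss)
  qed
  moreover have "g = \<one>" if g: "g \<in> carrier G" and Rg: "R g = 1\<^sub>m 2" for g
  proof -
    have nz: "\<psi> g \<noteq> 0" using \<psi>(1) g by (simp add: character_on_def)
    \<comment> \<open>If the twist is trivial at \<open>g\<close>, then \<open>M g\<close> is
      scalar, so \<open>g\<close> lies in the set \<open>S\<close> for which \<psi> was
      chosen.\<close>
    have "M g = inverse (\<psi> g) \<cdot>\<^sub>m R g" using nz by (auto simp: R_def)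
    then have Mg: "M g = inverse (\<psi> g) \<cdot>\<^sub>m 1\<^sub>m 2" using Rg by simp
    then have gS: "g \<in> S" using g S by auto
    have "\<mu> g = inverse (\<psi> g)" using Mg by (simp add: \<mu>_def)
    then have "\<mu> g * \<psi> g = 1" using nz by simp
    then have "\<mu> g = 1" "\<forall>j\<in>J. \<chi> j g = 1" using \<psi>(2)[OF gS] by auto
    moreover have "M g = 1\<^sub>m 2" using scal[OF gS] \<open>\<mu> g = 1\<close> by auto
    ultimately show ?thesis using ker[OF g] by blast
  qed
  ultimately show ?thesis by (rule embeds_if_faithful_matrix_rep)
qed

end

section \<open>Binary forms\<close>

text \<open>The homogenisation of degree \<open>e\<close> of a univariate polynomial, evaluated at \<open>(a, b)\<close>.\<close>

definition form :: "(complex \<Rightarrow> 'r::comm_ring_1) \<Rightarrow> nat \<Rightarrow> complex poly \<Rightarrow> 'r \<Rightarrow> 'r \<Rightarrow> 'r" where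
  "form \<kappa> e N a b = (\<Sum>i\<le>e. \<kappa> (coeff N i) * a ^ i * b ^ (e - i))"

lemma form_scale: "form \<kappa> e N (g * a) (g * b) = g ^ e * form \<kappa> e N a b"
proof -
  have "(g * a) ^ i * (g * b) ^ (e - i) = g ^ e * (a ^ i * b ^ (e - i))" if "i \<le> e" for i
  proof -
    have "g ^ e = g ^ i * g ^ (e - i)" using that by (simp flip: power_add)
    then show ?thesis by (simp add: power_mult_distrib mult_ac)
  qed
  then show ?thesis
    unfolding form_def sum_distrib_left by (intro sum.cong refl) (simp add: mult.assoc mult.left_commute[of "g ^ e"])
qed

lemma form_hom:
  assumes "comm_ring_hom \<phi>"
  shows "\<phi> (form \<kappa> e N a b) = form (\<lambda>c. \<phi> (\<kappa> c)) e N (\<phi> a) (\<phi> b)"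
proof -
  interpret comm_ring_hom \<phi> by fact
  show ?thesis by (simp add: form_def hom_sum hom_mult hom_power)
qed

context
  fixes \<kappa> :: "complex \<Rightarrow> 'r::comm_ring_1"
  assumes k: "comm_ring_hom \<kappa>"
begin

interpretation k: comm_ring_hom \<kappa> by (rule k)

lemma form_0 [simp]: "form \<kappa> e 0 a b = 0"
  by (simp add: form_def)

lemma form_add: "form \<kappa> e (N + M) a b = form \<kappa> e N a b + form \<kappa> e M a b"
  by (simp add: form_def k.hom_add algebra_simps sum.distrib)

lemma form_smult: "form \<kappa> e (smult c N) a b = \<kappa> c * form \<kappa> e N a b"
  by (simp add: form_def k.hom_mult sum_distrib_left mult_ac)

lemma form_pCons: "form \<kappa> (Suc e) (pCons c N) a b = \<kappa> c * b ^ Suc e + a * form \<kappa> e N a b"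
  unfolding form_def sum.atMost_Suc_shift by (simp add: sum_distrib_left mult_ac)

lemma form_const: "form \<kappa> e [:c:] a b = \<kappa> c * b ^ e"
  by (cases e) (simp_all only: form_pCons form_0, simp_all add: form_def)

text \<open>\<open>form\<close> cuts off coefficients above its degree. The bound prevents such a
  loss, and the surplus degree becomes a power of \<open>b\<close>.\<close>

lemma form_raise: "degree N \<le> e \<Longrightarrow> form \<kappa> (j + e) N a b = b ^ j * form \<kappa> e N a b"
proof -
  assume d: "degree N \<le> e"
  have "form \<kappa> (j + e) N a b = (\<Sum>i\<le>e. \<kappa> (coeff N i) * a ^ i * b ^ (j + e - i))"
    unfolding form_def using d by (intro sum.mono_neutral_right) (auto simp: coeff_eq_0)
  also have "\<dots> = b ^ j * form \<kappa> e N a b"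
    unfolding form_def sum_distrib_left
  proof (intro sum.cong refl)
    fix i assume "i \<in> {..e}"
    then have "b ^ (j + e - i) = b ^ j * b ^ (e - i)" by (simp flip: power_add)
    then show "\<kappa> (coeff N i) * a ^ i * b ^ (j + e - i) = b ^ j * (\<kappa> (coeff N i) * a ^ i * b ^ (e - i))"
      by (simp add: mult_ac)
  qed
  finally show ?thesis .
qed

lemma form_mult:
  "degree N \<le> e \<Longrightarrow> degree M \<le> e' \<Longrightarrow> form \<kappa> (e + e') (N * M) a b = form \<kappa> e N a b * form \<kappa> e' M a b"
proof (induction N arbitrary: e)
  case (pCons c N)
  show ?case
  proof (cases e)
    case 0
    then have "N = 0" using pCons.prems by (auto split: if_splits)
    then show ?thesis using 0 by (simp add: form_smult form_const)
  next
    case (Suc e1)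
    have "degree N \<le> e1" using pCons.prems Suc by (cases "N = 0") auto
    then have IH: "form \<kappa> (e1 + e') (N * M) a b = form \<kappa> e1 N a b * form \<kappa> e' M a b"
      using pCons.IH pCons.prems by blast
    have "form \<kappa> (e + e') (pCons c N * M) a b
        = \<kappa> c * form \<kappa> (Suc e1 + e') M a b + form \<kappa> (Suc (e1 + e')) (pCons 0 (N * M)) a b"
      using Suc by (simp add: form_add form_smult)
    also have "\<dots> = \<kappa> c * (b ^ Suc e1 * form \<kappa> e' M a b) + a * (form \<kappa> e1 N a b * form \<kappa> e' M a b)"
      unfolding form_raise[OF pCons.prems(2)] form_pCons IH by simp
    finally show ?thesis using Suc by (simp add: form_pCons algebra_simps)
  qed
qed simp

end

lemma form_eq_poly:
  fixes \<kappa> :: "complex \<Rightarrow> 'f::field"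
  assumes k: "comm_ring_hom \<kappa>" and b: "b \<noteq> 0"
  shows "degree N \<le> e \<Longrightarrow> form \<kappa> e N a b = b ^ e * poly (map_poly \<kappa> N) (a / b)"
proof (induction N arbitrary: e)
  case 0
  then show ?case using form_0[OF k] by simp
next
  case (pCons c N)
  interpret k: comm_ring_hom \<kappa> by (rule k)
  show ?case
  proof (cases e)
    case 0
    then have "N = 0" using pCons.prems by (auto split: if_splits)
    then show ?thesis using 0 form_const[OF k] by (simp add: map_poly_pCons)
  next
    case (Suc e1)
    have "degree N \<le> e1" using pCons.prems Suc by (cases "N = 0") auto
    then show ?thesis using pCons.IH[of e1] Suc b form_pCons[OF k]
      by (simp add: map_poly_pCons algebra_simps)
  qed
qed

lemma prime_not_dvd_Const: "prime_elem p \<Longrightarrow> c \<noteq> 0 \<Longrightarrow> \<not> p dvd Const c"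
  using dvd_trans[OF _ Const_dvd_1, of p c] by (auto simp: prime_elem_def)

text \<open>Over the complex numbers a binary form splits into linear factors: those belonging to
  the roots of \<open>D\<close>, and powers of \<open>b\<close> when the degree of \<open>D\<close>
  is below \<open>e\<close>.\<close>

lemma prime_dvd_form_cases:
  assumes p: "prime_elem (p :: cpoly)"
  shows "D \<noteq> 0 \<Longrightarrow> degree D \<le> e \<Longrightarrow> p dvd form Const e D a b \<Longrightarrow>
    p dvd b \<or> (\<exists>c. poly D c = 0 \<and> p dvd a - Const c * b)"
proof (induction "degree D" arbitrary: D e)
  case 0
  then obtain c where c: "D = [:c:]" using degree_eq_zeroE by metis
  then have "p dvd Const c * b ^ e" using 0 form_const[OF Const_hom] by simp
  moreover have "\<not> p dvd Const c"
    using prime_not_dvd_Const[OF p] 0 c by auto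
  ultimately show ?case using p prime_elem_dvd_multD prime_elem_dvd_power by blast
next
  case (Suc n)
  then have "\<not> constant (poly D)" by (simp add: constant_degree)
  then obtain c where c: "poly D c = 0" using fundamental_theorem_of_algebra by blast
  then obtain D' where D': "D = [:- c, 1:] * D'" by (auto simp: poly_eq_0_iff_dvd elim: dvdE)
  have "D' \<noteq> 0" using D' Suc.prems by auto
  then have deg: "degree D = Suc (degree D')" unfolding D' by (subst degree_mult_eq) auto
  obtain e' where e': "e = Suc e'" using deg Suc.prems by (cases e) auto
  have "form Const (1 + e') ([:- c, 1:] * D') a b = form Const 1 [:- c, 1:] a b * form Const e' D' a b"
    using deg e' Suc.prems by (intro form_mult Const_hom) auto
  moreover have "form Const 1 [:- c, 1:] a b = a - Const c * b"
    using form_pCons[OF Const_hom, of 0 "- c" "[:1:]" a b] form_const[OF Const_hom, of 0 1 a b]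
    by (simp add: Const.hom_uminus)
  ultimately have "p dvd (a - Const c * b) * form Const e' D' a b" using Suc.prems D' e' by simp
  then have "p dvd a - Const c * b \<or> p dvd form Const e' D' a b" using p prime_elem_dvd_multD by blast
  then show ?case
  proof
    assume "p dvd form Const e' D' a b"
    then have "p dvd b \<or> (\<exists>c. poly D' c = 0 \<and> p dvd a - Const c * b)"
      using Suc.hyps \<open>D' \<noteq> 0\<close> deg e' Suc.prems by auto
    then show ?thesis by (auto simp: D')
  qed (use c in blast)
qed

text \<open>A common prime divides \<open>b\<close> or some \<open>a - Const c * b\<close>. The
  first is excluded by a form containing \<open>a ^ e\<close>, the second by a form with nonzero
  value at \<open>c\<close>, both times because \<open>a\<close> and \<open>b\<close> share no
  prime.\<close>

lemma forms_no_common_prime: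
  fixes a b :: cpoly
  assumes cop: "\<And>p. prime_elem p \<Longrightarrow> \<not> (p dvd a \<and> p dvd b)"
    and deg: "\<And>u. u \<in> F \<Longrightarrow> degree (N u) \<le> e" and top: "v \<in> F" "degree (N v) = e"
    and w: "w \<in> F" "N w \<noteq> 0" and roots: "\<And>c. \<exists>u\<in>F. poly (N u) c \<noteq> 0"
    and p: "prime_elem p"
  shows "\<exists>u\<in>F. \<not> p dvd form Const e (N u) a b"
proof (rule ccontr)
  assume "\<not> ?thesis"
  then have all: "\<And>u. u \<in> F \<Longrightarrow> p dvd form Const e (N u) a b" by blast
  have unit: "\<not> p dvd Const c" if "c \<noteq> 0" for c
    using prime_not_dvd_Const[OF p that] .
  have b: "\<not> p dvd b"
  proof
    assume pb: "p dvd b"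
    have "N v \<noteq> 0 \<or> e = 0" using top by auto
    have "form Const e (N v) a b = Const (coeff (N v) e) * a ^ e + (\<Sum>i<e. Const (coeff (N v) i) * a ^ i * b ^ (e - i))"
      unfolding form_def by (simp flip: lessThan_Suc_atMost)
    moreover have "p dvd (\<Sum>i<e. Const (coeff (N v) i) * a ^ i * b ^ (e - i))"
    proof (rule dvd_sum)
      fix i assume "i \<in> {..<e}"
      then have "p dvd b ^ (e - i)" using pb by (simp add: dvd_power_same dvd_trans[OF pb] )
      then show "p dvd Const (coeff (N v) i) * a ^ i * b ^ (e - i)" by simp
    qed
    ultimately have "p dvd Const (coeff (N v) e) * a ^ e" using all[OF top(1)] by (simp add: dvd_add_left_iff)
    moreover have "\<not> p dvd a" using cop[OF p] pb by blast
    ultimately have "p dvd Const (coeff (N v) e)" using p prime_elem_dvd_multD prime_elem_dvd_power by blast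
    \<comment> \<open>The coefficient of degree \<open>e\<close> can vanish only if
      \<open>N v = 0\<close>, and then \<open>e = 0\<close>; the nonzero \<open>N w\<close> gives a
      nonzero constant form.\<close>
    then have v0: "coeff (N v) e = 0" using unit by blast
    then have "N v = 0" using top(2) leading_coeff_0_iff[of "N v"] by simp
    then have "e = 0" using top(2) by simp
    then have "degree (N w) = 0" using deg[OF w(1)] by simp
    then obtain c where c: "N w = [:c:]" "c \<noteq> 0" using w(2) by (metis degree_eq_zeroE pCons_0_0)
    then have "p dvd Const c" using all[OF w(1)] \<open>e = 0\<close> form_const[OF Const_hom, of 0 c a b] by simp
    then show False using unit c by blast
  qed
  then obtain c where c: "p dvd a - Const c * b"
    using prime_dvd_form_cases[OF p w(2) deg[OF w(1)] all[OF w(1)]] by blast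
  obtain u where u: "u \<in> F" "poly (N u) c \<noteq> 0" using roots by blast
  \<comment> \<open>Modulo \<open>a - Const c * b\<close> the form of \<open>N u\<close> is the
    value of \<open>N u\<close> at \<open>c\<close> times \<open>b ^ e\<close>.\<close>
  define S where "S = synthetic_div (N u) c"
  have Nu: "N u = [:poly (N u) c:] + [:- c, 1:] * S"
    using synthetic_div_correct'[of c "N u"] by (simp add: S_def algebra_simps)
  have "p dvd form Const e ([:- c, 1:] * S) a b"
  proof (cases e)
    case 0
    then have "degree (N u) = 0" using deg[OF u(1)] by simp
    then have "S = 0" unfolding S_def by (simp add: synthetic_div_eq_0_iff)
    then show ?thesis using form_0[OF Const_hom] by simp
  next
    case (Suc e')
    have "degree S \<le> e'" using deg[OF u(1)] Suc by (simp add: S_def degree_synthetic_div)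
    then have "form Const (1 + e') ([:- c, 1:] * S) a b = form Const 1 [:- c, 1:] a b * form Const e' S a b"
      by (intro form_mult Const_hom) auto
    moreover have "form Const 1 [:- c, 1:] a b = a - Const c * b"
      using form_pCons[OF Const_hom, of 0 "- c" "[:1:]" a b] form_const[OF Const_hom, of 0 1 a b]
      by (simp add: Const.hom_uminus)
    ultimately show ?thesis using c Suc by simp
  qed
  moreover have "form Const e (N u) a b = Const (poly (N u) c) * b ^ e + form Const e ([:- c, 1:] * S) a b"
    by (subst Nu) (simp only: form_add[OF Const_hom] form_const[OF Const_hom])
  ultimately have "p dvd Const (poly (N u) c) * b ^ e" using all[OF u(1)] by (simp add: dvd_add_left_iff)
  then have "p dvd Const (poly (N u) c) \<or> p dvd b" using p prime_elem_dvd_multD prime_elem_dvd_power by blast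
  then show False using unit u b by blast
qed

section \<open>Factors of homogeneous polynomials\<close>

lemma X_power_decomp:
  fixes U :: "'a::idom poly"
  assumes "U \<noteq> 0"
  obtains k H where "U = [:0, 1:] ^ k * H" "poly H 0 \<noteq> 0"
proof -
  obtain H where H: "U = [:- 0, 1:] ^ order 0 U * H" "\<not> [:- 0, 1:] dvd H"
    using order_decomp[OF assms, of 0] by blast
  show ?thesis by (rule that[of "order 0 U" H]) (use H in \<open>auto simp: poly_eq_0_iff_dvd\<close>)
qed

text \<open>Lowest and highest degrees both add up in a product; since they coincide for the
  product, they coincide for each factor.\<close>

lemma factor_of_monom:
  fixes P Q :: "'a::idom poly"
  assumes "P * Q = monom c k" "c \<noteq> 0"
  shows "\<exists>i a. P = monom a i"
proof -
  have nz: "P \<noteq> 0" "Q \<noteq> 0" using assms by auto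
  obtain i P' where P: "P = [:0, 1:] ^ i * P'" "poly P' 0 \<noteq> 0" using X_power_decomp[OF nz(1)] by blast
  obtain j Q' where Q: "Q = [:0, 1:] ^ j * Q'" "poly Q' 0 \<noteq> 0" using X_power_decomp[OF nz(2)] by blast
  have nz': "P' \<noteq> 0" "Q' \<noteq> 0" using P Q nz by auto
  have PQ: "P * Q = monom 1 (i + j) * (P' * Q')"
    unfolding P Q by (simp add: monom_altdef power_add mult_ac)
  have "coeff (P * Q) (i + j) = poly P' 0 * poly Q' 0"
    unfolding PQ by (simp add: coeff_monom_mult coeff_mult_0 poly_0_coeff_0)
  then have "coeff (P * Q) (i + j) \<noteq> 0" using P Q by simp
  then have "k = i + j" using assms(1) by (auto split: if_splits)
  moreover have "degree (P * Q) = i + j + (degree P' + degree Q')"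
    unfolding PQ using nz' by (simp add: degree_mult_eq degree_monom_eq)
  moreover have "degree (P * Q) = k" using assms by (simp add: degree_monom_eq)
  ultimately have "degree P' = 0" by simp
  then obtain a where "P' = [:a:]" using degree_eq_zeroE by blast
  then have "P = monom a i" using P by (simp add: monom_altdef)
  then show ?thesis by blast
qed

lemma homog_id_factor:
  assumes "homog (\<lambda>x. x) k (f * g)" "f * g \<noteq> 0"
  shows "\<exists>i. homog (\<lambda>x. x) i f"
proof -
  have "graded (\<lambda>x. x) f * graded (\<lambda>x. x) g = monom (f * g) k"
    using assms(1) by (simp add: homog_def graded.hom_mult)
  then obtain i a where ia: "graded (\<lambda>x. x) f = monom a i" using factor_of_monom assms(2) by blast
  have "poly (graded (\<lambda>x. x) f) 1 = pull (scaling (\<lambda>x. x) 1) f"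
    using poly_graded[OF polyop_id, of f 1] by simp
  also have "\<dots> = f"
    by (rule cpoly_eqI) (simp add: ev_pull polyop_scaling[OF polyop_id] scaling_def)
  finally have "a = f" using ia by (simp add: poly_monom)
  then show ?thesis using ia by (auto simp: homog_def)
qed

lemma homog_unique: "homog \<pi> k f \<Longrightarrow> homog \<pi> l f \<Longrightarrow> f \<noteq> 0 \<Longrightarrow> k = l"
  by (metis homog_def coeff_monom)

text \<open>Scaling by 0 evaluates at the origin and, in degree 0, changes nothing.\<close>

lemma homog_id_0:
  assumes "homog (\<lambda>x. x) 0 f"
  shows "f = Const (ev (\<lambda>_. 0) f)"
proof (rule cpoly_eqI)
  fix x
  have "pull (scaling (\<lambda>x. x) 0) f = f" using assms homog_iff[OF polyop_id] by simp
  moreover have "ev x (pull (scaling (\<lambda>x. x) 0) f) = ev (\<lambda>_. 0) f"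
    by (simp add: ev_pull polyop_scaling[OF polyop_id] scaling_def)
  ultimately show "ev x f = ev x (Const (ev (\<lambda>_. 0) f))" by simp
qed

section \<open>Restriction to a line\<close>

lemma pderiv_line: "poly (pderiv (line x v f)) t = dd f (\<lambda>i. x i + t * v i) v"
proof (induction f rule: cpoly_induct)
  case (mult f g)
  then show ?case by (simp add: line.hom_mult pderiv_mult dd_mult poly_line algebra_simps)
qed (simp_all add: line.hom_add pderiv_add dd_add pderiv_pCons)

lemma X_power_pderiv:
  "pderiv ([:0, 1:] ^ Suc k * H) = [:0, 1:] ^ k * (of_nat (Suc k) * H + [:0, 1:] * pderiv H)"
  for H :: "'a::idom poly"
proof -
  have "pderiv ([:0, 1:] ^ Suc k) = of_nat (Suc k) * ([:0, 1:] ^ k :: 'a poly)"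
    by (simp add: pderiv_power_Suc pderiv_pCons of_nat_poly del: power_Suc of_nat_Suc)
  then show ?thesis unfolding pderiv_mult by (simp only: power_Suc algebra_simps)
qed

text \<open>If the Wronskian vanished, \<open>U = G - c * F\<close>, with \<open>c\<close> making
  \<open>U\<close> vanish at 0, would satisfy \<open>F * U' = U * F'\<close>. Differentiation lowers
  the order of \<open>U\<close> at 0, but \<open>F\<close> does not vanish there.\<close>

lemma wronskian_nonzero:
  fixes F G :: "complex poly"
  assumes F: "poly F 0 \<noteq> 0" and G: "poly F 0 * poly G 1 \<noteq> poly G 0 * poly F 1"
  shows "F * pderiv G - G * pderiv F \<noteq> 0"
proof
  assume eq: "F * pderiv G - G * pderiv F = 0"
  define c where "c = poly G 0 / poly F 0"
  define U where "U = G - smult c F"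
  have "poly U 1 \<noteq> 0" using F G by (simp add: U_def c_def field_simps)
  then have "U \<noteq> 0" by auto
  obtain k H where U: "U = [:0, 1:] ^ k * H" "poly H 0 \<noteq> 0" by (rule X_power_decomp[OF \<open>U \<noteq> 0\<close>])
  have "poly U 0 = 0" using F by (simp add: U_def c_def)
  then have "k \<noteq> 0" using U by (cases k) auto
  then obtain l where k: "k = Suc l" by (cases k) auto
  have "F * pderiv U = U * pderiv F"
    using eq by (simp add: U_def pderiv_diff pderiv_smult algebra_simps)
  then have "[:0, 1:] ^ l * (F * (of_nat (Suc l) * H + [:0, 1:] * pderiv H)) = [:0, 1:] ^ l * ([:0, 1:] * H * pderiv F)"
    unfolding U(1) k X_power_pderiv by (simp add: mult_ac)
  then have "F * (of_nat (Suc l) * H + [:0, 1:] * pderiv H) = [:0, 1:] * H * pderiv F"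
    by (subst (asm) mult_cancel_left) auto
  from arg_cong[OF this, of "\<lambda>P. poly P 0"] show False using F U(2) by (simp del: of_nat_Suc add: of_nat_poly)
qed

text \<open>The line joins a point where \<open>R * f\<close> is nonzero to one where the pair of
  values of \<open>f\<close> and \<open>g\<close> is not proportional to the first. On it the
  Wronskian of the restrictions is nonzero, so a general point will do.\<close>

lemma ex_base_point:
  assumes "R \<noteq> 0" "f \<noteq> 0" "\<And>c. g \<noteq> Const c * f"
  obtains p q where "ev p R \<noteq> 0" "ev p f \<noteq> 0" "ev p f * dd g p q - ev p g * dd f p q \<noteq> 0"
proof -
  have "R * f \<noteq> 0" using assms by simp
  then obtain x where x: "ev x (R * f) \<noteq> 0" using cpoly_eqI[of "R * f" 0] by auto
  have fx: "ev x f \<noteq> 0" using x by (simp add: ev.hom_mult)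
  have "\<exists>y. ev y g * ev x f \<noteq> ev x g * ev y f"
  proof (rule ccontr)
    assume "\<not> ?thesis"
    then have "g = Const (ev x g / ev x f) * f"
      using fx by (intro cpoly_eqI) (simp add: ev.hom_mult field_simps)
    then show False using assms(3) by blast
  qed
  then obtain y where y: "ev y g * ev x f \<noteq> ev x g * ev y f" by blast
  define q where "q i = y i - x i" for i
  have at0: "poly (line x q h) 0 = ev x h" and at1: "poly (line x q h) 1 = ev y h" for h
    by (simp_all add: poly_line q_def)
  have "line x q f * pderiv (line x q g) - line x q g * pderiv (line x q f) \<noteq> 0"
    using fx y by (intro wronskian_nonzero) (simp_all add: at0 at1 mult.commute)
  moreover have "line x q (R * f) \<noteq> 0" using x at0[of "R * f"] by auto
  ultimately have "(line x q f * pderiv (line x q g) - line x q g * pderiv (line x q f)) * line x q (R * f) \<noteq> 0" by simp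
  then obtain t where "poly ((line x q f * pderiv (line x q g) - line x q g * pderiv (line x q f)) * line x q (R * f)) t \<noteq> 0"
    using poly_all_0_iff_0 by blast
  then show ?thesis
    by (intro that[of "\<lambda>i. x i + t * q i" q]) (auto simp: poly_line pderiv_line ev.hom_mult)
qed

text \<open>Restriction to the points \<open>p + t * q + s * v\<close>, with \<open>t\<close> as
  inner and \<open>s\<close> as outer variable; setting the outer variable to 0 gives the line
  through \<open>p\<close> along \<open>q\<close>.\<close>

definition plane :: "cfun \<Rightarrow> cfun \<Rightarrow> cfun \<Rightarrow> cpoly \<Rightarrow> complex poly poly" where
  "plane p q v = subst (\<lambda>c. [:[:c:]:]) (\<lambda>i. [:[:p i, q i:], [:v i:]:])"

lemma const2_hom: "comm_ring_hom (\<lambda>c::complex. [:[:c:]:])"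
  by (rule comm_ring_hom_comp[OF const_poly_hom const_poly_hom])

interpretation plane: comm_ring_hom "plane p q v"
  unfolding plane_def by (intro subst_hom const2_hom)

lemma plane_Const [simp]: "plane p q v (Const c) = [:[:c:]:]" and plane_Var [simp]: "plane p q v (Var i) = [:[:p i, q i:], [:v i:]:]"
  by (simp_all add: plane_def subst_Const subst_Var const2_hom)

lemma poly_plane_0: "poly (plane p q v f) 0 = line p q f"
  by (rule comm_ring_hom_eqI[OF comm_ring_hom_comp[OF comm_ring_hom_poly plane.comm_ring_hom_axioms]
        line.comm_ring_hom_axioms]) simp_all

definition ev2 :: "complex poly poly \<Rightarrow> complex \<Rightarrow> complex \<Rightarrow> complex" where
  "ev2 P s t = poly (poly P [:s:]) t"

lemma ev2_simps [simp]:
  "ev2 (P + Q) s t = ev2 P s t + ev2 Q s t" "ev2 (P - Q) s t = ev2 P s t - ev2 Q s t"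
  "ev2 (P * Q) s t = ev2 P s t * ev2 Q s t" "ev2 0 s t = 0"
  by (simp_all add: ev2_def)

lemma ev2_eqI: "(\<And>s t. ev2 P s t = ev2 Q s t) \<Longrightarrow> P = Q"
proof (rule ccontr)
  assume eq: "\<And>s t. ev2 P s t = ev2 Q s t" and "P \<noteq> Q"
  then have "finite {z. poly (P - Q) z = 0}" by (intro poly_roots_finite) simp
  moreover have "poly P [:s:] = poly Q [:s:]" for s
    using eq[of s] by (simp add: ev2_def poly_eq_poly_eq_iff[symmetric] fun_eq_iff)
  then have "range (\<lambda>s. [:s:]) \<subseteq> {z. poly (P - Q) z = 0}" by auto
  ultimately have "finite (range (\<lambda>s::complex. [:s:]))" by (rule rev_finite_subset)
  then have "finite (UNIV :: complex set)" by (rule finite_imageD) (simp add: inj_def)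
  then show False by (simp add: infinite_UNIV_char_0)
qed

definition pderiv_inner :: "complex poly poly \<Rightarrow> complex poly poly" where
  "pderiv_inner = map_poly pderiv"

lemma coeff_pderiv_inner: "coeff (pderiv_inner P) k = pderiv (coeff P k)"
  by (simp add: pderiv_inner_def coeff_map_poly)

lemma pderiv_inner_add: "pderiv_inner (P + Q) = pderiv_inner P + pderiv_inner Q"
  by (intro poly_eqI) (simp add: coeff_pderiv_inner pderiv_add)

lemma pderiv_inner_mult: "pderiv_inner (P * Q) = pderiv_inner P * Q + P * pderiv_inner Q"
proof (rule poly_eqI)
  fix n
  have "pderiv (\<Sum>i\<in>A. coeff P i * coeff Q (n - i)) =
      (\<Sum>i\<in>A. pderiv (coeff P i) * coeff Q (n - i)) + (\<Sum>i\<in>A. coeff P i * pderiv (coeff Q (n - i)))" for A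
    by (induction A rule: infinite_finite_induct) (simp_all add: pderiv_add pderiv_mult ac_simps)
  then show "coeff (pderiv_inner (P * Q)) n = coeff (pderiv_inner P * Q + P * pderiv_inner Q) n"
    by (simp only: coeff_pderiv_inner coeff_add coeff_mult)
qed

lemma ev2_plane:
  "ev2 (plane p q v f) s t = ev (\<lambda>i. p i + t * q i + s * v i) f"
  "ev2 (pderiv (plane p q v f)) s t = dd f (\<lambda>i. p i + t * q i + s * v i) v"
  "ev2 (pderiv_inner (plane p q v f)) s t = dd f (\<lambda>i. p i + t * q i + s * v i) q"
proof -
  show 1: "ev2 (plane p q v f) s t = ev (\<lambda>i. p i + t * q i + s * v i) f" for f
    by (induction f rule: cpoly_induct)
      (simp_all add: plane.hom_add plane.hom_mult ev.hom_add ev.hom_mult, simp_all add: ev2_def)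
  show "ev2 (pderiv (plane p q v f)) s t = dd f (\<lambda>i. p i + t * q i + s * v i) v"
    by (induction f rule: cpoly_induct)
      (simp_all add: plane.hom_add plane.hom_mult pderiv_add pderiv_mult dd_add dd_mult 1, simp_all add: ev2_def pderiv_pCons)
  show "ev2 (pderiv_inner (plane p q v f)) s t = dd f (\<lambda>i. p i + t * q i + s * v i) q"
    by (induction f rule: cpoly_induct)
      (simp_all add: plane.hom_add plane.hom_mult pderiv_inner_add pderiv_inner_mult dd_add dd_mult 1,
       simp_all add: ev2_def pderiv_inner_def map_poly_pCons pderiv_pCons)
qed

text \<open>Rearranges the dependence relation once the derivatives of \<open>Y * Z * H\<close> are
  inserted, where \<open>Y\<close> will be the outer variable and \<open>Z\<close> a power of it. A
  plain ring identity keeps this algebra apart from the polynomials.\<close>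

lemma bracket_cancel:
  fixes Y Z :: "'a::comm_ring_1"
  assumes "At * (b * (Z * (n * H + Y * H1)) - (Y * Z * H) * b1) = As * (b * (Y * Z * H2) - (Y * Z * H) * b2)"
  shows "Z * (At * (b * (n * H + Y * H1) - Y * H * b1)) = Z * (As * Y * (b * H2 - H * b2))"
  using assms by (simp add: algebra_simps)

text \<open>If \<open>u / b\<close> is functionally dependent on \<open>g / f\<close>, and \<open>g / f\<close> is not stationary along the
  line, then \<open>u\<close> vanishes as soon as it does so on the line: compare orders of vanishing in the
  direction transversal to the line.\<close>

lemma zero_if_zero_on_line:
  assumes dep: "\<And>x v w. (ev x f * dd g x v - ev x g * dd f x v) * (ev x b * dd u x w - ev x u * dd b x w)
      = (ev x f * dd g x w - ev x g * dd f x w) * (ev x b * dd u x v - ev x u * dd b x v)"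
    and p: "ev p f * dd g p q - ev p g * dd f p q \<noteq> 0" "ev p b \<noteq> 0"
    and line: "line p q u = 0"
  shows "u = 0"
proof -
  have "plane p q v u = 0" for v
  proof (rule ccontr)
    let ?pl = "plane p q v"
    assume "?pl u \<noteq> 0"
    then obtain k H where U: "?pl u = [:0, 1:] ^ k * H" "poly H 0 \<noteq> 0" using X_power_decomp by blast
    have "poly (?pl u) 0 = 0" using line by (simp add: poly_plane_0)
    then have "k \<noteq> 0" using U by (cases k) auto
    then obtain l where k: "k = Suc l" by (cases k) auto
    let ?X = "[:0, 1:] :: complex poly poly"
    define At where "At = ?pl f * pderiv_inner (?pl g) - ?pl g * pderiv_inner (?pl f)"
    define As where "As = ?pl f * pderiv (?pl g) - ?pl g * pderiv (?pl f)"
    have E: "At * (?pl b * pderiv (?pl u) - ?pl u * pderiv (?pl b))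
        = As * (?pl b * pderiv_inner (?pl u) - ?pl u * pderiv_inner (?pl b))"
      by (rule ev2_eqI) (simp add: At_def As_def ev2_plane dep)
    have D1: "pderiv (?pl u) = ?X ^ l * (of_nat (Suc l) * H + ?X * pderiv H)"
      unfolding U(1) k by (rule X_power_pderiv)
    have D2: "pderiv_inner (?pl u) = ?X ^ Suc l * pderiv_inner H"
    proof -
      have "?X ^ j = monom 1 j" for j by (simp add: monom_altdef)
      then show ?thesis unfolding U(1) k
        by (intro poly_eqI) (simp add: coeff_pderiv_inner coeff_monom_mult del: power_Suc)
    qed
    have "?X ^ l * (At * (?pl b * (of_nat (Suc l) * H + ?X * pderiv H) - ?X * H * pderiv (?pl b)))
        = ?X ^ l * (As * ?X * (?pl b * pderiv_inner H - H * pderiv_inner (?pl b)))"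
      by (rule bracket_cancel) (use E D1 D2 U(1) k in \<open>simp only: power_Suc\<close>)
    then have "At * (?pl b * (of_nat (Suc l) * H + ?X * pderiv H) - ?X * H * pderiv (?pl b))
        = As * ?X * (?pl b * pderiv_inner H - H * pderiv_inner (?pl b))"
      by (subst (asm) mult_cancel_left) auto
    \<comment> \<open>At \<open>s = 0\<close> only the term with the factor \<open>Suc l\<close> is
      left, a product of nonzero polynomials on the line.\<close>
    from arg_cong[OF this, of "\<lambda>P. poly P 0"]
    have "poly At 0 * (line p q b * (of_nat (Suc l) * poly H 0)) = 0"
      by (simp add: poly_plane_0 of_nat_poly del: of_nat_Suc)
    moreover have "ev2 At 0 0 = ev p f * dd g p q - ev p g * dd f p q" by (simp add: At_def ev2_plane)
    then have "poly (poly At 0) 0 \<noteq> 0" using p(1) by (simp add: ev2_def)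
    then have "poly At 0 \<noteq> 0" by (metis poly_0)
    moreover have "poly (line p q b) 0 \<noteq> 0" using p(2) by (simp add: poly_line)
    then have "line p q b \<noteq> 0" by auto
    moreover have "of_nat (Suc l) \<noteq> (0 :: complex poly)" by (simp del: of_nat_Suc)
    ultimately show False using U(2) by (simp del: of_nat_Suc)
  qed
  \<comment> \<open>With \<open>v\<close> pointing from \<open>p\<close> to \<open>x\<close>, the
    parameters \<open>s = 1\<close>, \<open>t = 0\<close> reach an arbitrary
    \<open>x\<close>.\<close>
  then have "ev2 (plane p q (\<lambda>i. x i - p i) u) 1 0 = 0" for x by (simp add: ev2_def)
  then show ?thesis by (intro cpoly_eqI) (simp add: ev2_plane)
qed

section \<open>The pencil defined by a homogeneous family\<close>

text \<open>\<open>f2 / f1\<close> is the reference function of multidegree zero, \<open>p\<close>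
  and \<open>q\<close> describe a line along which it varies, and \<open>bs V\<close> is the
  denominator used for \<open>V\<close>, nonzero at \<open>p\<close>.\<close>

locale pencil = poly_action +
  fixes \<V> :: "cpoly set set" and dg :: "cpoly set \<Rightarrow> nat" and bs :: "cpoly set \<Rightarrow> cpoly"
    and V0 :: "cpoly set" and f1 f2 :: cpoly and p q :: cfun
  assumes fam: "family \<V>"
    and hom: "V \<in> \<V> \<Longrightarrow> f \<in> V \<Longrightarrow> homog (\<lambda>x. x) (dg V) f"
    and bs: "V \<in> \<V> \<Longrightarrow> bs V \<in> V" "V \<in> \<V> \<Longrightarrow> ev p (bs V) \<noteq> 0"
    and V0: "V0 \<in> \<V>" "f1 \<in> V0" "f2 \<in> V0"
    and f1p: "ev p f1 \<noteq> 0"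
    and transversal: "ev p f1 * dd f2 p q - ev p f2 * dd f1 p q \<noteq> 0"
begin

lemma V_scale: "V \<in> \<V> \<Longrightarrow> f \<in> V \<Longrightarrow> Const c * f \<in> V"
  using family_subspace[OF fam] by (auto simp: cpoly.subspace_def)

lemma f1_nz: "f1 \<noteq> 0"
  using f1p by auto

lemma dg_V0_pos: "dg V0 > 0"
proof (rule ccontr)
  assume "\<not> dg V0 > 0"
  then have "f1 = Const (ev (\<lambda>_. 0) f1)" "f2 = Const (ev (\<lambda>_. 0) f2)"
    using hom[OF V0(1,2)] hom[OF V0(1,3)] homog_id_0 by auto
  then have "dd f1 p q = 0" "dd f2 p q = 0" by (metis dd_Const)+
  then show False using transversal by simp
qed

text \<open>The differentials of \<open>f2 / f1\<close> and \<open>u / b\<close> are linearly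
  dependent at every point, with denominators cleared.\<close>

definition dep :: "cpoly \<Rightarrow> cpoly \<Rightarrow> bool" where
  "dep b u \<longleftrightarrow> (\<forall>x v w. (ev x f1 * dd f2 x v - ev x f2 * dd f1 x v) * (ev x b * dd u x w - ev x u * dd b x w)
      = (ev x f1 * dd f2 x w - ev x f2 * dd f1 x w) * (ev x b * dd u x v - ev x u * dd b x v))"

text \<open>With the point \<open>x\<close> itself as first direction, Euler's identity evaluates
  the first column of the minors. Eliminating between the minor with \<open>u\<close> and the one
  with \<open>b\<close> leaves the relation multiplied by \<open>f1\<close> and its degree.\<close>

lemma dep_family:
  assumes V: "V \<in> \<V>" "b \<in> V" "u \<in> V"
  shows "dep b u"
proof -
  define E where "E x v w = (ev x f1 * dd f2 x v - ev x f2 * dd f1 x v) * (ev x b * dd u x w - ev x u * dd b x w)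
      - (ev x f1 * dd f2 x w - ev x f2 * dd f1 x w) * (ev x b * dd u x v - ev x u * dd b x v)" for x v w
  have euler: "dd f x x = of_nat (dg W) * ev x f" if "W \<in> \<V>" "f \<in> W" for W f x
    using dd_homog[OF polyop_id hom[OF that]] .
  have jac0: "jac f g h x u v w = 0" if "f \<in> V \<union> V0" "g \<in> V \<union> V0" "h \<in> V \<union> V0" for f g h x u v w
    using family_jac[OF fam, of f g h] that V V0 by blast
  have E1: "of_nat (dg V0) * ev x f1 * E x v w = 0" for x v w
  proof -
    have "ev x f1 * ev x b * jac f1 f2 u x x v w - ev x f1 * ev x u * jac f1 f2 b x x v w = 0"
      using jac0 V V0 by simp
    then show ?thesis
      unfolding jac_def E_def euler[OF V0(1,2)] euler[OF V0(1,3)] euler[OF V(1,2)] euler[OF V(1,3)]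
      by (simp add: algebra_simps)
  qed
  have "E x v w = 0" for x v w
  proof -
    \<comment> \<open>The factor \<open>f1\<close> is cancelled along the line from \<open>x\<close>
      to \<open>p\<close>, on which it is not identically zero.\<close>
    define z where "z i = p i - x i" for i
    define P where "P = (line x z f1) * smult (of_nat (dg V0)) 1"
    have "\<exists>Q. \<forall>t. poly Q t = E (\<lambda>i. x i + t * z i) v w"
    proof -
      have ex: "\<exists>Q. \<forall>t. poly Q t = dd f (\<lambda>i. x i + t * z i) v" for f v
      proof (intro exI allI)
        fix t
        show "poly (poly (pderiv (plane x z v f)) 0) t = dd f (\<lambda>i. x i + t * z i) v"
          using ev2_plane(2)[of x z v f 0 t] by (simp add: ev2_def)
      qed
      obtain d where d: "\<And>f v t. poly (d f v) t = dd f (\<lambda>i. x i + t * z i) v" using ex by metis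
      show ?thesis unfolding E_def
        by (intro exI[of _ "(line x z f1 * d f2 v - line x z f2 * d f1 v) * (line x z b * d u w - line x z u * d b w)
            - (line x z f1 * d f2 w - line x z f2 * d f1 w) * (line x z b * d u v - line x z u * d b v)"])
          (simp add: d poly_line)
    qed
    then obtain Q where Q: "\<And>t. poly Q t = E (\<lambda>i. x i + t * z i) v w" by blast
    have "poly (line x z f1 * Q) t = 0" for t
      using E1[of "\<lambda>i. x i + t * z i" v w] dg_V0_pos by (auto simp: Q poly_line)
    then have "line x z f1 * Q = 0" using poly_all_0_iff_0 by blast
    moreover have "poly (line x z f1) 1 \<noteq> 0" using f1p by (simp add: poly_line z_def)
    ultimately have "Q = 0" by auto
    then show ?thesis using Q[of 0] by simp
  qed
  then show ?thesis unfolding dep_def E_def by (metis eq_iff_diff_eq_0)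
qed

text \<open>The multigraded pieces of the algebra generated by the family.\<close>

inductive piece :: "cpoly set multiset \<Rightarrow> cpoly \<Rightarrow> bool" where
  piece_Const: "piece {#} (Const c)"
| piece_mult_member: "piece \<nu> u \<Longrightarrow> V \<in> \<V> \<Longrightarrow> f \<in> V \<Longrightarrow> piece (add_mset V \<nu>) (u * f)"
| piece_add: "piece \<nu> u \<Longrightarrow> piece \<nu> w \<Longrightarrow> piece \<nu> (u + w)"

definition base :: "cpoly set multiset \<Rightarrow> cpoly" where
  "base \<nu> = (\<Prod>V\<in>#\<nu>. bs V)"

lemma piece_scale: "piece \<nu> u \<Longrightarrow> piece \<nu> (Const c * u)"
proof (induction rule: piece.induct)
  case (piece_Const d)
  then show ?case using piece.piece_Const[of "c * d"] by (simp add: Const.hom_mult)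
next
  case (piece_mult_member \<nu> u V f)
  then show ?case using piece.piece_mult_member[of \<nu> "Const c * u" V f] by (simp add: mult.assoc)
next
  case (piece_add \<nu> u w)
  then show ?case using piece.piece_add[of \<nu> "Const c * u" "Const c * w"] by (simp add: distrib_left)
qed

lemma piece_mult: "piece \<nu> u \<Longrightarrow> piece \<mu> w \<Longrightarrow> piece (\<nu> + \<mu>) (u * w)"
proof (induction arbitrary: rule: piece.induct)
  case (piece_Const d)
  then show ?case using piece_scale by simp
next
  case (piece_mult_member \<nu> u V f)
  then show ?case using piece.piece_mult_member[of "\<nu> + \<mu>" "u * w" V f] by (simp add: mult_ac)
next
  case (piece_add \<nu> u w')
  then show ?case using piece.piece_add by (simp add: distrib_right)
qed

lemma piece_diff: "piece \<nu> u \<Longrightarrow> piece \<nu> w \<Longrightarrow> piece \<nu> (u - w)"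
  using piece_add[of \<nu> u "Const (-1) * w"] piece_scale[of \<nu> w "-1"] by (simp add: Const.hom_uminus)

lemma piece_member: "V \<in> \<V> \<Longrightarrow> f \<in> V \<Longrightarrow> piece {#V#} f"
  using piece_mult_member[OF piece_Const[of 1], of V f] by simp

lemma piece_one: "piece {#} 1"
  using piece_Const[of 1] by simp

lemma piece_power: "piece \<nu> u \<Longrightarrow> piece (repeat_mset k \<nu>) (u ^ k)"
  by (induction k) (auto simp: piece_one piece_mult)

lemma piece_zero: "piece \<nu> u \<Longrightarrow> piece \<nu> 0"
  using piece_scale[of \<nu> u 0] by simp

lemma piece_sum: "finite A \<Longrightarrow> (\<And>i. i \<in> A \<Longrightarrow> piece \<nu> (h i)) \<Longrightarrow> piece \<nu> 0 \<Longrightarrow> piece \<nu> (sum h A)"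
  by (induction A rule: finite_induct) (auto intro: piece_add)

lemma piece_act: "piece \<nu> u \<Longrightarrow> g \<in> carrier G \<Longrightarrow> piece \<nu> (act g u)"
  by (induction rule: piece.induct) (auto simp: pull.hom_mult pull.hom_add intro: piece.intros family_stable[OF fam])

lemma piece_homog: "piece \<nu> u \<Longrightarrow> homog (\<lambda>x. x) (\<Sum>V\<in>#\<nu>. dg V) u"
proof (induction rule: piece.induct)
  case (piece_Const c)
  then show ?case by (simp add: homog_Const)
next
  case (piece_mult_member \<nu> u V f)
  then show ?case using homog_mult[OF piece_mult_member.IH hom[of V f]] by (simp add: add.commute)
next
  case (piece_add \<nu> u w)
  then show ?case by (simp add: homog_add)
qed

text \<open>By the Leibniz rule the relation passes to products of quotients \<open>f / bs V\<close>
  and to sums over a common denominator.\<close>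

lemma dep_piece: "piece \<nu> u \<Longrightarrow> dep (base \<nu>) u"
proof (induction rule: piece.induct)
  case (piece_Const c)
  have "dd 1 x v = 0" for x v using dd_Const[of 1] by simp
  then show ?case by (simp add: dep_def base_def)
next
  case (piece_mult_member \<nu> u V f)
  have d: "dep (bs V) f" using dep_family piece_mult_member.hyps bs by blast
  show ?case
    unfolding dep_def
  proof (intro allI)
    fix x v w
    define a where "a z = ev x f1 * dd f2 x z - ev x f2 * dd f1 x z" for z
    define b where "b z = ev x (base \<nu>) * dd u x z - ev x u * dd (base \<nu>) x z" for z
    define c where "c z = ev x (bs V) * dd f x z - ev x f * dd (bs V) x z" for z
    have B: "base (add_mset V \<nu>) = bs V * base \<nu>" by (simp add: base_def)
    have e: "ev x (base (add_mset V \<nu>)) * dd (u * f) x z - ev x (u * f) * dd (base (add_mset V \<nu>)) x z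
        = ev x (bs V) * ev x f * b z + ev x (base \<nu>) * ev x u * c z" for z
      unfolding B b_def c_def by (simp add: dd_mult ev.hom_mult algebra_simps)
    have "a v * b w = a w * b v" "a v * c w = a w * c v"
      using piece_mult_member.IH d by (auto simp: dep_def a_def b_def c_def)
    moreover have "a y * (r * b z + s * c z) = r * (a y * b z) + s * (a y * c z)" for y z r s
      by (simp add: algebra_simps)
    ultimately have "a v * (ev x (bs V) * ev x f * b w + ev x (base \<nu>) * ev x u * c w)
        = a w * (ev x (bs V) * ev x f * b v + ev x (base \<nu>) * ev x u * c v)"
      by presburger
    then show "(ev x f1 * dd f2 x v - ev x f2 * dd f1 x v) * (ev x (base (add_mset V \<nu>)) * dd (u * f) x w - ev x (u * f) * dd (base (add_mset V \<nu>)) x w)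
      = (ev x f1 * dd f2 x w - ev x f2 * dd f1 x w) * (ev x (base (add_mset V \<nu>)) * dd (u * f) x v - ev x (u * f) * dd (base (add_mset V \<nu>)) x v)"
      unfolding e a_def by simp
  qed
next
  case (piece_add \<nu> u w)
  show ?case
    unfolding dep_def
  proof (intro allI)
    fix x v w'
    have e: "ev x (base \<nu>) * dd (u + w) x z - ev x (u + w) * dd (base \<nu>) x z
        = (ev x (base \<nu>) * dd u x z - ev x u * dd (base \<nu>) x z) + (ev x (base \<nu>) * dd w x z - ev x w * dd (base \<nu>) x z)" for z
      by (simp add: dd_add ev.hom_add algebra_simps)
    show "(ev x f1 * dd f2 x v - ev x f2 * dd f1 x v) * (ev x (base \<nu>) * dd (u + w) x w' - ev x (u + w) * dd (base \<nu>) x w')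
        = (ev x f1 * dd f2 x w' - ev x f2 * dd f1 x w') * (ev x (base \<nu>) * dd (u + w) x v - ev x (u + w) * dd (base \<nu>) x v)"
      unfolding e distrib_left using piece_add.IH by (simp add: dep_def)
  qed
qed

abbreviation rs :: "cpoly \<Rightarrow> complex poly" where
  "rs \<equiv> line p q"

lemma base_p: "set_mset \<nu> \<subseteq> \<V> \<Longrightarrow> ev p (base \<nu>) \<noteq> 0"
  by (induction \<nu>) (auto simp: base_def ev.hom_mult bs)

lemma piece_members: "piece \<nu> u \<Longrightarrow> set_mset \<nu> \<subseteq> \<V>"
  by (induction rule: piece.induct) auto

text \<open>Over \<open>base \<nu>\<close>, elements of a piece depend functionally on
  \<open>f2 / f1\<close>; an identity on the single line therefore holds everywhere.\<close>

lemma rs_inj: "piece \<nu> u \<Longrightarrow> rs u = 0 \<longleftrightarrow> u = 0"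
  using zero_if_zero_on_line[of f1 f2 "base \<nu>" u p q] dep_piece[of \<nu> u] base_p[OF piece_members] transversal
  by (auto simp: dep_def)

lemma rs_eq: "piece \<nu> u \<Longrightarrow> piece \<nu> w \<Longrightarrow> rs u = rs w \<Longrightarrow> u = w"
  using rs_inj[OF piece_diff[of \<nu> u w]] by (simp add: line.hom_minus)

text \<open>Quotients of equal multidegree, realised as rational functions of the parameter of the
  line so that Lueroth's theorem in one variable applies.\<close>

definition fld :: "complex poly fract set" where
  "fld = {to_fract (rs u) / to_fract (rs w) | \<nu> u w. piece \<nu> u \<and> piece \<nu> w \<and> w \<noteq> 0}"

lemma fldI: "piece \<nu> u \<Longrightarrow> piece \<nu> w \<Longrightarrow> w \<noteq> 0 \<Longrightarrow> to_fract (rs u) / to_fract (rs w) \<in> fld"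
  by (auto simp: fld_def)

lemma fract_subfield_fld: "fract_subfield fld"
proof
  show "cfract c \<in> fld" for c
    using fldI[OF piece_Const[of c] piece_one] by (simp flip: one_pCons)
next
  fix x y assume "x \<in> fld" "y \<in> fld"
  then obtain \<nu> u w \<nu>' u' w' where x: "x = to_fract (rs u) / to_fract (rs w)" "piece \<nu> u" "piece \<nu> w" "w \<noteq> 0"
    and y: "y = to_fract (rs u') / to_fract (rs w')" "piece \<nu>' u'" "piece \<nu>' w'" "w' \<noteq> 0"
    unfolding fld_def by blast
  have nz: "rs w \<noteq> 0" "rs w' \<noteq> 0" using rs_inj x y by auto
  have "x + y = to_fract (rs (u * w' + w * u')) / to_fract (rs (w * w'))"
    using nz by (simp add: x(1) y(1) line.hom_add line.hom_mult add_frac_eq mult_ac)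
  moreover have "piece (\<nu> + \<nu>') (u * w' + w * u')" by (intro piece_add piece_mult x y)
  moreover have ww: "piece (\<nu> + \<nu>') (w * w')" "w * w' \<noteq> 0" using x y piece_mult by auto
  ultimately show "x + y \<in> fld" using fldI by metis
  have "x * y = to_fract (rs (u * u')) / to_fract (rs (w * w'))"
    by (simp add: x(1) y(1) line.hom_mult)
  moreover have "piece (\<nu> + \<nu>') (u * u')" by (intro piece_mult x y)
  ultimately show "x * y \<in> fld" using fldI ww by metis
next
  fix x assume "x \<in> fld"
  then obtain \<nu> u w where x: "x = to_fract (rs u) / to_fract (rs w)" "piece \<nu> u" "piece \<nu> w" "w \<noteq> 0"
    unfolding fld_def by blast
  show "inverse x \<in> fld"
  proof (cases "u = 0")
    case True
    then show ?thesis using \<open>x \<in> fld\<close> x(1) by simp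
  next
    case False
    then show ?thesis using fldI[OF x(3,2)] by (simp add: x(1))
  qed
next
  have p12: "piece {#V0#} f1" "piece {#V0#} f2" using piece_member V0 by auto
  show "\<exists>x\<in>fld. \<forall>c. x \<noteq> cfract c"
  proof (intro bexI allI notI)
    show "to_fract (rs f2) / to_fract (rs f1) \<in> fld" by (rule fldI[OF p12(2,1) f1_nz])
    fix c assume "to_fract (rs f2) / to_fract (rs f1) = cfract c"
    moreover have sm: "cfract c * to_fract x = to_fract (smult c x)" for x by (simp flip: to_fract_mult)
    moreover have "rs f1 \<noteq> 0" using rs_inj[OF p12(1)] f1_nz by simp
    ultimately have "to_fract (rs f2) = to_fract (rs (Const c * f1))"
      by (simp add: divide_eq_eq line.hom_mult sm)
    then have "f2 = Const c * f1" using rs_eq[OF p12(2) piece_scale[OF p12(1)]] by simp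
    then show False using transversal by (simp add: dd_Const_mult ev.hom_mult)
  qed
qed

lemma ex_generators:
  obtains \<nu> A B where "piece \<nu> A" "piece \<nu> B" "B \<noteq> 0"
    "\<And>x. x \<in> fld \<Longrightarrow> \<exists>N D. poly (map_poly cfract D) (to_fract (rs A) / to_fract (rs B)) \<noteq> 0 \<and>
      x * poly (map_poly cfract D) (to_fract (rs A) / to_fract (rs B)) = poly (map_poly cfract N) (to_fract (rs A) / to_fract (rs B))"
proof -
  interpret K: fract_subfield fld by (rule fract_subfield_fld)
  obtain a b where ab: "to_fract a / to_fract b \<in> fld"
    "\<And>q. q \<in> fld \<Longrightarrow> \<exists>N D. poly (map_poly cfract D) (to_fract a / to_fract b) \<noteq> 0 \<and>
      q * poly (map_poly cfract D) (to_fract a / to_fract b) = poly (map_poly cfract N) (to_fract a / to_fract b)"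
    by (rule K.lueroth) blast
  then obtain \<nu> A B where "to_fract a / to_fract b = to_fract (rs A) / to_fract (rs B)" "piece \<nu> A" "piece \<nu> B" "B \<noteq> 0"
    unfolding fld_def by blast
  then show ?thesis using that ab(2) by metis
qed

end

lemma map_poly_eval_hom:
  fixes \<kappa> :: "'a::comm_ring_1 \<Rightarrow> 'b::comm_ring_1"
  assumes "comm_ring_hom \<kappa>"
  shows "comm_ring_hom (\<lambda>N. poly (map_poly \<kappa> N) x)"
proof -
  interpret k: comm_ring_hom \<kappa> by fact
  have add: "poly (map_poly \<kappa> (N + M)) x = poly (map_poly \<kappa> N) x + poly (map_poly \<kappa> M) x" for N M
    by (induction N M rule: poly_induct2) (simp_all add: map_poly_pCons k.hom_add algebra_simps)
  have smult: "poly (map_poly \<kappa> (smult c M)) x = \<kappa> c * poly (map_poly \<kappa> M) x" for c M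
    by (induction M) (simp_all add: map_poly_pCons k.hom_mult algebra_simps)
  have mult: "poly (map_poly \<kappa> (N * M)) x = poly (map_poly \<kappa> N) x * poly (map_poly \<kappa> M) x" for N M
    by (induction N) (simp_all add: add smult map_poly_pCons algebra_simps)
  show ?thesis by unfold_locales (simp_all add: add mult)
qed

lemma cfract_hom: "comm_ring_hom cfract"
  by unfold_locales (simp_all flip: to_fract_add to_fract_mult one_pCons)

lemma cpoly_associated: "p dvd q \<Longrightarrow> q dvd p \<Longrightarrow> p \<noteq> 0 \<Longrightarrow> \<exists>c. c \<noteq> 0 \<and> q = Const c * (p :: cpoly)"
proof -
  assume "p dvd q" "q dvd p" and p: "p \<noteq> 0"
  obtain r where r: "q = p * r" using \<open>p dvd q\<close> by (rule dvdE)
  obtain s where s: "p = q * s" using \<open>q dvd p\<close> by (rule dvdE)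
  have "p * (r * s) = p * 1" using r s by (simp flip: mult.assoc)
  then have "r * s = 1" using p by (metis mult_cancel_left)
  then have "r dvd 1" by (rule dvdI[OF sym])
  then obtain c where "c \<noteq> 0" "r = Const c" unfolding cpoly_unit_iff by blast
  then show ?thesis using r by (auto simp: mult.commute)
qed

lemma homog_power: "homog \<pi> k f \<Longrightarrow> homog \<pi> (n * k) (f ^ n)"
  by (induction n) (simp_all add: homog_mult, use homog_Const[of \<pi> 1] in simp)

lemma homog_sum: "(\<And>i. i \<in> A \<Longrightarrow> homog \<pi> k (h i)) \<Longrightarrow> homog \<pi> k (sum h A)"
  by (induction A rule: infinite_finite_induct) (simp_all add: homog_add)

lemma homog_form:
  assumes "homog \<pi> d a" "homog \<pi> d b"
  shows "homog \<pi> (e * d) (form Const e N a b)"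
  unfolding form_def
proof (rule homog_sum)
  fix i assume "i \<in> {..e}"
  then have "i * d + (e - i) * d = e * d" by (simp flip: add_mult_distrib)
  then show "homog \<pi> (e * d) (Const (coeff N i) * a ^ i * b ^ (e - i))"
    using homog_mult[OF homog_Const_mult[OF homog_power[OF assms(1), of i]] homog_power[OF assms(2), of "e - i"], of "coeff N i"]
    by simp
qed

lemma fract_smult: "to_fract (smult c q) = cfract c * to_fract q"
  by (simp flip: to_fract_mult)

context poly_action
begin

lemma prime_act: "g \<in> carrier G \<Longrightarrow> prime_elem f \<Longrightarrow> prime_elem (act g f)"
proof (rule prime_elemI)
  assume g: "g \<in> carrier G" and p: "prime_elem f"
  have dvd: "act g x dvd y \<Longrightarrow> x dvd act (inv g) y" for x y
    using g by (auto simp: pull.hom_mult act_inv' elim!: dvdE)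
  have up: "x dvd act (inv g) y \<Longrightarrow> act g x dvd y" for x y
  proof -
    assume "x dvd act (inv g) y"
    then obtain k where "act (inv g) y = x * k" by (rule dvdE)
    then have "act g (act (inv g) y) = act g x * act g k" by (simp add: pull.hom_mult)
    then show ?thesis by (simp add: act_inv[OF g])
  qed
  show "act g f \<noteq> 0" using p g by (simp add: act_eq_0_iff)
  show "\<not> act g f dvd 1" using dvd[of f 1] p by (auto simp: prime_elem_def)
  fix x y assume "act g f dvd x * y"
  then have "f dvd act (inv g) x * act (inv g) y" using dvd[of f "x * y"] by (simp add: pull.hom_mult)
  then have "f dvd act (inv g) x \<or> f dvd act (inv g) y" using p prime_elem_dvd_multD by blast
  then show "act g f dvd x \<or> act g f dvd y" using up by blast
qed

lemma homog_act: "g \<in> carrier G \<Longrightarrow> homog (\<lambda>x. x) k f \<Longrightarrow> homog (\<lambda>x. x) k (act g f)"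
proof -
  assume g: "g \<in> carrier G" and "homog (\<lambda>x. x) k f"
  then have h: "pull (scaling (\<lambda>x. x) c) f = Const (c ^ k) * f" for c using homog_iff[OF polyop_id] by blast
  have "pull (scaling (\<lambda>x. x) c) (act g f) = act g (pull (scaling (\<lambda>x. x) c) f)" for c
    by (rule cpoly_eqI) (simp add: ev_pull polyop_scaling polyop_id pol[OF g] scaling_commute[OF lin[OF g]])
  then show ?thesis unfolding homog_iff[OF polyop_id] by (simp add: h pull.hom_mult)
qed

end

section \<open>The coprime forms and the two-dimensional representation\<close>

context pencil
begin

context
  fixes \<nu> A B g0 a b
  assumes AB: "piece \<nu> A" "piece \<nu> B" "B \<noteq> 0"
    and gen: "\<And>x. x \<in> fld \<Longrightarrow> \<exists>N D. poly (map_poly cfract D) (to_fract (rs A) / to_fract (rs B)) \<noteq> 0 \<and>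
      x * poly (map_poly cfract D) (to_fract (rs A) / to_fract (rs B)) = poly (map_poly cfract N) (to_fract (rs A) / to_fract (rs B))"
    and ab: "A = g0 * a" "B = g0 * b" "\<And>r. prime_elem r \<Longrightarrow> \<not> (r dvd a \<and> r dvd b)"
begin

definition h :: "complex poly fract" where
  "h = to_fract (rs A) / to_fract (rs B)"

definition hval :: "complex poly \<Rightarrow> complex poly fract" where
  "hval N = poly (map_poly cfract N) h"

lemma hval_hom: "comm_ring_hom hval"
  unfolding hval_def by (rule map_poly_eval_hom[OF cfract_hom])

interpretation hval: comm_ring_hom hval by (rule hval_hom)

lemma hval_linear: "hval [:- c, 1:] = h - cfract c"
proof -
  have "cfract 1 = 1" "cfract (- c) = - cfract c" by (simp_all flip: one_pCons to_fract_uminus)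
  then show ?thesis by (simp add: hval_def map_poly_pCons)
qed

lemma gen_hval: "x \<in> fld \<Longrightarrow> \<exists>N D. hval D \<noteq> 0 \<and> x * hval D = hval N"
  using gen unfolding hval_def h_def by blast

lemma rsB: "rs B \<noteq> 0"
  using rs_inj AB by blast

lemma h_nonconst: "h \<noteq> cfract c"
proof
  assume h: "h = cfract c"
  interpret c: comm_ring_hom cfract by (rule cfract_hom)
  have hval: "hval N = cfract (poly N c)" for N
    unfolding hval_def h by (induction N) (simp_all add: map_poly_pCons c.hom_add c.hom_mult)
  obtain x where x: "x \<in> fld" "\<And>c. x \<noteq> cfract c"
    using fract_subfield.nonconst[OF fract_subfield_fld] by blast
  obtain N D where ND: "hval D \<noteq> 0" "x * hval D = hval N" using gen_hval[OF x(1)] by blast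
  have D: "poly D c \<noteq> 0" using ND(1) hval by auto
  have "cfract (poly N c / poly D c) * cfract (poly D c) = cfract (poly N c)"
    using D by (simp flip: c.hom_mult)
  then have "x * hval D = cfract (poly N c / poly D c) * hval D" using ND(2) hval by simp
  then have "x = cfract (poly N c / poly D c)" using ND(1) by simp
  then show False using x(2) by blast
qed

lemma nonzero: "A \<noteq> 0" "g0 \<noteq> 0" "a \<noteq> 0" "b \<noteq> 0"
proof -
  show "A \<noteq> 0" using h_nonconst[of 0] by (auto simp: h_def)
  then show "g0 \<noteq> 0" "a \<noteq> 0" "b \<noteq> 0" using ab AB by auto
qed

lemma piece_form: "piece (repeat_mset e \<nu>) (form Const e N A B)"
  unfolding form_def
proof (rule piece_sum)
  have t: "piece (repeat_mset e \<nu>) (A ^ i * B ^ (e - i))" if "i \<le> e" for i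
    using piece_mult[OF piece_power[OF AB(1), of i] piece_power[OF AB(2), of "e - i"]] that
    by (simp flip: repeat_mset_distrib)
  show "piece (repeat_mset e \<nu>) (Const (coeff N i) * A ^ i * B ^ (e - i))" if "i \<in> {..e}" for i
    using piece_scale[OF t[of i], of "coeff N i"] that by (simp add: mult.assoc)
  show "piece (repeat_mset e \<nu>) 0" using piece_zero t[of 0] by blast
qed simp

lemma rs_form: "degree N \<le> e \<Longrightarrow> to_fract (rs (form Const e N A B)) = to_fract (rs B) ^ e * hval N"
proof -
  assume d: "degree N \<le> e"
  have "comm_ring_hom (\<lambda>f. to_fract (rs f))"
    by unfold_locales (simp_all add: line.hom_add line.hom_mult)
  from form_hom[OF this, of Const e N A B]
  have "to_fract (rs (form Const e N A B)) = form cfract e N (to_fract (rs A)) (to_fract (rs B))" by simp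
  also have "\<dots> = to_fract (rs B) ^ e * hval N"
    unfolding hval_def h_def using rsB d by (intro form_eq_poly[OF cfract_hom]) auto
  finally show ?thesis .
qed

text \<open>The cleared identity holds on the line, and both of its sides lie in the same piece, so
  it lifts; the common power of \<open>g0\<close> then cancels.\<close>

lemma clear_denominators:
  assumes "piece \<mu> u" "piece \<mu> w" "w \<noteq> 0" "degree N \<le> e" "degree D \<le> e"
    and "to_fract (rs u) / to_fract (rs w) * hval D = hval N"
  shows "u * form Const e D a b = w * form Const e N a b"
proof -
  have w: "rs w \<noteq> 0" using rs_inj assms by blast
  have "to_fract (rs u) * hval D = to_fract (rs w) * hval N"
    using assms(6) w by (simp add: field_simps)
  then have "to_fract (rs (u * form Const e D A B)) = to_fract (rs (w * form Const e N A B))"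
    by (simp add: line.hom_mult rs_form assms(4,5) mult.left_commute)
  then have "u * form Const e D A B = w * form Const e N A B"
    using rs_eq[OF piece_mult[OF assms(1) piece_form] piece_mult[OF assms(2) piece_form]] by simp
  then have "g0 ^ e * (u * form Const e D a b) = g0 ^ e * (w * form Const e N a b)"
    by (simp add: ab(1,2) form_scale mult.left_commute)
  then show ?thesis using nonzero by simp
qed

text \<open>All quotients \<open>u / w\<close> are expressed in the generator over one denominator
  \<open>D\<close> of least degree. Minimality excludes a common root of the numerators, so the
  forms share no prime, and cross multiplication forces the form of \<open>w\<close> to divide
  \<open>w\<close>.\<close>

lemma common_factor:
  assumes F: "finite F" "w \<in> F" "w \<noteq> 0" "\<And>u. u \<in> F \<Longrightarrow> piece \<mu> u"
  obtains G0 e N where "\<And>u. u \<in> F \<Longrightarrow> u = G0 * form Const e (N u) a b"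
    "\<And>r. prime_elem r \<Longrightarrow> \<exists>u\<in>F. \<not> r dvd form Const e (N u) a b"
proof -
  define x where "x u = to_fract (rs u) / to_fract (rs w)" for u
  have rw: "rs w \<noteq> 0" using rs_inj F by blast
  have xw: "x w = 1" using rw by (simp add: x_def)
  define good where "good D \<longleftrightarrow> hval D \<noteq> 0 \<and> (\<forall>u\<in>F. \<exists>N. x u * hval D = hval N)" for D
  have "\<exists>D. good D"
  proof -
    have "\<exists>N D. hval D \<noteq> 0 \<and> x u * hval D = hval N" if "u \<in> F" for u
      using gen_hval[OF fldI[OF F(4)[OF that] F(4)[OF F(2)] F(3)]] by (simp add: x_def)
    then obtain N D where ND: "\<And>u. u \<in> F \<Longrightarrow> hval (D u) \<noteq> 0 \<and> x u * hval (D u) = hval (N u)" by metis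
    have "good (\<Prod>u\<in>F. D u)"
      unfolding good_def
    proof (intro conjI ballI)
      show "hval (\<Prod>u\<in>F. D u) \<noteq> 0" using F(1) ND by (simp add: hval.hom_prod)
      fix u assume u: "u \<in> F"
      have "x u * hval (\<Prod>u\<in>F. D u) = hval (N u * (\<Prod>u\<in>F - {u}. D u))"
        using ND[OF u] by (simp add: prod.remove[OF F(1) u] hval.hom_mult mult.assoc[symmetric])
      then show "\<exists>N. x u * hval (\<Prod>u\<in>F. D u) = hval N" by blast
    qed
    then show ?thesis by blast
  qed
  then obtain D where D: "good D" and min: "\<And>D'. good D' \<Longrightarrow> degree D \<le> degree D'"
    using ex_has_least_nat[of good _ degree] by blast
  obtain N0 where N0: "\<And>u. u \<in> F \<Longrightarrow> x u * hval D = hval (N0 u)" using D unfolding good_def by metis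
  \<comment> \<open>Taking \<open>D\<close> itself as numerator of \<open>w / w\<close> makes a root
    common to all \<open>N u\<close> a root of the denominator too, which minimality can then
    exclude.\<close>
  define N where "N u = (if u = w then D else N0 u)" for u
  have N: "x u * hval D = hval (N u)" if "u \<in> F" for u
    using N0[OF that] by (cases "u = w") (simp_all add: N_def xw)
  have D0: "D \<noteq> 0" using D by (auto simp: good_def)
  define e where "e = Max ((\<lambda>u. degree (N u)) ` F)"
  have deg: "degree (N u) \<le> e" if "u \<in> F" for u
    unfolding e_def using F(1) that by (intro Max_ge) auto
  have "e \<in> (\<lambda>u. degree (N u)) ` F" unfolding e_def using F by (intro Max_in) auto
  then obtain v where v: "v \<in> F" "degree (N v) = e" by auto
  have roots: "\<exists>u\<in>F. poly (N u) c \<noteq> 0" for c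
  proof (rule ccontr)
    assume "\<not> ?thesis"
    then have "\<exists>M. N u = [:- c, 1:] * M" if "u \<in> F" for u
      using that unfolding poly_eq_0_iff_dvd dvd_def by blast
    then obtain M where M: "\<And>u. u \<in> F \<Longrightarrow> N u = [:- c, 1:] * M u" by metis
    have DM: "D = [:- c, 1:] * M w" using M[OF F(2)] by (simp add: N_def)
    have hc: "h - cfract c \<noteq> 0" using h_nonconst[of c] by simp
    have "x u * hval (M w) = hval (M u)" if "u \<in> F" for u
    proof -
      have "(h - cfract c) * (x u * hval (M w)) = (h - cfract c) * hval (M u)"
        using N[OF that] unfolding DM M[OF that] hval.hom_mult hval_linear by (simp add: mult_ac)
      then show ?thesis using hc by (simp only: mult_cancel_left) simp
    qed
    moreover have "hval (M w) \<noteq> 0" using D unfolding good_def DM hval.hom_mult by auto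
    ultimately have "good (M w)" unfolding good_def by blast
    then have "degree D \<le> degree (M w)" by (rule min)
    moreover have "M w \<noteq> 0" using DM D0 by auto
    then have "degree D = Suc (degree (M w))" unfolding DM by (subst degree_mult_eq) auto
    ultimately show False by simp
  qed
  let ?f = "\<lambda>u. form Const e (N u) a b"
  have prime: "\<exists>u\<in>F. \<not> r dvd ?f u" if "prime_elem r" for r
    by (rule forms_no_common_prime[OF ab(3) deg v F(2) _ roots that]) (simp_all add: N_def D0)
  have Nw: "N w = D" by (simp add: N_def)
  have cross: "u * ?f w = w * ?f u" if "u \<in> F" for u
    using clear_denominators[OF F(4)[OF that] F(4)[OF F(2)] F(3) deg[OF that] deg[OF F(2)]] N[OF that]
    by (simp add: Nw x_def)
  have fw: "?f w \<noteq> 0"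
  proof
    assume "?f w = 0"
    then have "form Const e (N w) A B = 0" by (simp add: ab(1,2) form_scale)
    then have "to_fract (rs B) ^ e * hval (N w) = 0" using rs_form[OF deg[OF F(2)]] by simp
    then show False using rsB D by (simp add: Nw good_def)
  qed
  have "?f w dvd w"
  proof (rule dvd_if_no_common_prime[where I = F and m = ?f, OF fw])
    show "?f w dvd w * ?f u" if "u \<in> F" for u using cross[OF that] by (metis dvd_triv_right)
  qed (rule prime)
  then obtain G0 where G0: "w = ?f w * G0" by (rule dvdE)
  have "u = G0 * ?f u" if "u \<in> F" for u
  proof -
    have "?f w * u = w * ?f u" using cross[OF that] by (simp only: mult.commute)
    also have "\<dots> = ?f w * (G0 * ?f u)" by (subst G0) (simp only: mult.assoc)
    finally show ?thesis using fw by simp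
  qed
  from that[OF this prime] show ?thesis .
qed

text \<open>Factors of homogeneous polynomials are homogeneous, and \<open>A\<close>,
  \<open>B\<close> have the same degree. If \<open>a\<close> and \<open>b\<close> had degree 0, the
  generator \<open>h\<close> would be constant.\<close>

lemma ex_degree:
  obtains d where "d > 0" "homog (\<lambda>x. x) d a" "homog (\<lambda>x. x) d b"
proof -
  have A: "homog (\<lambda>x. x) (\<Sum>V\<in>#\<nu>. dg V) (a * g0)" "homog (\<lambda>x. x) (\<Sum>V\<in>#\<nu>. dg V) (g0 * a)"
    and B: "homog (\<lambda>x. x) (\<Sum>V\<in>#\<nu>. dg V) (b * g0)"
    using piece_homog[OF AB(1)] piece_homog[OF AB(2)] ab by (simp_all add: mult.commute)
  obtain i where i: "homog (\<lambda>x. x) i a" using homog_id_factor[OF A(1)] nonzero by auto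
  obtain j where j: "homog (\<lambda>x. x) j b" using homog_id_factor[OF B] nonzero by auto
  obtain l where l: "homog (\<lambda>x. x) l g0" using homog_id_factor[OF A(2)] nonzero by auto
  have "i + l = (\<Sum>V\<in>#\<nu>. dg V)" using homog_unique[OF homog_mult[OF i l] A(1)] nonzero by simp
  moreover have "j + l = (\<Sum>V\<in>#\<nu>. dg V)" using homog_unique[OF homog_mult[OF j l] B] nonzero by simp
  ultimately have ij: "i = j" by simp
  have "i > 0"
  proof (rule ccontr)
    assume "\<not> i > 0"
    then obtain x y where xy: "a = Const x" "b = Const y" using homog_id_0[of a] homog_id_0[of b] i j ij by auto
    then have "y \<noteq> 0" "rs g0 \<noteq> 0" using nonzero rsB ab by (auto simp: line.hom_mult)
    then have "h = cfract x / cfract y" 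
      unfolding h_def unfolding ab xy by (simp add: line.hom_mult fract_smult)
    moreover have "cfract (x / y) * cfract y = cfract x" using \<open>y \<noteq> 0\<close> by (simp flip: to_fract_mult)
    ultimately have "h = cfract (x / y)" using \<open>y \<noteq> 0\<close> by (simp add: divide_eq_eq)
    then show False using h_nonconst by blast
  qed
  then show ?thesis using that i j ij by blast
qed

lemma independent:
  assumes "Const m * a + Const n * b = 0"
  shows "m = 0 \<and> n = 0"
proof -
  have "m = 0"
  proof (rule ccontr)
    assume m: "m \<noteq> 0"
    have "Const (1 / m) * (Const m * a) = a"
      using m by (simp add: mult.assoc[symmetric] flip: Const.hom_mult)
    moreover have "Const m * a = Const (- n) * b" using assms by (simp add: Const.hom_uminus add_eq_0_iff)
    ultimately have "b dvd a" by (metis dvd_mult dvd_triv_right)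
    moreover have "\<not> b dvd 1"
    proof
      assume "b dvd 1"
      then obtain c where "b = Const c" by (auto simp: cpoly_unit_iff)
      moreover obtain d where "d > 0" "homog (\<lambda>x. x) d b" using ex_degree by blast
      ultimately show False using homog_unique[OF homog_Const[of "\<lambda>x. x" c]] nonzero by auto
    qed
    then obtain r where "prime_elem r" "r dvd b" using ex_prime_factor nonzero by blast
    ultimately show False using ab(3) dvd_trans by blast
  qed
  then show ?thesis using assms nonzero by simp
qed

text \<open>The transforms of \<open>A\<close> and \<open>B\<close> lie in the same piece, hence are
  a common factor times forms of one degree \<open>e\<close> in \<open>a\<close>, \<open>b\<close>.
  The pair of forms and the pair \<open>act g a\<close>, \<open>act g b\<close> have the same ratio
  and are both without common primes, so they agree up to a constant; comparing degrees gives
  \<open>e = 1\<close>.\<close>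

lemma act_generators:
  assumes g: "g \<in> carrier G"
  shows "\<exists>m n m' n'. act g a = Const m * a + Const n * b \<and> act g b = Const m' * a + Const n' * b"
proof -
  have "\<And>u. u \<in> {act g A, act g B} \<Longrightarrow> piece \<nu> u" using piece_act[OF _ g] AB by auto
  then obtain G0 e N where N: "\<And>u. u \<in> {act g A, act g B} \<Longrightarrow> u = G0 * form Const e (N u) a b"
    and pr: "\<And>r. prime_elem r \<Longrightarrow> \<exists>u\<in>{act g A, act g B}. \<not> r dvd form Const e (N u) a b"
    using common_factor[of "{act g A, act g B}" "act g B" \<nu>] AB act_eq_0_iff[OF g] by (metis finite.emptyI finite.insertI insertI1 insertI2)
  define N1 where "N1 = form Const e (N (act g A)) a b"
  define N2 where "N2 = form Const e (N (act g B)) a b"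
  have 1: "act g g0 * act g a = G0 * N1" using N[of "act g A"] by (simp add: N1_def ab pull.hom_mult)
  have 2: "act g g0 * act g b = G0 * N2" using N[of "act g B"] by (simp add: N2_def ab pull.hom_mult)
  have nz: "act g g0 \<noteq> 0" "act g a \<noteq> 0" "act g b \<noteq> 0" using nonzero by (simp_all add: act_eq_0_iff[OF g])
  then have nz': "G0 \<noteq> 0" "N1 \<noteq> 0" "N2 \<noteq> 0" using 1 2 by auto
  have "(act g g0 * G0) * (act g a * N2) = (act g g0 * G0) * (act g b * N1)"
    using 1 2 by (metis (no_types, lifting) mult.assoc mult.commute)
  then have cross: "act g a * N2 = act g b * N1" using nz nz' by simp
  have cop: "\<exists>u\<in>{act g a, act g b}. \<not> r dvd u" if "prime_elem r" for r
  proof (rule ccontr)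
    assume "\<not> ?thesis"
    then have "act (inv g) r dvd act (inv g) (act g a)" "act (inv g) r dvd act (inv g) (act g b)"
      by (auto simp: pull.hom_mult elim!: dvdE)
    then have "act (inv g) r dvd a" "act (inv g) r dvd b" by (simp_all add: act_inv'[OF g])
    then show False using ab(3)[OF prime_act[OF inv_closed[OF g] that]] by blast
  qed
  have "act g a dvd N1"
    by (rule dvd_if_no_common_prime[where I = "{act g a, act g b}" and m = "\<lambda>u. u", OF nz(2) _ cop])
      (use cross in \<open>auto simp: mult.commute intro: dvdI[of _ _ N2]\<close>)
  moreover have "N1 dvd act g a"
  proof (rule dvd_if_no_common_prime[where I = "{N1, N2}" and m = "\<lambda>u. u", OF nz'(2)])
    show "N1 dvd act g a * u" if "u \<in> {N1, N2}" for u using that cross by auto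
    show "\<exists>i\<in>{N1, N2}. \<not> r dvd i" if "prime_elem r" for r using pr[OF that] by (auto simp: N1_def N2_def)
  qed
  ultimately obtain c where c: "c \<noteq> 0" "act g a = Const c * N1"
    using cpoly_associated[of N1 "act g a"] nz' by blast
  have "N1 * (Const c * N2) = N1 * act g b" using cross c(2) by (simp add: mult_ac)
  then have c2: "act g b = Const c * N2" using nz' by simp
  obtain d where d: "d > 0" "homog (\<lambda>x. x) d a" "homog (\<lambda>x. x) d b" by (rule ex_degree)
  have "homog (\<lambda>x. x) (e * d) (act g a)"
    unfolding c(2) N1_def by (intro homog_Const_mult homog_form d)
  then have "e * d = d" using homog_unique[OF _ homog_act[OF g d(2)] nz(2)] by blast
  then have e: "e = 1" using d(1) by simp
  have "form Const 1 M a b = Const (coeff M 1) * a + Const (coeff M 0) * b" for M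
    by (simp add: form_def add.commute)
  then show ?thesis unfolding c(2) c2 N1_def N2_def e by (simp add: distrib_left mult.assoc[symmetric] flip: Const.hom_mult) blast
qed

lemma member_form:
  assumes V: "V \<in> \<V>"
  obtains G0 e F N where "G0 \<noteq> 0" "F \<subseteq> V" "\<And>u. u \<in> F \<Longrightarrow> u = G0 * form Const e (N u) a b"
    "\<And>r. prime_elem r \<Longrightarrow> \<exists>u\<in>F. \<not> r dvd form Const e (N u) a b"
    "\<And>f. f \<in> V \<Longrightarrow> \<exists>M. f = G0 * form Const e M a b"
proof -
  obtain F0 where F0: "finite F0" "V \<subseteq> cpoly.span F0" using family_finite_dim[OF fam V] by blast
  obtain F1 where F1: "F1 \<subseteq> V" "cpoly.independent F1" "V \<subseteq> cpoly.span F1"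
    by (rule cpoly.basis_exists[of V]) (rule that)
  have "finite F1" using cpoly.independent_span_bound[OF F0(1) F1(2)] F1(1) F0(2) by blast
  \<comment> \<open>The extra \<open>bs V\<close> is the nonzero element that
    \<open>common_factor\<close> uses as denominator.\<close>
  define F where "F = insert (bs V) F1"
  have F: "finite F" "F \<subseteq> V" "V \<subseteq> cpoly.span F"
    using \<open>finite F1\<close> F1 bs(1)[OF V] cpoly.span_mono[of F1 F] by (auto simp: F_def)
  have bV: "bs V \<noteq> 0" using bs(2)[OF V] by auto
  have pc: "piece {#V#} u" if "u \<in> F" for u using piece_member[OF V] F(2) that by blast
  have bF: "bs V \<in> F" by (simp add: F_def)
  obtain G0 e N where N: "\<And>u. u \<in> F \<Longrightarrow> u = G0 * form Const e (N u) a b"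
    and pr: "\<And>r. prime_elem r \<Longrightarrow> \<exists>u\<in>F. \<not> r dvd form Const e (N u) a b"
    by (rule common_factor[OF F(1) bF bV pc]) blast+
  have G0: "G0 \<noteq> 0"
  proof
    assume "G0 = 0"
    then have "bs V = 0" using N[OF bF] by simp
    with bV show False ..
  qed
  have span: "\<exists>M. f = G0 * form Const e M a b" if "f \<in> V" for f
  proof -
    have "f \<in> cpoly.span F" using F(3) that by blast
    then show ?thesis
    proof (induction rule: cpoly.span_induct_alt)
      case base
      then show ?case by (intro exI[of _ 0]) (simp add: form_0[OF Const_hom])
    next
      case (step c x y)
      then obtain M where M: "y = G0 * form Const e M a b" by blast
      have "Const c * x + y = G0 * form Const e (smult c (N x) + M) a b"
        unfolding form_add[OF Const_hom] form_smult[OF Const_hom]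
        by (subst N[OF step(1)]) (simp add: M algebra_simps)
      then show ?case by blast
    qed
  qed
  show ?thesis by (rule that[OF G0 F(2) N pr span])
qed

text \<open>\<open>G0\<close> is a greatest common divisor of the stable space \<open>V\<close>, so
  each group element maps it to an associate.\<close>

lemma act_scalar_factor:
  assumes V: "V \<in> \<V>" and G0: "G0 \<noteq> 0" "F \<subseteq> V" "\<And>u. u \<in> F \<Longrightarrow> u = G0 * form Const e (N u) a b"
    "\<And>r. prime_elem r \<Longrightarrow> \<exists>u\<in>F. \<not> r dvd form Const e (N u) a b"
    "\<And>f. f \<in> V \<Longrightarrow> \<exists>M. f = G0 * form Const e M a b"
    and g: "g \<in> carrier G"
  shows "\<exists>c. c \<noteq> 0 \<and> act g G0 = Const c * G0"
proof -
  have dvd: "act k G0 dvd G0" if k: "k \<in> carrier G" for k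
  proof (rule dvd_if_no_common_prime[where I = F and m = "\<lambda>u. form Const e (N u) a b"])
    show "act k G0 \<noteq> 0" using G0(1) by (simp add: act_eq_0_iff[OF k])
    fix u assume u: "u \<in> F"
    have "act (inv k) u \<in> V" using u G0(2) family_stable[OF fam V inv_closed[OF k]] by blast
    then obtain M where "act (inv k) u = G0 * form Const e M a b" using G0(5) by blast
    then have "u = act k G0 * act k (form Const e M a b)" using act_inv[OF k, of u] by (simp add: pull.hom_mult)
    then show "act k G0 dvd G0 * form Const e (N u) a b" using G0(3)[OF u] by (metis dvd_triv_left)
  qed (rule G0(4))
  have "act g (act (inv g) G0) dvd act g G0"
    using dvd[OF inv_closed[OF g]] by (auto simp: pull.hom_mult elim!: dvdE)
  then have "G0 dvd act g G0" by (simp add: act_inv[OF g])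
  then show ?thesis using cpoly_associated[OF _ dvd[OF g] G0(1)] by blast
qed

text \<open>\<open>M\<close> is the action on the span of \<open>a\<close> and \<open>b\<close>, and
  \<open>\<chi> V\<close> the action on the common factor of \<open>V\<close>. Where
  \<open>M g\<close> is the scalar \<open>l\<close>, the element acts on \<open>V\<close> by
  \<open>\<chi> V g\<close> times a power of \<open>l\<close>.\<close>

lemma ex_representation_aux:
  shows "\<exists>M \<chi>. matrix_rep M \<and> (\<forall>V\<in>\<V>. character_on (carrier G) (\<chi> V)) \<and>
    (\<forall>g\<in>carrier G. \<forall>V\<in>\<V>. \<forall>l. M g = l \<cdot>\<^sub>m 1\<^sub>m 2 \<longrightarrow> (\<exists>c. \<forall>f\<in>V. act g f = Const c * f)) \<and>
    (\<forall>g\<in>carrier G. M g = 1\<^sub>m 2 \<longrightarrow> (\<forall>V\<in>\<V>. \<chi> V g = 1) \<longrightarrow> g = \<one>)"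
proof -
  obtain m n m' n' where mn: "\<And>g. g \<in> carrier G \<Longrightarrow> act g a = Const (m g) * a + Const (n g) * b \<and>
      act g b = Const (m' g) * a + Const (n' g) * b"
    using act_generators by metis
  \<comment> \<open>The rows hold the coefficients of the images of \<open>a\<close> and
    \<open>b\<close>; this transposed convention compensates for the reversed order in
    \<open>act_act\<close>.\<close>
  define M where "M g = mat_of_rows_list 2 [[m g, n g], [m' g, n' g]]" for g
  have Mc: "M g \<in> carrier_mat 2 2" for g by (auto simp: M_def mat_of_rows_list_def)
  have Mi: "M g $$ (0, 0) = m g" "M g $$ (0, 1) = n g" "M g $$ (1, 0) = m' g" "M g $$ (1, 1) = n' g" for g
    by (simp_all add: M_def mat_of_rows_list_def)
  have uniq: "x = x' \<and> y = y'" if "Const x * a + Const y * b = Const x' * a + Const y' * b" for x y x' y'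
    using independent[of "x - x'" "y - y'"] that by (simp add: Const.hom_minus algebra_simps)
  have eqI: "X = Y" if "X \<in> carrier_mat 2 2" "Y \<in> carrier_mat 2 2" "X $$ (0,0) = Y $$ (0,0)" "X $$ (0,1) = Y $$ (0,1)"
    "X $$ (1,0) = Y $$ (1,0)" "X $$ (1,1) = Y $$ (1,1)" for X Y :: "complex mat"
    using that by (intro eq_matI) (auto simp: less_2_cases_iff)
  have rep: "matrix_rep M"
    unfolding matrix_rep_def
  proof (intro conjI ballI Mc)
    have "Const (m \<one>) * a + Const (n \<one>) * b = Const 1 * a + Const 0 * b"
      "Const (m' \<one>) * a + Const (n' \<one>) * b = Const 0 * a + Const 1 * b"
      using mn[OF one_closed] by (simp_all add: act_one)
    then have "m \<one> = 1 \<and> n \<one> = 0" "m' \<one> = 0 \<and> n' \<one> = 1" using uniq by blast+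
    then show "M \<one> = 1\<^sub>m 2" by (intro eqI Mc) (simp_all add: Mi del: One_nat_def)
    fix g k assume g: "g \<in> carrier G" and k: "k \<in> carrier G"
    have "Const (m (g \<otimes> k)) * a + Const (n (g \<otimes> k)) * b
        = Const (m g * m k + n g * m' k) * a + Const (m g * n k + n g * n' k) * b"
      using mn[OF m_closed[OF g k]] mn[OF g] mn[OF k] act_act[OF k g, of a]
      by (simp add: pull.hom_add pull.hom_mult Const.hom_add Const.hom_mult algebra_simps)
    moreover have "Const (m' (g \<otimes> k)) * a + Const (n' (g \<otimes> k)) * b
        = Const (m' g * m k + n' g * m' k) * a + Const (m' g * n k + n' g * n' k) * b"
      using mn[OF m_closed[OF g k]] mn[OF g] mn[OF k] act_act[OF k g, of b]
      by (simp add: pull.hom_add pull.hom_mult Const.hom_add Const.hom_mult algebra_simps)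
    ultimately have e: "m (g \<otimes> k) = m g * m k + n g * m' k \<and> n (g \<otimes> k) = m g * n k + n g * n' k"
      "m' (g \<otimes> k) = m' g * m k + n' g * m' k \<and> n' (g \<otimes> k) = m' g * n k + n' g * n' k"
      using uniq by blast+
    have prod: "(M g * M k) $$ (i, j) = M g $$ (i, 0) * M k $$ (0, j) + M g $$ (i, 1) * M k $$ (1, j)" if "i < 2" "j < 2" for i j
      using that Mc[of g] Mc[of k] by (simp add: scalar_prod_def numeral_2_eq_2)
    show "M (g \<otimes> k) = M g * M k"
      using e by (intro eqI Mc mult_carrier_mat[OF Mc Mc]) (simp_all add: prod Mi del: One_nat_def)
  qed
  have "\<forall>V\<in>\<V>. \<exists>G0 e \<chi>. G0 \<noteq> 0 \<and> (\<forall>f\<in>V. \<exists>M. f = G0 * form Const e M a b) \<and>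
      (\<forall>g\<in>carrier G. \<chi> g \<noteq> 0 \<and> act g G0 = Const (\<chi> g) * G0)"
  proof
    fix V assume V: "V \<in> \<V>"
    obtain G0 e F N where G0: "G0 \<noteq> 0" "F \<subseteq> V" "\<And>u. u \<in> F \<Longrightarrow> u = G0 * form Const e (N u) a b"
      "\<And>r. prime_elem r \<Longrightarrow> \<exists>u\<in>F. \<not> r dvd form Const e (N u) a b"
      "\<And>f. f \<in> V \<Longrightarrow> \<exists>M. f = G0 * form Const e M a b"
      by (rule member_form[OF V]) blast
    have "\<forall>g\<in>carrier G. \<exists>c. c \<noteq> 0 \<and> act g G0 = Const c * G0"
      using act_scalar_factor[OF V G0] by blast
    then obtain \<chi> where "\<forall>g\<in>carrier G. \<chi> g \<noteq> 0 \<and> act g G0 = Const (\<chi> g) * G0" by metis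
    then show "\<exists>G0 e \<chi>. G0 \<noteq> 0 \<and> (\<forall>f\<in>V. \<exists>M. f = G0 * form Const e M a b) \<and>
      (\<forall>g\<in>carrier G. \<chi> g \<noteq> 0 \<and> act g G0 = Const (\<chi> g) * G0)"
      using G0(1,5) by blast
  qed
  then obtain G0 e \<chi> where G0: "\<And>V. V \<in> \<V> \<Longrightarrow> G0 V \<noteq> 0"
    "\<And>V f. V \<in> \<V> \<Longrightarrow> f \<in> V \<Longrightarrow> \<exists>M. f = G0 V * form Const (e V) M a b"
    "\<And>V g. V \<in> \<V> \<Longrightarrow> g \<in> carrier G \<Longrightarrow> \<chi> V g \<noteq> 0 \<and> act g (G0 V) = Const (\<chi> V g) * G0 V"
    by metis
  have char: "character_on (carrier G) (\<chi> V)" if V: "V \<in> \<V>" for V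
    unfolding character_on_def
  proof (intro conjI ballI)
    fix g k assume g: "g \<in> carrier G" and k: "k \<in> carrier G"
    show "\<chi> V g \<noteq> 0" using G0(3)[OF V g] by blast
    have "Const (\<chi> V (g \<otimes> k)) * G0 V = Const (\<chi> V g * \<chi> V k) * G0 V"
    proof -
      have e: "act x (G0 V) = Const (\<chi> V x) * G0 V" if "x \<in> carrier G" for x using G0(3)[OF V that] by blast
      have "Const (\<chi> V (g \<otimes> k)) * G0 V = act (g \<otimes> k) (G0 V)" by (rule e[OF m_closed[OF g k], symmetric])
      also have "\<dots> = act k (act g (G0 V))" by (rule act_act[OF k g, symmetric])
      also have "\<dots> = Const (\<chi> V g * \<chi> V k) * G0 V"
        by (simp only: e[OF g] e[OF k] pull.hom_mult pull_Const Const.hom_mult mult.assoc)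
      finally show ?thesis .
    qed
    then have "Const (\<chi> V (g \<otimes> k)) = Const (\<chi> V g * \<chi> V k)" using G0(1)[OF V] mult_right_cancel by blast
    then show "\<chi> V (g \<otimes> k) = \<chi> V g * \<chi> V k" by simp
  qed
  have scal: "act g f = Const (\<chi> V g * l ^ e V) * f"
    if g: "g \<in> carrier G" and V: "V \<in> \<V>" and l: "M g = l \<cdot>\<^sub>m 1\<^sub>m 2" and f: "f \<in> V" for g V l f
  proof -
    have "m g = l" "n g = 0" "m' g = 0" "n' g = l" using Mi[of g] l by auto
    then have ga: "act g a = Const l * a" "act g b = Const l * b" using mn[OF g] by auto
    obtain N where N: "f = G0 V * form Const (e V) N a b" using G0(2)[OF V f] by blast
    have "act g (form Const (e V) N a b) = form Const (e V) N (act g a) (act g b)"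
      using form_hom[OF pull.comm_ring_hom_axioms, of "L g" Const "e V" N a b] by simp
    also have "\<dots> = Const (l ^ e V) * form Const (e V) N a b"
      unfolding ga form_scale by (simp add: Const.hom_power)
    finally show ?thesis
      unfolding N pull.hom_mult conjunct2[OF G0(3)[OF V g]] by (simp only: Const.hom_mult mult_ac)
  qed
  have scal': "\<exists>c. \<forall>f\<in>V. act g f = Const c * f"
    if "g \<in> carrier G" "V \<in> \<V>" "M g = l \<cdot>\<^sub>m 1\<^sub>m 2" for g l V
    using scal[OF that] by blast
  have faithful: "g = \<one>"
    if g: "g \<in> carrier G" and 1: "M g = 1\<^sub>m 2" and \<chi>1: "\<And>V. V \<in> \<V> \<Longrightarrow> \<chi> V g = 1" for g
  proof -
    have "M g = 1 \<cdot>\<^sub>m 1\<^sub>m 2" using 1 by auto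
    then have "act g f = f" if "V \<in> \<V>" "f \<in> V" for V f
      using scal[OF g that(1) _ that(2)] \<chi>1[OF that(1)] by simp
    then show "g = \<one>" by (rule family_faithful[OF fam g])
  qed
  show ?thesis
  proof (intro exI[of _ M] exI[of _ \<chi>] conjI ballI allI impI)
    show "matrix_rep M" by (rule rep)
    show "character_on (carrier G) (\<chi> V)" if "V \<in> \<V>" for V by (rule char[OF that])
    show "\<exists>c. \<forall>f\<in>V. act g f = Const c * f" if "g \<in> carrier G" "V \<in> \<V>" "M g = l \<cdot>\<^sub>m 1\<^sub>m 2" for g V l
      by (rule scal'[OF that])
    show "g = \<one>" if "g \<in> carrier G" "M g = 1\<^sub>m 2" "\<forall>V\<in>\<V>. \<chi> V g = 1" for g
      by (rule faithful[OF that(1,2)]) (rule bspec[OF that(3)])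
  qed
qed

end

lemma ex_representation:
  shows "\<exists>M \<chi>. matrix_rep M \<and> (\<forall>V\<in>\<V>. character_on (carrier G) (\<chi> V)) \<and>
    (\<forall>g\<in>carrier G. \<forall>V\<in>\<V>. \<forall>l. M g = l \<cdot>\<^sub>m 1\<^sub>m 2 \<longrightarrow> (\<exists>c. \<forall>f\<in>V. act g f = Const c * f)) \<and>
    (\<forall>g\<in>carrier G. M g = 1\<^sub>m 2 \<longrightarrow> (\<forall>V\<in>\<V>. \<chi> V g = 1) \<longrightarrow> g = \<one>)"
proof -
  obtain \<nu> A B where AB: "piece \<nu> A" "piece \<nu> B" "B \<noteq> 0"
    and gen: "\<And>x. x \<in> fld \<Longrightarrow> \<exists>N D. poly (map_poly cfract D) (to_fract (rs A) / to_fract (rs B)) \<noteq> 0 \<and>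
      x * poly (map_poly cfract D) (to_fract (rs A) / to_fract (rs B)) = poly (map_poly cfract N) (to_fract (rs A) / to_fract (rs B))"
    by (rule ex_generators) blast
  obtain g0 a b where ab: "A = g0 * a" "B = g0 * b" "\<And>r. prime_elem r \<Longrightarrow> \<not> (r dvd a \<and> r dvd b)"
    using ex_coprime_reduction[OF AB(3), of A] by blast
  show ?thesis by (rule ex_representation_aux[OF AB gen ab])
qed

end

section \<open>Characters of the centre\<close>

lemma mv_hom: "i < n \<Longrightarrow> M \<in> carrier_mat n n \<Longrightarrow> N \<in> carrier_mat n n \<Longrightarrow>
    (\<Sum>j<n. (M * N) $$ (i, j) * (x j :: complex)) = (\<Sum>k<n. M $$ (i, k) * (\<Sum>j<n. N $$ (k, j) * x j))"
proof -
  assume a: "i < n" "M \<in> carrier_mat n n" "N \<in> carrier_mat n n"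
  have "(M * N) $$ (i, j) = (\<Sum>k<n. M $$ (i, k) * N $$ (k, j))" if "j < n" for j
    using a that by (simp add: scalar_prod_def lessThan_atLeast0)
  then have "(\<Sum>j<n. (M * N) $$ (i, j) * x j) = (\<Sum>j<n. \<Sum>k<n. M $$ (i, k) * N $$ (k, j) * x j)"
    by (intro sum.cong refl) (simp add: sum_distrib_right)
  also have "\<dots> = (\<Sum>k<n. \<Sum>j<n. M $$ (i, k) * N $$ (k, j) * x j)" by (rule sum.swap)
  finally show ?thesis by (simp add: sum_distrib_left mult.assoc)
qed

text \<open>Coordinates from \<open>n\<close> on stay fixed, so that the unit matrix acts as the
  identity on all of \<open>cfun\<close>.\<close>

definition lin_of_mat :: "nat \<Rightarrow> complex mat \<Rightarrow> cfun \<Rightarrow> cfun" where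
  "lin_of_mat n M x = (\<lambda>i. if i < n then \<Sum>j<n. M $$ (i, j) * x j else x i)"

lemma polyop_lin_of_mat: "polyop (lin_of_mat n M)"
  unfolding polyop_def lin_of_mat_def
  by (intro exI[of _ "\<lambda>i. if i < n then \<Sum>j<n. Const (M $$ (i, j)) * Var j else Var i"])
    (simp add: ev.hom_sum ev.hom_mult)

lemma linop_lin_of_mat: "linop (lin_of_mat n M)"
  unfolding linop_def lin_of_mat_def
  by (auto simp: fun_eq_iff algebra_simps sum.distrib sum_distrib_left)

lemma lin_of_mat_mult: "M \<in> carrier_mat n n \<Longrightarrow> N \<in> carrier_mat n n \<Longrightarrow>
    lin_of_mat n (M * N) x = lin_of_mat n M (lin_of_mat n N x)"
  by (intro ext) (simp add: lin_of_mat_def mv_hom del: index_mult_mat)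

lemma lin_of_mat_one: "lin_of_mat n (1\<^sub>m n) x = x"
proof
  fix i
  have "(\<Sum>j<n. 1\<^sub>m n $$ (i, j) * x j) = x i" if "i < n"
  proof -
    have "(\<Sum>j<n. 1\<^sub>m n $$ (i, j) * x j) = (\<Sum>j<n. if j = i then x j else 0)"
      using that by (intro sum.cong) auto
    then show ?thesis using that by simp
  qed
  then show "lin_of_mat n (1\<^sub>m n) x i = x i" by (simp add: lin_of_mat_def)
qed

section \<open>Projections and characters attached to the centre\<close>

context poly_action
begin

definition exponent :: nat where
  "exponent = (SOME e. e > 0 \<and> (\<forall>g\<in>carrier G. g [^] e = \<one>))"

lemma exponent: "exponent > 0" "g \<in> carrier G \<Longrightarrow> g [^] exponent = \<one>"
  using someI_ex[OF finite_imp_exponent[OF fin]] by (auto simp: exponent_def)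

definition centre :: "'a set" where
  "centre = {z \<in> carrier G. \<forall>g\<in>carrier G. z \<otimes> g = g \<otimes> z}"

lemma centre_carrier: "centre \<subseteq> carrier G"
  by (auto simp: centre_def)

lemma centre_mult: "z \<in> centre \<Longrightarrow> w \<in> centre \<Longrightarrow> z \<otimes> w \<in> centre"
proof -
  assume z: "z \<in> centre" and w: "w \<in> centre"
  have c: "z \<in> carrier G" "w \<in> carrier G" using z w centre_carrier by auto
  have "z \<otimes> w \<otimes> g = g \<otimes> (z \<otimes> w)" if g: "g \<in> carrier G" for g
  proof -
    have "z \<otimes> w \<otimes> g = z \<otimes> (w \<otimes> g)" by (rule m_assoc[OF c g])
    also have "\<dots> = z \<otimes> (g \<otimes> w)" using w g by (simp add: centre_def)
    also have "\<dots> = z \<otimes> g \<otimes> w" by (rule m_assoc[OF c(1) g c(2), symmetric])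
    also have "\<dots> = g \<otimes> z \<otimes> w" using z g by (simp add: centre_def)
    also have "\<dots> = g \<otimes> (z \<otimes> w)" by (rule m_assoc[OF g c])
    finally show ?thesis .
  qed
  then show ?thesis using c by (simp add: centre_def)
qed

lemma L_pow: "g \<in> carrier G \<Longrightarrow> (L g ^^ k) x = L (g [^] (k::nat)) x"
  by (induction k arbitrary: x) (simp_all add: L_one L_mult funpow_Suc_right del: funpow.simps(2))

definition proj :: "'a \<times> nat \<Rightarrow> cfun \<Rightarrow> cfun" where
  "proj zi = isotypic (L (fst zi)) exponent (snd zi)"

definition indices :: "('a \<times> nat) set" where
  "indices = centre \<times> {..<exponent}"

lemma L_funpow_exponent: "z \<in> carrier G \<Longrightarrow> (L z ^^ exponent) x = x"
  by (simp add: L_pow exponent L_one)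

lemma L_centre_commute: "z \<in> centre \<Longrightarrow> g \<in> carrier G \<Longrightarrow> L g (L z x) = L z (L g x)"
  using centre_carrier by (auto simp: L_mult[symmetric] centre_def)

lemma proj_props:
  assumes "zi \<in> indices"
  shows "polyop (proj zi)" "linop (proj zi)" "proj zi (proj zi x) = proj zi x"
    "g \<in> carrier G \<Longrightarrow> L g (proj zi x) = proj zi (L g x)"
proof -
  have z: "fst zi \<in> carrier G" "fst zi \<in> centre" "snd zi < exponent"
    using assms centre_carrier by (auto simp: indices_def)
  show "polyop (proj zi)" unfolding proj_def by (rule polyop_isotypic[OF pol[OF z(1)]])
  show "linop (proj zi)" unfolding proj_def by (rule linop_isotypic[OF lin[OF z(1)]])
  show "proj zi (proj zi x) = proj zi x" unfolding proj_def
    using isotypic_orthogonal[OF lin[OF z(1)] L_funpow_exponent[OF z(1)] exponent(1) z(3) z(3)] by simp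
  show "L g (proj zi x) = proj zi (L g x)" if "g \<in> carrier G" unfolding proj_def
    by (rule isotypic_commute[OF lin[OF that]]) (rule L_centre_commute[OF z(2) that])
qed

lemma proj_commute:
  assumes "zi \<in> indices" "wj \<in> indices"
  shows "proj zi (proj wj x) = proj wj (proj zi x)"
proof -
  have w: "fst wj \<in> carrier G" using assms centre_carrier by (auto simp: indices_def)
  show ?thesis unfolding proj_def[of wj]
    by (rule isotypic_commute[OF proj_props(2)[OF assms(1)]]) (rule proj_props(4)[OF assms(1) w, symmetric])
qed

lemma proj_one: "proj (\<one>, 0) = (\<lambda>x. x)"
proof -
  have "L \<one> = (\<lambda>x. x)" by (intro ext) (simp add: L_one)
  then show ?thesis by (simp add: proj_def isotypic_id exponent)
qed

lemma one_index: "(\<one>, 0) \<in> indices"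
  by (auto simp: indices_def centre_def exponent)

text \<open>The scalar by which a central \<open>z\<close> acts on polynomials of multidegree
  \<alpha>. Exponents are integers because differences of multidegrees occur.\<close>

definition chi :: "('a \<times> nat \<Rightarrow> int) \<Rightarrow> 'a \<Rightarrow> complex" where
  "chi \<alpha> z = (\<Prod>i<exponent. (prim_root exponent ^ i) powi \<alpha> (z, i))"

lemma chi_zero: "chi (\<lambda>_. 0) z = 1"
  by (simp add: chi_def)

lemma chi_add: "chi (\<lambda>i. \<alpha> i + \<beta> i) z = chi \<alpha> z * chi \<beta> z"
  by (simp add: chi_def power_int_add prod.distrib)

lemma chi_diff: "chi (\<lambda>i. \<alpha> i - \<beta> i) z = chi \<alpha> z / chi \<beta> z"
  by (simp add: chi_def power_int_diff prod_dividef)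

lemma chi_mult: "chi (\<lambda>i. n * \<alpha> i) z = chi \<alpha> z powi n"
proof -
  have "(\<Prod>i<k. f i powi n) = (\<Prod>i<k. f i) powi n" for k and f :: "nat \<Rightarrow> complex"
    by (induction k) (simp_all add: power_int_mult_distrib)
  then show ?thesis by (simp add: chi_def power_int_mult mult.commute[of n])
qed

lemma chi_nz: "chi \<alpha> z \<noteq> 0"
  by (simp add: chi_def)

end

section \<open>The lattice of multidegrees and its rank\<close>

locale homogeneous_family = poly_action +
  fixes \<V> :: "cpoly set set" and \<alpha> :: "cpoly set \<Rightarrow> 'a \<times> nat \<Rightarrow> nat" and bs :: "cpoly set \<Rightarrow> cpoly"
  assumes fam: "family \<V>"
    and hom: "V \<in> \<V> \<Longrightarrow> zi \<in> indices \<Longrightarrow> f \<in> V \<Longrightarrow> homog (proj zi) (\<alpha> V zi) f"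
    and outside: "V \<in> \<V> \<Longrightarrow> zi \<notin> indices \<Longrightarrow> \<alpha> V zi = 0"
    and bs: "V \<in> \<V> \<Longrightarrow> bs V \<in> V" "V \<in> \<V> \<Longrightarrow> bs V \<noteq> 0"
begin

lemma act_eq_imp_eq:
  assumes "g \<in> carrier G" "k \<in> carrier G" "\<And>V f. V \<in> \<V> \<Longrightarrow> f \<in> V \<Longrightarrow> act g f = act k f"
  shows "g = k"
proof -
  have "act (g \<otimes> inv k) f = f" if "V \<in> \<V>" "f \<in> V" for V f
    using assms(3)[OF that] act_act[of "inv k" g f] act_inv'[of k f] assms(1,2) by simp
  then have "g \<otimes> inv k = \<one>" using family_faithful[OF fam, of "g \<otimes> inv k"] assms(1,2) by blast
  then show ?thesis using assms(1,2) inv_equality inv_inv by (metis inv_closed)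
qed

text \<open>Being scalar on every member, \<open>g\<close> commutes with the action of each
  \<open>k\<close> there; joint faithfulness carries this over to the group.\<close>

lemma scalar_imp_centre:
  assumes g: "g \<in> carrier G" and sc: "\<And>V. V \<in> \<V> \<Longrightarrow> \<exists>c. \<forall>f\<in>V. act g f = Const c * f"
  shows "g \<in> centre"
  unfolding centre_def
proof (intro CollectI conjI ballI g)
  fix k assume k: "k \<in> carrier G"
  show "g \<otimes> k = k \<otimes> g"
  proof (rule act_eq_imp_eq)
    fix V f assume V: "V \<in> \<V>" and f: "f \<in> V"
    obtain c where c: "\<And>f. f \<in> V \<Longrightarrow> act g f = Const c * f" using sc[OF V] by blast
    have "act k (act g f) = act g (act k f)"
      using c[OF f] c[OF family_stable[OF fam V k f]] by (simp add: pull.hom_mult)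
    then show "act (g \<otimes> k) f = act (k \<otimes> g) f" using g k by (simp add: act_act)
  qed (use g k in auto)
qed

lemma act_centre:
  assumes V: "V \<in> \<V>" and z: "z \<in> centre" and f: "f \<in> V"
  shows "act z f = Const (chi (\<lambda>i. int (\<alpha> V i)) z) * f"
proof -
  have zc: "z \<in> carrier G" using z centre_carrier by blast
  have "homog (isotypic (L z) exponent i) (\<alpha> V (z, i)) f" if "i < exponent" for i
    using hom[OF V _ f, of "(z, i)"] that z by (simp add: indices_def proj_def)
  then have "act z f = Const (\<Prod>i<exponent. (prim_root exponent ^ i) ^ \<alpha> V (z, i)) * f"
    by (rule pull_eq_if_homog[OF lin[OF zc] L_funpow_exponent[OF zc] exponent(1) pol[OF zc]])
  then show ?thesis by (simp add: chi_def)
qed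

definition lat :: "('a \<times> nat \<Rightarrow> int) set" where
  "lat = int_span ((\<lambda>V i. int (\<alpha> V i)) ` \<V>)"

lemma lat_lattice: "int_lattice lat"
  unfolding lat_def by (rule int_lattice_int_span)

text \<open>Multiplicativity is not formal, since the weights at \<open>z\<close>, at
  \<open>w\<close> and at their product are a priori unrelated. It comes from the action on the
  nonzero \<open>bs V\<close>.\<close>

lemma lat_character: "x \<in> lat \<Longrightarrow> character_on centre (chi x)"
  unfolding lat_def
proof (induction rule: int_span.induct)
  case int_span_zero
  then show ?case by (simp add: character_on_def chi_zero)
next
  have *: "character_on centre (chi y)" if y: "y \<in> (\<lambda>V i. int (\<alpha> V i)) ` \<V>" for y
  proof -
    obtain V where V: "V \<in> \<V>" "y = (\<lambda>i. int (\<alpha> V i))" using y by blast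
    have "chi y (z \<otimes> w) = chi y z * chi y w" if zw: "z \<in> centre" "w \<in> centre" for z w
    proof -
      have zc: "z \<in> carrier G" "w \<in> carrier G" using zw centre_carrier by auto
      have "Const (chi y (z \<otimes> w)) * bs V = act (z \<otimes> w) (bs V)"
        using act_centre[OF V(1) centre_mult[OF zw] bs(1)[OF V(1)]] V(2) by simp
      also have "\<dots> = act w (act z (bs V))" using zc by (simp add: act_act)
      also have "\<dots> = Const (chi y z * chi y w) * bs V"
        using act_centre[OF V(1) zw(1) bs(1)[OF V(1)]] act_centre[OF V(1) zw(2) bs(1)[OF V(1)]] V(2)
        by (simp add: pull.hom_mult Const.hom_mult mult_ac)
      finally show ?thesis using bs(2)[OF V(1)] by simp
    qed
    then show ?thesis by (simp add: character_on_def chi_nz)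
  qed
  {
    case (int_span_add x y)
    then show ?case using character_on_mult[OF int_span_add.IH *[OF int_span_add.hyps(2)]] by (simp add: chi_add)
  next
    case (int_span_diff x y)
    then show ?case using *[OF int_span_diff.hyps(2)] by (auto simp: character_on_def chi_diff chi_nz)
  }
qed

lemma trivial_if_chi_trivial:
  assumes "z \<in> centre" "\<And>x. x \<in> lat \<Longrightarrow> chi x z = 1"
  shows "z = \<one>"
proof -
  have "act z f = f" if "V \<in> \<V>" "f \<in> V" for V f
    using act_centre[OF that(1) assms(1) that(2)] assms(2)[of "\<lambda>i. int (\<alpha> V i)"] that(1)
    by (simp add: lat_def int_span_base)
  then show ?thesis using family_faithful[OF fam] assms(1) centre_carrier by blast
qed

lemma chi_inj_onI:
  assumes "character_on centre c" "\<And>z. z \<in> centre \<Longrightarrow> c z = 1 \<Longrightarrow> z = \<one>"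
  shows "inj_on c centre"
proof (rule inj_onI)
  fix z w assume z: "z \<in> centre" and w: "w \<in> centre" and e: "c z = c w"
  have wc: "w \<in> carrier G" "z \<in> carrier G" using w z centre_carrier by auto
  have iw: "inv w \<in> centre" unfolding centre_def
  proof (intro CollectI conjI ballI)
    fix g assume g: "g \<in> carrier G"
    have "w \<otimes> (inv w \<otimes> g) = w \<otimes> (g \<otimes> inv w)"
    proof -
      have "w \<otimes> (inv w \<otimes> g) = g" using wc g by (simp add: m_assoc[symmetric])
      moreover have "w \<otimes> (g \<otimes> inv w) = (w \<otimes> g) \<otimes> inv w" using wc g by (simp add: m_assoc)
      moreover have "\<dots> = (g \<otimes> w) \<otimes> inv w" using w g by (simp add: centre_def)
      moreover have "\<dots> = g" using wc g by (simp add: m_assoc)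
      ultimately show ?thesis by simp
    qed
    then show "inv w \<otimes> g = g \<otimes> inv w" using wc g by (metis Units_eq Units_l_cancel inv_closed m_closed)
  qed (use wc in simp)
  have "c (z \<otimes> inv w) = c (w \<otimes> inv w)" using assms(1) z w iw e by (simp add: character_on_def)
  also have "\<dots> = 1" using character_on_one[OF assms(1)] wc by (simp add: centre_def)
  finally have "z \<otimes> inv w = \<one>" using assms(2) centre_mult[OF z iw] by blast
  then show "z = w" using wc by (metis inv_closed inv_equality inv_inv)
qed

lemma euler: "V \<in> \<V> \<Longrightarrow> f \<in> V \<Longrightarrow> zi \<in> indices \<Longrightarrow> dd f x (proj zi x) = of_nat (\<alpha> V zi) * ev x f"
  by (rule dd_homog[OF proj_props(1) hom])

text \<open>In the directions \<open>proj i x\<close>, \<open>proj j x\<close>,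
  \<open>proj k x\<close> Euler's identity turns each derivative into a weight times a value. The
  vanishing minor is thus the determinant of weights times a nonzero product of values.\<close>

lemma det_zero:
  assumes V: "V \<in> \<V>" "V' \<in> \<V>" "V'' \<in> \<V>"
  shows "int_det3 (\<lambda>i. int (\<alpha> V i)) (\<lambda>i. int (\<alpha> V' i)) (\<lambda>i. int (\<alpha> V'' i)) i j k = 0"
proof (cases "i \<in> indices \<and> j \<in> indices \<and> k \<in> indices")
  case True
  have "bs V * bs V' * bs V'' \<noteq> 0" using bs V by simp
  then obtain x where x: "ev x (bs V * bs V' * bs V'') \<noteq> 0" using cpoly_eqI[of "bs V * bs V' * bs V''" 0] by auto
  have "jac (bs V) (bs V') (bs V'') x (proj i x) (proj j x) (proj k x) = 0"
    using family_jac[OF fam] bs V by blast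
  then have "of_int (int_det3 (\<lambda>i. int (\<alpha> V i)) (\<lambda>i. int (\<alpha> V' i)) (\<lambda>i. int (\<alpha> V'' i)) i j k)
      * (ev x (bs V) * ev x (bs V') * ev x (bs V'')) = 0"
    using True V bs by (simp add: jac_def euler int_det3_def algebra_simps)
  then show ?thesis using x by (simp add: ev.hom_mult)
next
  case False
  then consider "i \<notin> indices" | "j \<notin> indices" | "k \<notin> indices" by blast
  then show ?thesis by cases (simp_all add: int_det3_def outside V)
qed

text \<open>As \<open>f1\<close> and \<open>f2\<close> have equal weights, the combination of their
  minors weighted by the values kills the Euler entries in the first row. What remains is the 2x2
  minor of weights times the derivative of \<open>f2 / f1\<close> in a direction where it is
  nonzero, up to nonzero factors.\<close>

lemma minors_zero:
  assumes V: "V \<in> \<V>" "V' \<in> \<V>" and W: "W \<in> \<V>" "f1 \<in> W" "f2 \<in> W"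
    and W2: "\<And>c. f2 \<noteq> Const c * f1" "f1 \<noteq> 0"
  shows "int (\<alpha> V i) * int (\<alpha> V' j) = int (\<alpha> V j) * int (\<alpha> V' i)"
proof (cases "i \<in> indices \<and> j \<in> indices")
  case True
  have "bs V * bs V' \<noteq> 0" using bs V by simp
  then obtain x v where x: "ev x (bs V * bs V') \<noteq> 0" "ev x f1 \<noteq> 0" "ev x f1 * dd f2 x v - ev x f2 * dd f1 x v \<noteq> 0"
    using ex_base_point[of "bs V * bs V'" f1 f2] W2 by metis
  let ?j = "\<lambda>f. jac f (bs V) (bs V') x v (proj i x) (proj j x)"
  have "?j f1 = 0" "?j f2 = 0" using family_jac[OF fam] bs V W by blast+
  then have "ev x f1 * ?j f2 - ev x f2 * ?j f1 = 0" by simp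
  then have "(ev x f1 * dd f2 x v - ev x f2 * dd f1 x v) * (ev x (bs V) * ev x (bs V'))
      * of_int (int (\<alpha> V i) * int (\<alpha> V' j) - int (\<alpha> V j) * int (\<alpha> V' i)) = 0"
    using True V W bs by (simp add: jac_def euler algebra_simps)
  then have "of_int (int (\<alpha> V i) * int (\<alpha> V' j) - int (\<alpha> V j) * int (\<alpha> V' i)) = (0 :: complex)"
    using x by (simp add: ev.hom_mult del: of_int_diff of_int_mult)
  then show ?thesis by (simp del: of_int_diff of_int_mult)
next
  case False
  then consider "i \<notin> indices" | "j \<notin> indices" by blast
  then show ?thesis by cases (simp_all add: outside V)
qed

lemma embeds_if_one_dimensional:
  assumes one: "\<And>V f. V \<in> \<V> \<Longrightarrow> f \<in> V \<Longrightarrow> \<exists>c. f = Const c * bs V"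
  shows "\<exists>H. subgroup H (GL 2) \<and> G \<cong> (GL 2)\<lparr>carrier := H\<rparr>"
proof -
  have "g \<in> centre" if g: "g \<in> carrier G" for g
  proof (rule scalar_imp_centre[OF g])
    fix V assume V: "V \<in> \<V>"
    obtain c where c: "act g (bs V) = Const c * bs V" using one[OF V family_stable[OF fam V g bs(1)[OF V]]] by blast
    have "act g f = Const c * f" if f: "f \<in> V" for f
    proof -
      obtain d where "f = Const d * bs V" using one[OF V f] by blast
      then show ?thesis using c by (simp add: pull.hom_mult mult.left_commute)
    qed
    then show "\<exists>c. \<forall>f\<in>V. act g f = Const c * f" by blast
  qed
  then have cen: "centre = carrier G" using centre_carrier by blast
  have "\<exists>d\<in>lat. \<exists>d'\<in>lat. \<forall>x\<in>lat. \<exists>m n. \<forall>i. x i = m * d i + n * d' i"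
  proof (rule int_lattice_rank_2[OF lat_lattice])
    show "int_det3 x y z i j k = 0" if "x \<in> lat" "y \<in> lat" "z \<in> lat" for x y z i j k
      using that unfolding lat_def by (rule int_span_minors_3[rotated -3]) (auto intro: det_zero)
  qed
  \<comment> \<open>Every \<open>chi x\<close> is a product of powers of \<open>chi d\<close> and
    \<open>chi d'\<close>, so these two separate the elements of the centre, which is all of
    \<open>G\<close> here.\<close>
  then obtain d d' where d: "d \<in> lat" "d' \<in> lat" "\<forall>x\<in>lat. \<exists>m n. \<forall>i. x i = m * d i + n * d' i" by blast
  have ch: "character_on (carrier G) (chi d)" "character_on (carrier G) (chi d')"
    using lat_character d(1,2) cen by auto
  define M where "M g = mat_of_rows_list 2 [[chi d g, 0], [0, chi d' g]]" for g
  have Mc: "M g \<in> carrier_mat 2 2" for g by (auto simp: M_def mat_of_rows_list_def)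
  have Mi: "M g $$ (0, 0) = chi d g" "M g $$ (0, 1) = 0" "M g $$ (1, 0) = 0" "M g $$ (1, 1) = chi d' g" for g
    by (simp_all add: M_def mat_of_rows_list_def)
  have eqI: "X = Y" if "X \<in> carrier_mat 2 2" "Y \<in> carrier_mat 2 2" "X $$ (0,0) = Y $$ (0,0)" "X $$ (0,1) = Y $$ (0,1)"
    "X $$ (1,0) = Y $$ (1,0)" "X $$ (1,1) = Y $$ (1,1)" for X Y :: "complex mat"
    using that by (intro eq_matI) (auto simp: less_2_cases_iff)
  have prod: "(M g * M k) $$ (i, j) = M g $$ (i, 0) * M k $$ (0, j) + M g $$ (i, 1) * M k $$ (1, j)" if "i < 2" "j < 2" for i j g k
    using that Mc[of g] Mc[of k] by (simp add: scalar_prod_def numeral_2_eq_2)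
  have "matrix_rep M"
    unfolding matrix_rep_def
  proof (intro conjI ballI Mc)
    show "M \<one> = 1\<^sub>m 2" using ch by (intro eqI Mc) (auto simp: Mi character_on_one simp del: One_nat_def)
    fix g k assume "g \<in> carrier G" "k \<in> carrier G"
    then show "M (g \<otimes> k) = M g * M k"
      using ch by (intro eqI Mc mult_carrier_mat[OF Mc Mc]) (auto simp: prod Mi character_on_def simp del: One_nat_def)
  qed
  then show ?thesis
  proof (rule embeds_if_faithful_matrix_rep)
    fix g assume g: "g \<in> carrier G" and "M g = 1\<^sub>m 2"
    then have "chi d g = 1" "chi d' g = 1" using Mi[of g] by auto
    then have "chi x g = 1" if x: "x \<in> lat" for x
    proof -
      obtain m n where "\<forall>i. x i = m * d i + n * d' i" using d(3) x by blast
      then have "x = (\<lambda>i. m * d i + n * d' i)" by auto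
      then show ?thesis using \<open>chi d g = 1\<close> \<open>chi d' g = 1\<close>
        using chi_add[of "\<lambda>i. m * d i" "\<lambda>i. n * d' i" g] chi_mult[of m d g] chi_mult[of n d' g] by simp
    qed
    then show "g = \<one>" using trivial_if_chi_trivial g cen by blast
  qed
qed

lemma embeds_if_not_one_dimensional:
  assumes W: "W \<in> \<V>" "f1 \<in> W" "f2 \<in> W" and W2: "\<And>c. f2 \<noteq> Const c * f1" "f1 \<noteq> 0"
  shows "\<exists>H. subgroup H (GL 2) \<and> G \<cong> (GL 2)\<lparr>carrier := H\<rparr>"
proof -
  have "\<exists>d\<in>lat. \<forall>x\<in>lat. \<exists>n. \<forall>i. x i = n * d i"
  proof (rule int_lattice_rank_1[OF lat_lattice])
    show "x i * y j = x j * y i" if "x \<in> lat" "y \<in> lat" for x y i j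
      using that unfolding lat_def by (rule int_span_minors_2[rotated -2]) (auto intro: minors_zero[OF _ _ W W2])
  qed
  then obtain d where d: "d \<in> lat" "\<forall>x\<in>lat. \<exists>n. \<forall>i. x i = n * d i" by blast
  have chd: "character_on centre (chi d)" by (rule lat_character[OF d(1)])
  have inj: "inj_on (chi d) centre"
  proof (rule chi_inj_onI[OF chd], rule trivial_if_chi_trivial)
    fix z x assume "chi d z = 1" "x \<in> lat"
    then obtain n where "\<forall>i. x i = n * d i" using d(2) by blast
    then have "x = (\<lambda>i. n * d i)" by auto
    then show "chi x z = 1" using \<open>chi d z = 1\<close> by (simp add: chi_mult)
  qed
  have fin\<V>: "finite \<V>" by (rule family_finite[OF fam])
  have "(\<Prod>V\<in>\<V>. bs V) \<noteq> 0" using fin\<V> bs by simp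
  then obtain p q where pq: "ev p (\<Prod>V\<in>\<V>. bs V) \<noteq> 0" "ev p f1 \<noteq> 0" "ev p f1 * dd f2 p q - ev p f2 * dd f1 p q \<noteq> 0"
    using ex_base_point[of "\<Prod>V\<in>\<V>. bs V" f1 f2] W2 by metis
  have hom1: "homog (\<lambda>x. x) (\<alpha> V (\<one>, 0)) f" if "V \<in> \<V>" "f \<in> V" for V f
    using hom[OF that(1) one_index that(2)] by (simp add: proj_one)
  \<comment> \<open>The index \<open>(\<one>, 0)\<close> selects the ordinary degree among the
    weights.\<close>
  interpret pencil G L \<V> "\<lambda>V. \<alpha> V (\<one>, 0)" bs W f1 f2 p q
    by unfold_locales (use fam hom1 bs W pq fin\<V> in \<open>auto simp: ev.hom_prod\<close>)
  obtain M \<chi> where rep: "matrix_rep M"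
    and char: "\<forall>V\<in>\<V>. character_on (carrier G) (\<chi> V)"
    and scal: "\<forall>g\<in>carrier G. \<forall>V\<in>\<V>. \<forall>l. M g = l \<cdot>\<^sub>m 1\<^sub>m 2 \<longrightarrow> (\<exists>c. \<forall>f\<in>V. act g f = Const c * f)"
    and faithful: "\<forall>g\<in>carrier G. M g = 1\<^sub>m 2 \<longrightarrow> (\<forall>V\<in>\<V>. \<chi> V g = 1) \<longrightarrow> g = \<one>"
    using ex_representation by (elim exE conjE)
  define S where "S = {g \<in> carrier G. \<exists>l. M g = l \<cdot>\<^sub>m 1\<^sub>m 2}"
  \<comment> \<open>This brings the elements acting as scalars under the single faithful character
    \<open>chi d\<close>.\<close>
  have "S \<subseteq> centre"
  proof
    fix g assume "g \<in> S"
    then obtain l where "g \<in> carrier G" "M g = l \<cdot>\<^sub>m 1\<^sub>m 2" by (auto simp: S_def)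
    then show "g \<in> centre" using scal by (intro scalar_imp_centre) blast+
  qed
  then have \<theta>: "character_on S (chi d)" "inj_on (chi d) S"
    using chd inj character_on_mono inj_on_subset by blast+
  show ?thesis
  proof (rule embeds_if_faithful_up_to_characters[OF fin rep fin\<V> _ S_def \<theta>])
    show "character_on (carrier G) (\<chi> V)" if "V \<in> \<V>" for V using char that by blast
    show "g = \<one>" if "g \<in> carrier G" "M g = 1\<^sub>m 2" "\<And>V. V \<in> \<V> \<Longrightarrow> \<chi> V g = 1" for g
      using faithful that by blast
  qed
qed

end

section \<open>From a family, and from a covariant, to the embedding\<close>

theorem (in poly_action) embeds_if_family:
  assumes "family \<W>"
  shows "\<exists>H. subgroup H (GL 2) \<and> G \<cong> (GL 2)\<lparr>carrier := H\<rparr>"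
proof -
  have finI: "finite (proj ` indices)"
    using finite_subset[OF centre_carrier fin] by (simp add: indices_def)
  have "\<exists>\<V>. family \<V> \<and> (\<forall>V\<in>\<V>. \<forall>\<pi>\<in>proj ` indices. \<exists>k. \<forall>f\<in>V. homog \<pi> k f)"
    by (rule ex_homogeneous_family[OF finI assms]) (auto simp: proj_props intro: proj_commute)
  then obtain \<V>0 where V0: "family \<V>0" "\<And>V zi. V \<in> \<V>0 \<Longrightarrow> zi \<in> indices \<Longrightarrow> \<exists>k. \<forall>f\<in>V. homog (proj zi) k f"
    by blast
  \<comment> \<open>Zero spaces offer no nonzero \<open>bs V\<close>; every element acts trivially
    on them, so discarding them preserves faithfulness.\<close>
  define \<V> where "\<V> = {V \<in> \<V>0. \<exists>f\<in>V. f \<noteq> 0}"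
  have fam: "family \<V>"
    unfolding family_def
  proof (intro conjI ballI allI impI)
    show "finite \<V>" using family_finite[OF V0(1)] by (simp add: \<V>_def)
    show "cpoly.subspace V" "\<exists>F. finite F \<and> V \<subseteq> cpoly.span F" if "V \<in> \<V>" for V
      using family_subspace[OF V0(1)] family_finite_dim[OF V0(1)] that by (auto simp: \<V>_def)
    show "act g f \<in> V" if "V \<in> \<V>" "g \<in> carrier G" "f \<in> V" for V g f
      using family_stable[OF V0(1) _ that(2,3)] that(1) by (auto simp: \<V>_def)
    show "g = \<one>" if "g \<in> carrier G" "\<forall>V\<in>\<V>. \<forall>f\<in>V. act g f = f" for g
    proof (rule family_faithful[OF V0(1) that(1)])
      show "act g f = f" if "V \<in> \<V>0" "f \<in> V" for V f
        using that \<open>\<forall>V\<in>\<V>. \<forall>f\<in>V. act g f = f\<close> by (cases "f = 0") (auto simp: \<V>_def)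
    qed
    show "jac f g h x u v w = 0" if "f \<in> \<Union>\<V>" "g \<in> \<Union>\<V>" "h \<in> \<Union>\<V>" for f g h x u v w
    proof -
      have "\<Union>\<V> \<subseteq> \<Union>\<V>0" by (auto simp: \<V>_def)
      then show ?thesis by (intro family_jac[OF V0(1)] subsetD[OF _ that(1)] subsetD[OF _ that(2)] subsetD[OF _ that(3)])
    qed
  qed
  have "\<exists>\<alpha>. \<forall>V zi. V \<in> \<V> \<longrightarrow> (zi \<in> indices \<longrightarrow> (\<forall>f\<in>V. homog (proj zi) (\<alpha> V zi) f)) \<and> (zi \<notin> indices \<longrightarrow> \<alpha> V zi = 0)"
  proof -
    have "\<forall>V zi. \<exists>k. V \<in> \<V> \<longrightarrow> (zi \<in> indices \<longrightarrow> (\<forall>f\<in>V. homog (proj zi) k f)) \<and> (zi \<notin> indices \<longrightarrow> k = 0)"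
      using V0(2) unfolding \<V>_def by blast
    then show ?thesis by metis
  qed
  then obtain \<alpha> where \<alpha>: "\<And>V zi f. V \<in> \<V> \<Longrightarrow> zi \<in> indices \<Longrightarrow> f \<in> V \<Longrightarrow> homog (proj zi) (\<alpha> V zi) f"
    "\<And>V zi. V \<in> \<V> \<Longrightarrow> zi \<notin> indices \<Longrightarrow> \<alpha> V zi = 0" by metis
  have "\<forall>V\<in>\<V>. \<exists>f. f \<in> V \<and> f \<noteq> 0" by (auto simp: \<V>_def)
  then obtain bs where bs: "\<And>V. V \<in> \<V> \<Longrightarrow> bs V \<in> V" "\<And>V. V \<in> \<V> \<Longrightarrow> bs V \<noteq> 0" by metis
  interpret homogeneous_family G L \<V> \<alpha> bs
    by unfold_locales (use fam \<alpha> bs in auto)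
  show ?thesis
  proof (cases "\<forall>V\<in>\<V>. \<forall>f\<in>V. \<exists>c. f = Const c * bs V")
    case True
    then show ?thesis by (intro embeds_if_one_dimensional) blast
  next
    case False
    then obtain V f where "V \<in> \<V>" "f \<in> V" "\<And>c. f \<noteq> Const c * bs V" by blast
    then show ?thesis using embeds_if_not_one_dimensional bs by metis
  qed
qed

theorem theorem10p2:
  fixes G (structure)
  assumes "group G" and "finite (carrier G)"
    and "covdim G = 2"
  shows "\<exists>H. subgroup H (GL 2) \<and> G \<cong> (GL 2)\<lparr>carrier := H\<rparr>"
proof -
  interpret group G by fact
  define DD where "DD = {d. \<exists>n \<rho> m \<sigma> \<phi>. faithful_covariant G n \<rho> m \<sigma> \<phi> \<and> d = covariant_dim n m \<phi>}"
  have "Inf DD = 2" using assms(3) by (simp add: covdim_def DD_def)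
  \<comment> \<open>The infimum of the empty set is \<infinity>; a nonempty set attains its infimum,
    so a covariant of dimension exactly 2 exists.\<close>
  moreover have "DD \<noteq> {}"
  proof
    assume "DD = {}"
    then have "Inf DD = (\<infinity> :: enat)" by (simp add: top_enat_def)
    then show False using \<open>Inf DD = 2\<close> by simp
  qed
  ultimately have "2 \<in> DD" using wellorder_InfI[of _ DD] by (metis all_not_in_conv)
  then obtain n \<rho> m \<sigma> \<phi> where fc: "faithful_covariant G n \<rho> m \<sigma> \<phi>" and dim: "covariant_dim n m \<phi> = 2"
    unfolding DD_def by auto
  have cov: "covariant G n \<rho> m \<sigma> \<phi>" using fc by (simp add: faithful_covariant_def)
  have rho: "\<rho> \<in> hom G (GL n)" and sigma: "\<sigma> \<in> hom G (GL m)"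
    using cov by (simp_all add: covariant_def gmodule_def)
  obtain pp where "\<forall>j<m. pp j \<in> polynomials n"
    "\<forall>v\<in>carrier_vec n. \<phi> v = vec m (\<lambda>j. poly_eval v (pp j))"
    using cov unfolding covariant_def polynomial_map_def by blast
  then have pp: "\<And>j. j < m \<Longrightarrow> pp j \<in> polynomials n"
    "\<And>v. v \<in> carrier_vec n \<Longrightarrow> \<phi> v = vec m (\<lambda>j. poly_eval v (pp j))" by blast+
  have equiv: "\<phi> (\<rho> g *\<^sub>v v) = \<sigma> g *\<^sub>v \<phi> v" if "g \<in> carrier G" "v \<in> carrier_vec n" for g v
    using cov that by (simp add: covariant_def)
  have faithful: "g = \<one>" if "g \<in> carrier G" "\<And>v. v \<in> carrier_vec n \<Longrightarrow> \<sigma> g *\<^sub>v \<phi> v = \<phi> v" for g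
    using fc that by (simp add: faithful_covariant_def)
  have GLc: "M \<in> carrier_mat k k" if "M \<in> carrier (GL k)" for M k
    using that by (auto simp: GL_def units_of_def Units_def ring_mat_def)
  have rc: "\<rho> g \<in> carrier_mat n n" if "g \<in> carrier G" for g using rho that GLc by (auto simp: hom_def)
  have sc: "\<sigma> g \<in> carrier_mat m m" if "g \<in> carrier G" for g using sigma that GLc by (auto simp: hom_def)
  have rm: "\<rho> (g \<otimes> k) = \<rho> g * \<rho> k" if "g \<in> carrier G" "k \<in> carrier G" for g k
    using rho that by (auto simp: hom_def GL_def units_of_def ring_mat_def)
  interpret R: ring "ring_mat TYPE(complex) n ()" by (rule ring_mat)
  have GLg: "group (GL n)" unfolding GL_def by (rule R.units_group)
  interpret rho: group_hom G "GL n" \<rho> by (intro group_hom.intro GLg group_axioms group_hom_axioms.intro rho)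
  have r1: "\<rho> \<one> = 1\<^sub>m n" using rho.hom_one by (simp add: GL_def units_of_def ring_mat_def)
  define L where "L g = lin_of_mat n (\<rho> g)" for g
  interpret poly_action G L
    by unfold_locales
      (simp_all add: L_def assms(2) polyop_lin_of_mat linop_lin_of_mat rm lin_of_mat_mult rc r1 lin_of_mat_one
        del: rho.hom_mult rho.hom_one)
  \<comment> \<open>By equivariance \<open>act g\<close> mixes the coordinate polynomials of \<phi>
    through the rows of \<open>\<sigma> g\<close>, so their span is stable.\<close>
  define W where "W = cpoly.span (pp ` {..<m})"
  have ev_pp: "ev x (pp j) = \<phi> (vec n x) $ j" if "j < m" for x j
    using that pp by (simp add: poly_eval_eq_ev) (rule ev_cong[OF pp(1)], auto)
  have act_pp: "act g (pp j) = (\<Sum>k<m. Const (\<sigma> g $$ (j, k)) * pp k)" if g: "g \<in> carrier G" and j: "j < m" for g j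
  proof (rule cpoly_eqI)
    fix x
    have "vec n (L g x) = \<rho> g *\<^sub>v vec n x"
      using rc[OF g] by (intro eq_vecI) (auto simp: L_def lin_of_mat_def scalar_prod_def lessThan_atLeast0)
    then have "ev x (act g (pp j)) = (\<sigma> g *\<^sub>v \<phi> (vec n x)) $ j"
      using equiv[OF g] j by (simp add: ev_pull pol[OF g] ev_pp)
    also have "\<dots> = (\<Sum>k<m. \<sigma> g $$ (j, k) * \<phi> (vec n x) $ k)"
      using sc[OF g] j pp(2)[of "vec n x"] by (simp add: scalar_prod_def lessThan_atLeast0)
    also have "\<dots> = ev x (\<Sum>k<m. Const (\<sigma> g $$ (j, k)) * pp k)"
      by (simp add: ev.hom_sum ev.hom_mult ev_pp)
    finally show "ev x (act g (pp j)) = ev x (\<Sum>k<m. Const (\<sigma> g $$ (j, k)) * pp k)" .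
  qed
  have jac_pp: "jac (pp i) (pp j) (pp k) x u v w = 0" if "i < m" "j < m" "k < m" for i j k x u v w
    using jac_eq_0_if_dim_le_2[OF pp _ that] dim by simp
  \<comment> \<open>Multilinearity extends the vanishing from the coordinate polynomials to their
    span, one argument at a time.\<close>
  have jac_lin: "jac (Const c * f + f') g h x u v w = c * jac f g h x u v w + jac f' g h x u v w"
    "jac g (Const c * f + f') h x u v w = c * jac g f h x u v w + jac g f' h x u v w"
    "jac g h (Const c * f + f') x u v w = c * jac g h f x u v w + jac g h f' x u v w"
    "jac 0 g h x u v w = 0" "jac g 0 h x u v w = 0" "jac g h 0 x u v w = 0" for c f f' g h x u v w
    unfolding jac_def dd_add dd_Const_mult by (simp_all add: algebra_simps)
  have jac1: "jac f g h x u v w = 0" if "f \<in> W" "g \<in> pp ` {..<m}" "h \<in> pp ` {..<m}" for f g h x u v w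
    using that(1) unfolding W_def by (induction rule: cpoly.span_induct_alt) (use that jac_pp in \<open>auto simp: jac_lin\<close>)
  have jac2: "jac f g h x u v w = 0" if "f \<in> W" "g \<in> W" "h \<in> pp ` {..<m}" for f g h x u v w
    using that(2) unfolding W_def by (induction rule: cpoly.span_induct_alt) (use that jac1 in \<open>auto simp: jac_lin\<close>)
  have jac3: "jac f g h x u v w = 0" if "f \<in> W" "g \<in> W" "h \<in> W" for f g h x u v w
    using that(3) unfolding W_def by (induction rule: cpoly.span_induct_alt) (use that jac2 in \<open>auto simp: jac_lin\<close>)
  have "family {W}"
    unfolding family_def
  proof (intro conjI ballI allI impI)
    show "cpoly.subspace V" "\<exists>F. finite F \<and> V \<subseteq> cpoly.span F" if "V \<in> {W}" for V
      using that by (auto simp: W_def intro!: exI[of _ "pp ` {..<m}"])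
    show "act g f \<in> V" if "V \<in> {W}" and g: "g \<in> carrier G" and "f \<in> V" for V g f
    proof -
      have "f \<in> cpoly.span (pp ` {..<m})" using that by (simp add: W_def)
      then have "act g f \<in> W"
      proof (induction rule: cpoly.span_induct_alt)
        case base
        then show ?case by (simp add: W_def cpoly.span_zero)
      next
        case (step c x y)
        then obtain j where j: "j < m" "x = pp j" by auto
        have "act g x \<in> W"
          unfolding j(2) act_pp[OF g j(1)] W_def by (intro cpoly.span_sum cpoly.span_scale cpoly.span_base) auto
        then show ?case using step(2) unfolding W_def
          by (simp add: pull.hom_add pull.hom_mult cpoly.span_add cpoly.span_scale)
      qed
      then show ?thesis using that by simp
    qed
    show "g = \<one>" if g: "g \<in> carrier G" and triv: "\<forall>V\<in>{W}. \<forall>f\<in>V. act g f = f" for g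
    proof (rule faithful[OF g])
      fix v :: "complex vec" assume v: "v \<in> carrier_vec n"
      have \<phi>v: "\<phi> v \<in> carrier_vec m" using pp(2)[OF v] by simp
      show "\<sigma> g *\<^sub>v \<phi> v = \<phi> v"
      proof (rule eq_vecI)
        fix j assume "j < dim_vec (\<phi> v)"
        then have j: "j < m" using \<phi>v by simp
        have vv: "vec n (\<lambda>i. v $ i) = v" using v by auto
        have "pp j \<in> W" unfolding W_def using j by (intro cpoly.span_base) auto
        then have "act g (pp j) = pp j" using triv by blast
        then have "ev (\<lambda>i. v $ i) (\<Sum>k<m. Const (\<sigma> g $$ (j, k)) * pp k) = ev (\<lambda>i. v $ i) (pp j)"
          using act_pp[OF g j] by simp
        then have "(\<Sum>k<m. \<sigma> g $$ (j, k) * \<phi> v $ k) = \<phi> v $ j"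
          using j by (simp add: ev.hom_sum ev.hom_mult ev_pp vv)
        then show "(\<sigma> g *\<^sub>v \<phi> v) $ j = \<phi> v $ j"
          using sc[OF g] j \<phi>v by (simp add: scalar_prod_def lessThan_atLeast0)
      qed (use sc[OF g] \<phi>v in auto)
    qed
  qed (use jac3 in auto)
  then show ?thesis by (rule embeds_if_family)
qed

end
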